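(* Let $M$ be an untwisted hyperbolic punctured torus bundle with monodromy $h$ and fundamental group $\pi_1(M)\cong G\rtimes_{h_*}\mathbb{Z}$, where $G$ is the fundamental group of the punctured torus. Let $<$ be a bi-ordering of $\pi_1(M)$. Then: (1) The maximal convex subgroup of $\pi_1(M)$ with respect to $<$ is $G$. (2) Let $<_G$ be the bi-order on $G$ obtained by restricting $<$. The maximal convex subgroup of $G$ with respect to $<_G$ is $G_2=[G,G]$.
   Context: A bi-ordering of a group is a strict total order on its elements that is invariant under left and right multiplication. A subgroup $C$ of a bi-ordered group $(H,<)$ is convex with respect to $<$ if for all $a,b\in C$ and $g\in H$, $a<g<b$ implies $g\in C$. A convex subgroup $C$ is maximal if $C\neq H$ and the only convex subgroups of $H$ containing $C$ are $C$ and $H$ (such a subgroup is unique when it exists). Let $T$ be a compact oriented torus with one boundary component (the punctured torus), $x\in\partial T$ a base point and $G=\pi_1(T,x)$, a free group of rank 2. The punctured torus bundle with monodromy $h$, where $h\colon T\to T$ is an orientation-preserving homeomorphism fixing $\partial T$ pointwise, is $M=T\times[0,1]/((y,1)\sim(h(y),0))$. Let $h_*\in\mathrm{Aut}(G)$ be the induced automorphism and $h_+\in \mathrm{SL}(2,\mathbb{Z})$ the induced map on $H_1(T;\mathbb{Z})\cong\mathbb{Z}^2$. Then $\pi_1(M)\cong G\rtimes_{h_*}\mathbb{Z}$, and $G$ is regarded as the subgroup $G\times\{0\}$. The bundle is hyperbolic if $h$ is pseudo-Anosov (equivalently $|\mathrm{tr}\,h_+|>2$); a hyperbolic bundle is untwisted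 if the eigenvalues of $h_+$ are positive (equivalently $\mathrm{tr}\,h_+>2$) and twisted if they are negative. *)

theory Defs
  imports "HOL-Analysis.Analysis" "HOL-Algebra.Generated_Groups" "HOL-Homology.Homology"
begin

section \<open>Bi-orderings and convex subgroups\<close>

text \<open>A strict order on \<open>G\<close> is a relation contained in \<open>carrier G \<times> carrier G\<close>, so that
  transitivity and irreflexivity carry no condition outside the carrier.\<close>

definition bi_ordering :: "('a, 'b) monoid_scheme \<Rightarrow> 'a rel \<Rightarrow> bool" where
  "bi_ordering G r \<longleftrightarrow>
     r \<subseteq> carrier G \<times> carrier G \<and> strict_linear_order_on (carrier G) r \<and>
     (\<forall>a\<in>carrier G. \<forall>b\<in>carrier G. \<forall>g\<in>carrier G.
        (a, b) \<in> r \<longrightarrow> (g \<otimes>\<^bsub>G\<^esub> a, g \<otimes>\<^bsub>G\<^esub> b) \<in> r \<and> (a \<otimes>\<^bsub>G\<^esub> g, b \<otimes>\<^bsub>G\<^esub> g) \<in> r)"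

definition convex_subgroup :: "('a, 'b) monoid_scheme \<Rightarrow> 'a rel \<Rightarrow> 'a set \<Rightarrow> bool" where
  "convex_subgroup G r C \<longleftrightarrow>
     subgroup C G \<and>
     (\<forall>a\<in>C. \<forall>b\<in>C. \<forall>g\<in>carrier G. (a, g) \<in> r \<and> (g, b) \<in> r \<longrightarrow> g \<in> C)"

definition maximal_convex_subgroup :: "('a, 'b) monoid_scheme \<Rightarrow> 'a rel \<Rightarrow> 'a set \<Rightarrow> bool" where
  "maximal_convex_subgroup G r C \<longleftrightarrow>
     convex_subgroup G r C \<and> C \<noteq> carrier G \<and>
     (\<forall>D. convex_subgroup G r D \<and> C \<subseteq> D \<longrightarrow> D = C \<or> D = carrier G)"


section \<open>The fundamental group\<close>

text \<open>The library's \<open>homotopic_paths\<close> and \<open>joinpaths\<close> need the points to form a type of class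
  \<open>topological_space\<close>. The points of a mapping torus are equivalence classes, so the notions
  are given here for abstract topologies.\<close>

definition loops :: "'a topology \<Rightarrow> 'a \<Rightarrow> (real \<Rightarrow> 'a) set" where
  "loops X x = {p. pathin X p \<and> p 0 = x \<and> p 1 = x}"

definition loop_concat :: "(real \<Rightarrow> 'a) \<Rightarrow> (real \<Rightarrow> 'a) \<Rightarrow> real \<Rightarrow> 'a" where
  "loop_concat p q = (\<lambda>t. if t \<le> 1/2 then p (2 * t) else q (2 * t - 1))"

definition loop_class :: "'a topology \<Rightarrow> 'a \<Rightarrow> (real \<Rightarrow> 'a) \<Rightarrow> (real \<Rightarrow> 'a) set" where
  "loop_class X x p =
     {q. homotopic_with (\<lambda>r. r 0 = x \<and> r 1 = x) (top_of_set {0..1}) X p q}"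

text \<open>The unions below are unions of equal classes: the class does not depend on the chosen
  representatives.\<close>

definition fundamental_group :: "'a topology \<Rightarrow> 'a \<Rightarrow> (real \<Rightarrow> 'a) set monoid" where
  "fundamental_group X x =
     \<lparr>carrier = loop_class X x ` loops X x,
      monoid.mult = (\<lambda>a b. \<Union>p\<in>a. \<Union>q\<in>b. loop_class X x (loop_concat p q)),
      one = loop_class X x (\<lambda>_. x)\<rparr>"

definition fundamental_group_map ::
    "'b topology \<Rightarrow> 'b \<Rightarrow> ('a \<Rightarrow> 'b) \<Rightarrow> (real \<Rightarrow> 'a) set \<Rightarrow> (real \<Rightarrow> 'b) set" where
  "fundamental_group_map Y y f a = (\<Union>p\<in>a. loop_class Y y (f \<circ> p))"


section \<open>Mapping tori\<close>

definition quotient_topology :: "'a topology \<Rightarrow> ('a \<Rightarrow> 'b) \<Rightarrow> 'b topology" where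
  "quotient_topology X q =
     topology (\<lambda>U. U \<subseteq> q ` topspace X \<and> openin X {x \<in> topspace X. q x \<in> U})"

lemma openin_quotient_topology:
  "openin (quotient_topology X q) U \<longleftrightarrow>
     U \<subseteq> q ` topspace X \<and> openin X {x \<in> topspace X. q x \<in> U}"
proof -
  let ?P = "\<lambda>U. U \<subseteq> q ` topspace X \<and> openin X {x \<in> topspace X. q x \<in> U}"
  have int: "?P (S \<inter> T)" if "?P S" "?P T" for S T
  proof -
    have "{x \<in> topspace X. q x \<in> S \<inter> T} = {x \<in> topspace X. q x \<in> S} \<inter> {x \<in> topspace X. q x \<in> T}"
      by auto
    with that show ?thesis by (auto intro: openin_Int)
  qed
  have un: "?P (\<Union>K)" if "\<forall>S\<in>K. ?P S" for K
  proof -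
    have "{x \<in> topspace X. q x \<in> \<Union>K} = \<Union>((\<lambda>S. {x \<in> topspace X. q x \<in> S}) ` K)"
      by auto
    moreover have "openin X (\<Union>((\<lambda>S. {x \<in> topspace X. q x \<in> S}) ` K))"
      using that by (intro openin_Union) auto
    ultimately show ?thesis using that by auto
  qed
  have "istopology ?P"
    unfolding istopology_def using int un by blast
  then show ?thesis
    by (simp add: quotient_topology_def topology_inverse')
qed

lemma topspace_quotient_topology: "topspace (quotient_topology X q) = q ` topspace X"
proof -
  have "{x \<in> topspace X. q x \<in> q ` topspace X} = topspace X" by auto
  then have "openin (quotient_topology X q) (q ` topspace X)"
    by (simp add: openin_quotient_topology)
  then show ?thesis
    using openin_subset openin_quotient_topology openin_topspace by (metis subset_antisym)
qed

lemma quotient_map_quotient_topology: "quotient_map X (quotient_topology X q) q"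
  by (auto simp: quotient_map_def topspace_quotient_topology openin_quotient_topology)

text \<open>The class of a point of \<open>X \<times> [0,1]\<close> under the equivalence relation generated by
  \<open>(y, 1) \<sim> (h y, 0)\<close>.\<close>

definition mapping_torus_class :: "'a topology \<Rightarrow> ('a \<Rightarrow> 'a) \<Rightarrow> 'a \<times> real \<Rightarrow> ('a \<times> real) set" where
  "mapping_torus_class X h p =
     (let glue = {((y, 1), (h y, 0)) | y. y \<in> topspace X} in (glue \<union> glue\<inverse>)\<^sup>* `` {p})"

definition mapping_torus :: "'a topology \<Rightarrow> ('a \<Rightarrow> 'a) \<Rightarrow> ('a \<times> real) set topology" where
  "mapping_torus X h =
     quotient_topology (prod_topology X (top_of_set {0..1})) (mapping_torus_class X h)"


section \<open>Punctured torus bundles\<close>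

text \<open>The torus is \<open>S\<^sup>1 \<times> S\<^sup>1\<close> in \<open>\<complex>\<^sup>2\<close>. The distance ball removed is, in angular
  coordinates in \<open>(-\<pi>, \<pi>]\<close>, the convex disc \<open>cos a + cos b > 3/2\<close>.\<close>

definition punctured_torus_set :: "(complex \<times> complex) set" where
  "punctured_torus_set = (sphere 0 1 \<times> sphere 0 1) - ball (1, 1) 1"

definition punctured_torus_boundary :: "(complex \<times> complex) set" where
  "punctured_torus_boundary = (sphere 0 1 \<times> sphere 0 1) \<inter> sphere (1, 1) 1"

abbreviation punctured_torus :: "(complex \<times> complex) topology" where
  "punctured_torus \<equiv> top_of_set punctured_torus_set"

text \<open>A self-homeomorphism of a compact connected oriented surface with boundary preserves the
  orientation iff it fixes the fundamental class, a generator of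
  \<open>H\<^sub>2(T, \<partial>T; \<int>) \<cong> \<int>\<close>.\<close>

definition orientation_preserving :: "(complex \<times> complex \<Rightarrow> complex \<times> complex) \<Rightarrow> bool" where
  "orientation_preserving h \<longleftrightarrow>
     (\<forall>c \<in> carrier (relative_homology_group 2 punctured_torus punctured_torus_boundary).
        hom_induced 2 punctured_torus punctured_torus_boundary
          punctured_torus punctured_torus_boundary h c = c)"

definition is_monodromy :: "(complex \<times> complex \<Rightarrow> complex \<times> complex) \<Rightarrow> bool" where
  "is_monodromy h \<longleftrightarrow>
     homeomorphic_map punctured_torus punctured_torus h \<and>
     orientation_preserving h \<and>
     (\<forall>y \<in> punctured_torus_boundary. h y = y)"

definition Z2_group :: "(int ^ 2) monoid" where
  "Z2_group = \<lparr>carrier = UNIV, monoid.mult = (+), one = 0\<rparr>"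

text \<open>\<open>A\<close> is the matrix of the map \<open>h\<^sub>+\<close> induced on \<open>H\<^sub>1(T; \<int>)\<close>, for some identification of
  \<open>H\<^sub>1(T; \<int>)\<close> with \<open>\<int>\<^sup>2\<close>; hence \<open>A\<close> is determined by \<open>h\<close> up to conjugation in
  \<open>GL(2, \<int>)\<close>.\<close>

definition homology_matrix :: "(complex \<times> complex \<Rightarrow> complex \<times> complex) \<Rightarrow> int ^ 2 ^ 2 \<Rightarrow> bool" where
  "homology_matrix h A \<longleftrightarrow>
     (\<exists>\<phi> \<in> iso (homology_group 1 punctured_torus) Z2_group.
        \<forall>c \<in> carrier (homology_group 1 punctured_torus).
          \<phi> (hom_induced 1 punctured_torus {} punctured_torus {} h c) = A *v \<phi> c)"

text \<open>\<open>h\<close> is pseudo-Anosov iff \<open>\<bar>tr h\<^sub>+\<bar> > 2\<close>; the trace does not depend on the choice of \<open>A\<close>.\<close>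

definition hyperbolic :: "(complex \<times> complex \<Rightarrow> complex \<times> complex) \<Rightarrow> bool" where
  "hyperbolic h \<longleftrightarrow> (\<exists>A. homology_matrix h A \<and> \<bar>trace A\<bar> > 2)"

definition untwisted :: "(complex \<times> complex \<Rightarrow> complex \<times> complex) \<Rightarrow> bool" where
  "untwisted h \<longleftrightarrow>
     (\<exists>A. homology_matrix h A \<and>
        (\<forall>(c::complex) v. v \<noteq> 0 \<and> map_matrix of_int A *v v = c *s v \<longrightarrow> c \<in> \<real> \<and> Re c > 0))"

text \<open>The fibre \<open>T \<times> {0}\<close> of the bundle contains the base point \<open>[(x, 0)]\<close>. Under
  \<open>\<pi>\<^sub>1(M) \<cong> G \<rtimes> \<int>\<close>, where \<open>G = \<pi>\<^sub>1(T, x)\<close>, the subgroup \<open>G \<times> {0}\<close> is the image of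
  \<open>\<pi>\<^sub>1(T, x)\<close> under the inclusion of this fibre.\<close>

definition bundle_group ::
    "(complex \<times> complex \<Rightarrow> complex \<times> complex) \<Rightarrow> complex \<times> complex \<Rightarrow>
     (real \<Rightarrow> ((complex \<times> complex) \<times> real) set) set monoid" where
  "bundle_group h x =
     fundamental_group (mapping_torus punctured_torus h) (mapping_torus_class punctured_torus h (x, 0))"

definition fibre_subgroup ::
    "(complex \<times> complex \<Rightarrow> complex \<times> complex) \<Rightarrow> complex \<times> complex \<Rightarrow>
     (real \<Rightarrow> ((complex \<times> complex) \<times> real) set) set set" where
  "fibre_subgroup h x =
     fundamental_group_map (mapping_torus punctured_torus h)
         (mapping_torus_class punctured_torus h (x, 0))
         (\<lambda>y. mapping_torus_class punctured_torus h (y, 0))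
       ` carrier (fundamental_group punctured_torus x)"

end

theory Submission
  imports Defs
begin

text \<open>A maximal convex subgroup \<open>C\<close> of a finitely generated bi-ordered group exists (the union of
  the proper convex subgroups), is invariant under all order automorphisms, and has a torsion-free
  abelian quotient because that quotient is archimedean. Let \<open>t\<close> be the stable letter, acting on
  \<open>G\<close> through \<open>h\<^sub>*\<close>, and let \<open>A = h\<^sub>+\<close>. By Cayley-Hamilton,
  \<open>h\<^sub>*\<^sup>2(g) h\<^sub>*(g)\<^sup>-\<^sup>\<tau> g\<^sup>d \<in> [G,G]\<close> for all \<open>g \<in> G\<close>, where \<open>\<tau> = tr A\<close> and \<open>d = det A = \<plusminus>1\<close>.

  For \<open>\<pi>\<^sub>1(M)\<close> the action of \<open>t\<close> on the abelian quotient by \<open>C\<close> is trivial, so \<open>g\<^bsup>1 - \<tau> + d\<^esup> \<in> C\<close>,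
  hence \<open>G \<subseteq> C\<close>, and then \<open>C = G\<close> because \<open>\<pi>\<^sub>1(M)/G\<close> is infinite cyclic. For \<open>G = \<langle>a, b\<rangle>\<close>
  the maximal convex subgroup \<open>D\<close> is \<open>h\<^sub>*\<close>-invariant and contains \<open>[G,G]\<close>; were it larger, \<open>G/D\<close> would
  be infinite cyclic and \<open>A\<close> would have a rational eigenvalue, which \<open>\<bar>\<tau>\<bar> > 2\<close> excludes.

  On the topological side it suffices that \<open>G\<close> has two generators and that the Hurewicz map
  \<open>G \<rightarrow> H\<^sub>1(T) \<cong> \<int>\<^sup>2\<close> is onto: its kernel is then \<open>[G,G]\<close>. The structure of \<open>\<pi>\<^sub>1(M)\<close> comes from
  lifting paths and homotopies to \<open>T \<times> \<real>\<close>.\<close>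

section \<open>Bi-ordered groups\<close>

text \<open>Two obstacles shape the proof. That the quotient is abelian is classically read off from
  Hoelder's embedding of an archimedean group into the reals; here no embedding is built. A positive
  commutator outside \<open>C\<close> lies below the square of every positive element outside
  \<open>C\<close>. It therefore behaves like a least positive element modulo \<open>C\<close>,
  which makes the quotient cyclic and so forces the commutator back into \<open>C\<close>. The other
  obstacle is that \<open>M\<close> is an abstract quotient space. As the fibre is compact,
  \<open>M\<close> can be replaced by a compact set in a Euclidean space. A path or a homotopy is
  then lifted by taking a logarithm of its circle coordinate, and the fibre coordinate comes from
  inverting a continuous injection of a compact set. The gluing \<open>(y, 1) ~ (h y, 0)\<close>
  fixes the direction of conjugation: with \<open>\<alpha>\<close> the automorphism induced by
  \<open>h\<close>, \<open>t \<otimes> \<alpha> g \<otimes> inv t = g\<close>, which is why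
  \<open>inv t \<otimes> g \<otimes> t\<close> occurs in the statement on extensions.\<close>

locale bi_ordered_group = group G for G (structure) +
  fixes less :: "'a rel"
  assumes bi_ordering: "bi_ordering G less"
begin

definition lt (infix "\<sqsubset>" 50) where "a \<sqsubset> b \<longleftrightarrow> (a, b) \<in> less"
abbreviation le (infix "\<sqsubseteq>" 50) where "a \<sqsubseteq> b \<equiv> a = b \<or> a \<sqsubset> b"

lemma lt_carrier: "a \<sqsubset> b \<Longrightarrow> a \<in> carrier G \<and> b \<in> carrier G"
  using bi_ordering by (auto simp: lt_def bi_ordering_def)

lemma lt_irrefl [simp]: "\<not> a \<sqsubset> a"
  using bi_ordering by (auto simp: lt_def bi_ordering_def strict_linear_order_on_def irrefl_def)

lemma lt_trans [trans]: "a \<sqsubset> b \<Longrightarrow> b \<sqsubset> c \<Longrightarrow> a \<sqsubset> c"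
  using bi_ordering by (auto simp: lt_def bi_ordering_def strict_linear_order_on_def dest: transD)

lemma lt_linear: "a \<in> carrier G \<Longrightarrow> b \<in> carrier G \<Longrightarrow> a \<sqsubset> b \<or> a = b \<or> b \<sqsubset> a"
  using bi_ordering by (auto simp: lt_def bi_ordering_def strict_linear_order_on_def total_on_def)

lemma lt_mult_left: "a \<sqsubset> b \<Longrightarrow> g \<in> carrier G \<Longrightarrow> g \<otimes> a \<sqsubset> g \<otimes> b"
  using bi_ordering lt_carrier by (auto simp: lt_def bi_ordering_def)

lemma lt_mult_right: "a \<sqsubset> b \<Longrightarrow> g \<in> carrier G \<Longrightarrow> a \<otimes> g \<sqsubset> b \<otimes> g"
  using bi_ordering lt_carrier by (auto simp: lt_def bi_ordering_def)

lemma le_lt_trans: "a \<sqsubseteq> b \<Longrightarrow> b \<sqsubset> c \<Longrightarrow> a \<sqsubset> c"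
  using lt_trans by blast

lemma le_trans [trans]: "a \<sqsubseteq> b \<Longrightarrow> b \<sqsubseteq> c \<Longrightarrow> a \<sqsubseteq> c"
  using lt_trans by blast

lemma lt_mult_mono: "a \<sqsubset> b \<Longrightarrow> c \<sqsubset> d \<Longrightarrow> a \<otimes> c \<sqsubset> b \<otimes> d"
  using lt_carrier lt_mult_left lt_mult_right lt_trans by metis

lemma le_mult_mono:
  assumes "a \<sqsubseteq> b" "c \<sqsubseteq> d" "a \<in> carrier G" "c \<in> carrier G"
  shows "a \<otimes> c \<sqsubseteq> b \<otimes> d"
  using assms lt_mult_left lt_mult_right lt_mult_mono by metis

lemma lt_inv: assumes "a \<sqsubset> b" shows "inv b \<sqsubset> inv a"
proof -
  have c: "a \<in> carrier G" "b \<in> carrier G" using lt_carrier assms by auto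
  have "inv b \<otimes> a \<otimes> inv a \<sqsubset> inv b \<otimes> b \<otimes> inv a"
    using assms c by (intro lt_mult_right lt_mult_left) auto
  then show ?thesis using c by (simp add: m_assoc)
qed

lemma one_lt_inv: "a \<sqsubset> \<one> \<Longrightarrow> \<one> \<sqsubset> inv a"
  using lt_inv[of a \<one>] by simp

lemma positive_or_inverse_positive:
  assumes "a \<in> carrier G" "a \<noteq> \<one>"
  obtains "\<one> \<sqsubset> a" | "\<one> \<sqsubset> inv a"
  using assms lt_linear[of a \<one>] one_lt_inv by auto

section \<open>Convex subgroups of a bi-ordered group\<close>

lemma convex_subgroupD:
  assumes "convex_subgroup G less C"
  shows "subgroup C G" and "\<lbrakk>\<one> \<sqsubset> g; g \<sqsubseteq> c; c \<in> C\<rbrakk> \<Longrightarrow> g \<in> C"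
proof -
  show "subgroup C G" using assms by (simp add: convex_subgroup_def)
  then have "\<one> \<in> C" by (rule subgroup.one_closed)
  then show "\<lbrakk>\<one> \<sqsubset> g; g \<sqsubseteq> c; c \<in> C\<rbrakk> \<Longrightarrow> g \<in> C"
    using assms lt_carrier unfolding convex_subgroup_def lt_def[symmetric] by blast
qed

lemma convex_subgroupI:
  assumes "subgroup C G" and *: "\<And>g c. \<lbrakk>\<one> \<sqsubset> g; g \<sqsubset> c; c \<in> C\<rbrakk> \<Longrightarrow> g \<in> C"
  shows "convex_subgroup G less C"
  unfolding convex_subgroup_def lt_def[symmetric]
proof (intro conjI ballI impI)
  fix a b g assume a: "a \<in> C" and b: "b \<in> C" and g: "g \<in> carrier G" and ab: "a \<sqsubset> g \<and> g \<sqsubset> b"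
  have c: "a \<in> carrier G" "b \<in> carrier G" using a b subgroup.mem_carrier[OF assms(1)] by auto
  have ia: "inv a \<in> C" by (simp add: a assms(1) subgroup.m_inv_closed)
  have "inv a \<otimes> a \<sqsubset> inv a \<otimes> g" "inv a \<otimes> g \<sqsubset> inv a \<otimes> b"
    using ab c by (simp_all only: lt_mult_left inv_closed)
  then have "inv a \<otimes> g \<in> C"
    using *[of "inv a \<otimes> g" "inv a \<otimes> b"] c ia b subgroup.m_closed[OF assms(1)] by simp
  then have "a \<otimes> (inv a \<otimes> g) \<in> C" using a subgroup.m_closed[OF assms(1)] by blast
  then show "g \<in> C" using c g by (simp flip: m_assoc)
qed (fact assms(1))

lemma convex_subgroup_positive_not_mem:
  assumes "subgroup C G" "g \<in> carrier G" "g \<notin> C"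
  obtains p where "p = g \<or> p = inv g" "\<one> \<sqsubset> p" "p \<notin> C"
proof -
  have "g \<noteq> \<one>" using assms subgroup.one_closed by metis
  moreover have "inv g \<notin> C" using assms subgroup.m_inv_closed inv_inv by metis
  ultimately show ?thesis using positive_or_inverse_positive assms that by metis
qed

text \<open>Otherwise there are a positive \<open>p\<close> in \<open>C\<close> outside
  \<open>D\<close> and a positive \<open>q\<close> in \<open>D\<close> outside \<open>C\<close>. By
  convexity the smaller of the two belongs to both subgroups.\<close>

lemma convex_subgroups_linear:
  assumes C: "convex_subgroup G less C" and D: "convex_subgroup G less D"
  shows "C \<subseteq> D \<or> D \<subseteq> C"
proof (rule ccontr)
  assume "\<not> ?thesis"
  then obtain c d where cd: "c \<in> C" "c \<notin> D" "d \<in> D" "d \<notin> C" by blast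
  note sC = convex_subgroupD(1)[OF C] and sD = convex_subgroupD(1)[OF D]
  obtain p where p: "\<one> \<sqsubset> p" "p \<notin> D" "p \<in> C"
    using convex_subgroup_positive_not_mem[OF sD _ cd(2)] cd sC
    by (metis subgroup.m_inv_closed subgroup.mem_carrier)
  obtain q where q: "\<one> \<sqsubset> q" "q \<notin> C" "q \<in> D"
    using convex_subgroup_positive_not_mem[OF sC _ cd(4)] cd sD
    by (metis subgroup.m_inv_closed subgroup.mem_carrier)
  have "p \<sqsubset> q \<or> p = q \<or> q \<sqsubset> p" using p q lt_carrier lt_linear by blast
  then show False using p q convex_subgroupD(2)[OF C] convex_subgroupD(2)[OF D] by blast
qed

lemma proper_convex_subset_maximal:
  assumes "maximal_convex_subgroup G less C" "convex_subgroup G less D" "D \<noteq> carrier G"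
  shows "D \<subseteq> C"
  using assms convex_subgroups_linear[of C D] unfolding maximal_convex_subgroup_def by blast

text \<open>The proper convex subgroups form a chain, so their union \<open>C\<close> is a convex
  subgroup. It is proper: finitely many generators inside \<open>C\<close> would already lie in a
  single member of the chain, which would then be the whole group.\<close>

lemma ex_maximal_convex_subgroup:
  assumes gen: "generate G S = carrier G" and S: "finite S" "S \<subseteq> carrier G"
    and nontriv: "carrier G \<noteq> {\<one>}"
  obtains C where "maximal_convex_subgroup G less C"
proof -
  define P where "P = {D. convex_subgroup G less D \<and> D \<noteq> carrier G}"
  define C where "C = \<Union>P"
  have triv: "convex_subgroup G less {\<one>}"
    by (rule convex_subgroupI[OF triv_subgroup]) (use lt_trans lt_irrefl in blast)
  then have ne: "{\<one>} \<in> P" using nontriv by (auto simp: P_def)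
  have sub: "subgroup D G" if "D \<in> P" for D using that convex_subgroupD by (auto simp: P_def)
  have directed: "\<exists>D\<in>P. a \<in> D \<and> b \<in> D" if ab: "a \<in> C" "b \<in> C" for a b
  proof -
    obtain D E where DE: "D \<in> P" "a \<in> D" "E \<in> P" "b \<in> E" using ab unfolding C_def by blast
    then have "D \<subseteq> E \<or> E \<subseteq> D" by (intro convex_subgroups_linear) (auto simp: P_def)
    then show ?thesis using DE by blast
  qed
  have "subgroup C G"
  proof
    show "C \<subseteq> carrier G" using sub subgroup.subset by (fastforce simp: C_def)
    show "\<one> \<in> C" using ne by (auto simp: C_def)
    show "a \<otimes> b \<in> C" if "a \<in> C" "b \<in> C" for a b
      using directed[OF that] subgroup.m_closed[OF sub] unfolding C_def by fast
    show "inv a \<in> C" if "a \<in> C" for a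
      using that subgroup.m_inv_closed[OF sub] unfolding C_def by fast
  qed
  moreover have "g \<in> C" if "\<one> \<sqsubset> g" "g \<sqsubset> c" "c \<in> C" for g c
    using that convex_subgroupD(2) unfolding C_def P_def by blast
  ultimately have conv: "convex_subgroup G less C" by (rule convex_subgroupI)
  have "C \<noteq> carrier G"
  proof
    assume CG: "C = carrier G"
    have sub_gen: "\<exists>D\<in>P. T \<subseteq> D" if "finite T" "T \<subseteq> S" for T
      using that
    proof (induction T rule: finite_induct)
      case empty then show ?case using ne by blast
    next
      case (insert a T)
      then obtain D where D: "D \<in> P" "T \<subseteq> D" by auto
      have "a \<in> C" using insert S CG by auto
      then obtain E where E: "E \<in> P" "a \<in> E" by (auto simp: C_def)
      show ?case using convex_subgroups_linear[of D E] D E unfolding P_def by blast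
    qed
    then obtain D where D: "D \<in> P" "S \<subseteq> D" using S by blast
    then have "carrier G \<subseteq> D" using gen generate_subgroup_incl[OF D(2) sub] by auto
    then show False using D sub subgroup.subset unfolding P_def by blast
  qed
  then have "maximal_convex_subgroup G less C"
    using conv unfolding maximal_convex_subgroup_def C_def P_def by blast
  then show ?thesis by (rule that)
qed

text \<open>The image of \<open>C\<close> under an order automorphism is again a proper convex
  subgroup, and \<open>C\<close> contains all of these. Conjugations and the action of the monodromy
  are the two instances.\<close>

lemma maximal_convex_invariant:
  assumes C: "maximal_convex_subgroup G less C"
    and hom: "s \<in> hom G G" and surj: "s ` carrier G = carrier G"
    and mono: "\<And>a b. a \<sqsubset> b \<Longrightarrow> s a \<sqsubset> s b"
    and a: "a \<in> C"
  shows "s a \<in> C"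
proof -
  have conv: "convex_subgroup G less C" and proper: "C \<noteq> carrier G"
    using C by (auto simp: maximal_convex_subgroup_def)
  have sC: "subgroup C G" using conv convex_subgroupD by blast
  have inj: "inj_on s (carrier G)"
    by (rule inj_onI) (metis lt_irrefl lt_linear mono)
  interpret s: group_hom G G s
    using hom by (simp add: group_hom_def group_hom_axioms_def)
  have "subgroup (s ` C) G" by (rule s.subgroup_img_is_subgroup[OF sC])
  moreover have "g \<in> s ` C" if g: "\<one> \<sqsubset> g" "g \<sqsubset> c" "c \<in> s ` C" for g c
  proof -
    obtain c' where c': "c' \<in> C" "c = s c'" using g by blast
    have cc: "c' \<in> carrier G" using c' subgroup.mem_carrier[OF sC] by blast
    obtain g' where g': "g' \<in> carrier G" "g = s g'" using g(1) lt_carrier surj by blast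
    have "\<one> \<sqsubset> g'" using lt_linear[of \<one> g'] mono g g' lt_trans lt_irrefl s.hom_one
      by (metis one_closed)
    moreover have "g' \<sqsubset> c'" using lt_linear[of c' g'] mono g g' c' cc lt_trans lt_irrefl by metis
    ultimately show ?thesis using convex_subgroupD(2)[OF conv] c' g' by blast
  qed
  ultimately have "convex_subgroup G less (s ` C)" by (rule convex_subgroupI)
  moreover have "s ` C \<noteq> carrier G"
  proof
    assume "s ` C = carrier G"
    then have "carrier G \<subseteq> C" using inj surj subgroup.subset[OF sC] by (metis inj_on_image_eq_iff order_refl)
    then show False using proper subgroup.subset[OF sC] by blast
  qed
  ultimately show ?thesis using proper_convex_subset_maximal[OF C] a by blast
qed

lemma maximal_convex_normal:
  assumes C: "maximal_convex_subgroup G less C"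
  shows "C \<lhd> G"
proof -
  have sC: "subgroup C G" using C convex_subgroupD by (auto simp: maximal_convex_subgroup_def)
  have "x \<otimes> a \<otimes> inv x \<in> C" if x: "x \<in> carrier G" and a: "a \<in> C" for x a
  proof (rule maximal_convex_invariant[OF C _ _ _ a, of "\<lambda>g. x \<otimes> g \<otimes> inv x"])
    show "(\<lambda>g. x \<otimes> g \<otimes> inv x) \<in> hom G G"
      using x by (auto intro!: homI simp: m_assoc inv_solve_left)
    have "g \<in> (\<lambda>g. x \<otimes> g \<otimes> inv x) ` carrier G" if "g \<in> carrier G" for g
      using that x by (intro image_eqI[of _ _ "inv x \<otimes> g \<otimes> x"]) (auto simp: m_assoc, simp flip: m_assoc)
    then show "(\<lambda>g. x \<otimes> g \<otimes> inv x) ` carrier G = carrier G" using x by auto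
    show "a \<sqsubset> b \<Longrightarrow> x \<otimes> a \<otimes> inv x \<sqsubset> x \<otimes> b \<otimes> inv x" for a b
      using x by (intro lt_mult_right lt_mult_left) auto
  qed
  then show ?thesis using sC normal_inv_iff by blast
qed

text \<open>Pass to the inverse if necessary to get a positive \<open>p\<close>. The powers of
  \<open>p\<close> with positive exponent are at least \<open>p\<close>, so by convexity a power in
  \<open>C\<close> brings \<open>p\<close> with it.\<close>

lemma convex_root_closed:
  assumes C: "convex_subgroup G less C" and g: "g \<in> carrier G" and n: "n \<noteq> 0" and gn: "g [^] (n::int) \<in> C"
  shows "g \<in> C"
proof (rule ccontr)
  assume "g \<notin> C"
  note sC = convex_subgroupD(1)[OF C]
  obtain p where p: "p = g \<or> p = inv g" "\<one> \<sqsubset> p" "p \<notin> C"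
    using convex_subgroup_positive_not_mem[OF sC g \<open>g \<notin> C\<close>] .
  have pc: "p \<in> carrier G" using p lt_carrier by blast
  have "p [^] n \<in> C"
    using p(1) gn g sC int_pow_inv[of g n] subgroup.m_inv_closed by metis
  then have "p [^] (int (nat \<bar>n\<bar>)) \<in> C"
    using int_pow_neg[of p n] pc sC subgroup.m_inv_closed by (cases "n \<ge> 0") fastforce+
  then have *: "p [^] nat \<bar>n\<bar> \<in> C" by (simp add: int_pow_int)
  have "p \<sqsubseteq> p [^] Suc m" for m
  proof (induction m)
    case 0 then show ?case using pc by simp
  next
    case (Suc m)
    then have "\<one> \<sqsubset> p [^] Suc m" using p(2) lt_trans by metis
    then have "\<one> \<otimes> p \<sqsubset> p [^] Suc m \<otimes> p" using pc by (rule lt_mult_right)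
    then show ?case using pc by simp
  qed
  moreover have "\<exists>m. nat \<bar>n\<bar> = Suc m" using n by (intro not0_implies_Suc) auto
  ultimately have "p \<sqsubseteq> p [^] nat \<bar>n\<bar>" by metis
  then show False using convex_subgroupD(2)[OF C p(2) _ *] p(3) by blast
qed

text \<open>The elements caught between \<open>inv (f [^] n)\<close> and \<open>f [^] n\<close> for
  some \<open>n\<close> form a convex subgroup \<open>A\<close>. It contains \<open>f\<close>, hence
  is not inside \<open>C\<close>, and by maximality it is everything.\<close>

lemma archimedean_nat:
  assumes C: "maximal_convex_subgroup G less C" and f: "\<one> \<sqsubset> f" "f \<notin> C" and g: "g \<in> carrier G"
  obtains n :: nat where "g \<sqsubset> f [^] n"
proof -
  have fc: "f \<in> carrier G" using f lt_carrier by blast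
  define A where "A = {g \<in> carrier G. \<exists>n::nat. inv (f [^] n) \<sqsubseteq> g \<and> g \<sqsubseteq> f [^] n}"
  have "subgroup A G"
  proof
    show "A \<subseteq> carrier G" by (auto simp: A_def)
    have "inv (f [^] (0::nat)) \<sqsubseteq> \<one> \<and> \<one> \<sqsubseteq> f [^] (0::nat)" by simp
    then show "\<one> \<in> A" unfolding A_def by blast
    show "x \<otimes> y \<in> A" if xy: "x \<in> A" "y \<in> A" for x y
    proof -
      obtain n m :: nat where n: "inv (f [^] n) \<sqsubseteq> x" "x \<sqsubseteq> f [^] n" and m: "inv (f [^] m) \<sqsubseteq> y" "y \<sqsubseteq> f [^] m"
        and c: "x \<in> carrier G" "y \<in> carrier G"
        using xy unfolding A_def by blast
      have "x \<otimes> y \<sqsubseteq> f [^] n \<otimes> f [^] m" using n m c by (intro le_mult_mono) auto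
      moreover have "inv (f [^] n) \<otimes> inv (f [^] m) \<sqsubseteq> x \<otimes> y"
        using n m c fc by (intro le_mult_mono) auto
      moreover have "inv (f [^] n) \<otimes> inv (f [^] m) = inv (f [^] (n + m))"
        by (metis add.commute fc inv_mult_group nat_pow_closed nat_pow_mult)
      ultimately have "inv (f [^] (n + m)) \<sqsubseteq> x \<otimes> y \<and> x \<otimes> y \<sqsubseteq> f [^] (n + m)"
        using fc by (simp add: nat_pow_mult)
      then show ?thesis unfolding A_def using c by blast
    qed
    show "inv x \<in> A" if x: "x \<in> A" for x
    proof -
      obtain n :: nat where n: "inv (f [^] n) \<sqsubseteq> x" "x \<sqsubseteq> f [^] n" and c: "x \<in> carrier G"
        using x unfolding A_def by blast
      have "inv (f [^] n) \<sqsubseteq> inv x \<and> inv x \<sqsubseteq> f [^] n"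
        using n lt_inv[of x "f [^] n"] lt_inv[of "inv (f [^] n)" x] c fc by auto
      then show ?thesis unfolding A_def using inv_closed[OF c] by (intro CollectI conjI exI[of _ n]) auto
    qed
  qed
  moreover have "h \<in> A" if h: "\<one> \<sqsubset> h" "h \<sqsubset> c" "c \<in> A" for h c
  proof -
    obtain n :: nat where n: "c \<sqsubseteq> f [^] n" using h unfolding A_def by blast
    have "\<one> \<sqsubset> f [^] n" using n h lt_trans by metis
    then have "inv (f [^] n) \<sqsubset> \<one>" using lt_inv[of \<one> "f [^] n"] by simp
    then have "inv (f [^] n) \<sqsubseteq> h \<and> h \<sqsubseteq> f [^] n" using n h lt_trans by metis
    then show ?thesis unfolding A_def using h lt_carrier by blast
  qed
  ultimately have "convex_subgroup G less A" by (rule convex_subgroupI)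
  moreover have "f \<in> A"
  proof -
    have "inv (f [^] (1::nat)) \<sqsubseteq> f" using f fc lt_inv[OF f(1)] le_trans by (auto intro: lt_trans)
    moreover have "f \<sqsubseteq> f [^] (1::nat)" using fc by simp
    ultimately show ?thesis unfolding A_def using fc by blast
  qed
  ultimately have "A = carrier G" using proper_convex_subset_maximal[OF C] f by blast
  then obtain n :: nat where "g \<sqsubseteq> f [^] n" using g unfolding A_def by blast
  moreover have "f [^] n \<sqsubset> f [^] Suc n"
    using lt_mult_left[OF f(1), of "f [^] n"] fc by simp
  ultimately show ?thesis using that le_lt_trans by blast
qed

lemma archimedean_int:
  assumes C: "maximal_convex_subgroup G less C" and f: "\<one> \<sqsubset> f" "f \<notin> C" and g: "g \<in> carrier G"
  obtains k :: int where "f [^] k \<sqsubseteq> g" "g \<sqsubset> f [^] (k + 1)"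
proof -
  have fc: "f \<in> carrier G" using f lt_carrier by blast
  obtain m :: nat where m: "inv g \<sqsubset> f [^] m" using archimedean_nat[OF C f inv_closed[OF g]] .
  then have m': "f [^] (- int m) \<sqsubset> g"
    using lt_inv[OF m] g fc by (simp add: int_pow_neg_int)
  obtain n :: nat where n: "g \<sqsubset> f [^] n" using archimedean_nat[OF C f g] .
  \<comment> \<open>The exponent is shifted by \<open>m\<close> so that the search runs over natural
    numbers. Since \<open>f [^] (- int m) \<sqsubset> g\<close> excludes \<open>j = 0\<close>, the
    least \<open>j\<close> has a predecessor, which gives the lower bound.\<close>
  let ?P = "\<lambda>j::nat. g \<sqsubset> f [^] (int j - int m)"
  have "?P (n + m)" using n by (simp add: int_pow_int)
  then obtain j where j: "?P j" "\<And>i. i < j \<Longrightarrow> \<not> ?P i"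
    using LeastI[of ?P] not_less_Least[of _ ?P] by blast
  have "j \<noteq> 0"
  proof
    assume "j = 0"
    then have "g \<sqsubset> f [^] (- int m)" using j(1) by simp
    then show False using m' lt_trans lt_irrefl by blast
  qed
  then obtain i where i: "j = Suc i" using not0_implies_Suc by blast
  have "f [^] (int i - int m) \<sqsubseteq> g"
    using j(2)[of i] i lt_linear[of g "f [^] (int i - int m)"] fc g by auto
  moreover have "g \<sqsubset> f [^] (int i - int m + 1)" using j(1) i by (simp add: algebra_simps)
  ultimately show ?thesis by (rule that)
qed

text \<open>The elements \<open>x\<close>, \<open>y\<close> and their inverses are rounded up to the
  powers of \<open>e\<close> with exponents \<open>m + 1\<close>, \<open>n + 1\<close>,
  \<open>- m\<close> and \<open>- n\<close>. These add up to 2, whatever \<open>m\<close> and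
  \<open>n\<close> are.\<close>

lemma commutator_less_square:
  assumes C: "maximal_convex_subgroup G less C" and e: "\<one> \<sqsubset> e" "e \<notin> C"
    and x: "x \<in> carrier G" and y: "y \<in> carrier G"
  shows "x \<otimes> y \<otimes> inv x \<otimes> inv y \<sqsubset> e \<otimes> e"
proof -
  have ec: "e \<in> carrier G" using e lt_carrier by blast
  obtain m :: int where m: "e [^] m \<sqsubseteq> x" "x \<sqsubset> e [^] (m + 1)" using archimedean_int[OF C e x] .
  obtain n :: int where n: "e [^] n \<sqsubseteq> y" "y \<sqsubset> e [^] (n + 1)" using archimedean_int[OF C e y] .
  have "inv x \<sqsubseteq> inv (e [^] m)" "inv y \<sqsubseteq> inv (e [^] n)" using m n lt_inv by auto
  then have "inv x \<otimes> inv y \<sqsubseteq> inv (e [^] m) \<otimes> inv (e [^] n)"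
    using x y by (intro le_mult_mono) auto
  moreover have "x \<otimes> y \<sqsubset> e [^] (m + 1) \<otimes> e [^] (n + 1)" using m n by (intro lt_mult_mono)
  ultimately have "(x \<otimes> y) \<otimes> (inv x \<otimes> inv y) \<sqsubset> (e [^] (m + 1) \<otimes> e [^] (n + 1)) \<otimes> (inv (e [^] m) \<otimes> inv (e [^] n))"
    using x y ec by (metis inv_closed lt_mult_mono lt_mult_right m_closed)
  also have "\<dots> = e [^] ((m + 1) + (n + 1) + (- m + - n))"
    using ec by (simp only: int_pow_mult int_pow_neg int_pow_closed m_closed)
  also have "\<dots> = e [^] (2::int)" by (simp add: algebra_simps)
  also have "\<dots> = e \<otimes> e" using ec by (metis int_pow_1 int_pow_mult one_add_one)
  finally show ?thesis using x y by (simp add: m_assoc)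
qed

text \<open>Suppose that a positive commutator \<open>c\<close> lies outside \<open>C\<close>. By
  the preceding bound \<open>c\<close> is not a product of two positive elements outside
  \<open>C\<close>, since the square of the smaller one would be at most \<open>c\<close>. Hence
  dividing any \<open>g\<close> by a suitable power of \<open>c\<close> leaves a remainder that is
  trivial or equal to \<open>c\<close> modulo \<open>C\<close>. All cosets of \<open>C\<close> are
  then powers of one coset and commute, so that \<open>c\<close> lies in \<open>C\<close> after
  all.\<close>

lemma derived_subset_maximal_convex:
  assumes C: "maximal_convex_subgroup G less C"
  shows "derived G (carrier G) \<subseteq> C"
proof -
  have conv: "convex_subgroup G less C" using C by (auto simp: maximal_convex_subgroup_def)
  note sC = convex_subgroupD(1)[OF conv]
  interpret C: normal C G by (rule maximal_convex_normal[OF C])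
  have pos: "x \<otimes> y \<otimes> inv x \<otimes> inv y \<in> C"
    if x: "x \<in> carrier G" and y: "y \<in> carrier G" and pos: "\<one> \<sqsubset> x \<otimes> y \<otimes> inv x \<otimes> inv y" for x y
  proof (rule ccontr)
    define c where "c = x \<otimes> y \<otimes> inv x \<otimes> inv y"
    assume "x \<otimes> y \<otimes> inv x \<otimes> inv y \<notin> C"
    then have c: "c \<notin> C" "\<one> \<sqsubset> c" "c \<in> carrier G" using pos x y by (auto simp: c_def)
    have small: "\<not> e \<otimes> e \<sqsubseteq> c" if "\<one> \<sqsubset> e" "e \<notin> C" for e
      using commutator_less_square[OF C that x y] lt_trans lt_irrefl unfolding c_def by metis
    have cyclic: "\<exists>k::int. C #> g = C #> (c [^] k)" if g: "g \<in> carrier G" for g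
    proof -
      obtain k :: int where k: "c [^] k \<sqsubseteq> g" "g \<sqsubset> c [^] (k + 1)" using archimedean_int[OF C c(2,1) g] .
      \<comment> \<open>\<open>e\<close> is the remainder of \<open>g\<close> after division by
        \<open>c [^] k\<close>, and \<open>d\<close> is what it lacks to \<open>c\<close>; one of
        the two lies in \<open>C\<close>.\<close>
      define e where "e = g \<otimes> inv (c [^] k)"
      define d where "d = inv e \<otimes> c"
      have ec: "e \<in> carrier G" "d \<in> carrier G" using g c by (auto simp: e_def d_def)
      have ed: "e \<otimes> d = c" using ec c by (simp add: d_def flip: m_assoc)
      have e1: "\<one> \<sqsubseteq> e"
        using lt_mult_right[of "c [^] k" g "inv (c [^] k)"] k g c by (auto simp: e_def)
      have "e \<sqsubset> c [^] (k + 1) \<otimes> inv (c [^] k)"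
        unfolding e_def by (rule lt_mult_right[OF k(2)]) (use c in auto)
      also have "\<dots> = c" using c int_pow_mult[of c "k + 1" "- k"] by (simp add: int_pow_neg)
      finally have d1: "\<one> \<sqsubset> d"
        using lt_mult_left[of e c "inv e"] ec by (simp add: d_def)
      have "e \<in> C \<or> d \<in> C"
      proof (rule ccontr)
        assume n: "\<not> ?thesis"
        then have "\<one> \<sqsubset> e" using e1 C.one_closed by auto
        moreover have "e \<otimes> e \<sqsubseteq> c" if "e \<sqsubseteq> d" using le_mult_mono[of e e e d] that ed ec by auto
        moreover have "d \<otimes> d \<sqsubseteq> c" if "d \<sqsubseteq> e" using le_mult_mono[of d e d d] that ed ec by auto
        ultimately show False using small d1 n lt_linear[OF ec] by blast
      qed
      moreover have g_eq: "g = e \<otimes> c [^] k" using g c by (simp add: e_def m_assoc)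
      moreover have "C #> (e \<otimes> c [^] k) = C #> (c [^] k)" if "e \<in> C"
        using that ec c coset_mult_assoc[OF C.subset, of e "c [^] k"] by (simp add: coset_join2[OF _ sC])
      moreover have "C #> (e \<otimes> c [^] k) = C #> (c [^] (k + 1))" if "d \<in> C"
      proof -
        \<comment> \<open>In \<open>e\<close> the factor \<open>inv d\<close> stands to the right of
          \<open>c\<close>; conjugation by \<open>c\<close> moves it to the left, where the right
          coset absorbs it.\<close>
        have "c \<otimes> inv d \<otimes> inv c \<in> C"
          using that c C.inv_op_closed2 by blast
        then have *: "C #> (c \<otimes> inv d \<otimes> inv c) = C"
          using C.is_subgroup C.rcos_const by blast
        have "e = c \<otimes> inv d" using ed ec c by (metis inv_solve_right)
        moreover have "inv c \<otimes> (c \<otimes> c [^] k) = c [^] k" using c by (simp flip: m_assoc)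
        ultimately have "e \<otimes> c [^] k = (c \<otimes> inv d \<otimes> inv c) \<otimes> (c \<otimes> c [^] k)"
          using ec c by (simp add: m_assoc)
        moreover have "c \<otimes> c [^] k = c [^] (k + 1)" using c by (metis add.commute int_pow_1 int_pow_mult)
        ultimately show ?thesis
          using * ec c coset_mult_assoc[OF C.subset, of "c \<otimes> inv d \<otimes> inv c" "c [^] (k + 1)"]
          by (simp only: m_closed inv_closed int_pow_closed)
      qed
      ultimately show ?thesis by metis
    qed
    obtain i :: int where i: "C #> x = C #> (c [^] i)" using cyclic[OF x] by blast
    obtain j :: int where j: "C #> y = C #> (c [^] j)" using cyclic[OF y] by blast
    have "C #> (x \<otimes> y) = C #> (c [^] i \<otimes> c [^] j)"
      using C.rcos_sum[OF x y] C.rcos_sum[of "c [^] i" "c [^] j"] c i j by simp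
    also have "c [^] i \<otimes> c [^] j = c [^] j \<otimes> c [^] i" using c by (metis add.commute int_pow_mult)
    also have "C #> (c [^] j \<otimes> c [^] i) = C #> (y \<otimes> x)"
      using C.rcos_sum[OF y x] C.rcos_sum[of "c [^] j" "c [^] i"] c i j by simp
    finally have "x \<otimes> y \<in> C #> (y \<otimes> x)"
      using rcos_self[OF _ sC, of "x \<otimes> y"] x y by simp
    then have "x \<otimes> y \<otimes> inv (y \<otimes> x) \<in> C"
      using x y C.rcos_module_imp[OF is_group] by blast
    then show False using c(1) x y by (simp add: c_def inv_mult_group m_assoc)
  qed
  \<comment> \<open>A negative commutator is the inverse of the positive commutator of
    \<open>y\<close> and \<open>x\<close>.\<close>
  have "x \<otimes> y \<otimes> inv x \<otimes> inv y \<in> C" if x: "x \<in> carrier G" and y: "y \<in> carrier G" for x y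
  proof -
    have "inv (x \<otimes> y \<otimes> inv x \<otimes> inv y) = y \<otimes> x \<otimes> inv y \<otimes> inv x"
      using x y by (simp add: inv_mult_group m_assoc)
    then show ?thesis
      using lt_linear[of \<one> "x \<otimes> y \<otimes> inv x \<otimes> inv y"] pos[OF x y] pos[OF y x] x y lt_inv[of "x \<otimes> y \<otimes> inv x \<otimes> inv y" \<one>]
      by (metis C.m_inv_closed C.one_closed inv_closed inv_inv inv_one m_closed one_closed)
  qed
  then show ?thesis
    unfolding derived_def by (intro generate_subgroup_incl[OF _ sC]) blast
qed

end

text \<open>The rational root argument for \<open>X^2 - \<tau> X + d\<close>: in lowest terms the
  denominator of a root \<open>k / m\<close> divides 1 and its numerator divides \<open>d\<close>,
  so the root is 1 or -1. Either value gives
  \<open>\<bar>\<tau>\<bar> = \<bar>1 + d\<bar> \<le> 2\<close>.\<close>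

lemma no_rational_eigenvalue:
  fixes k m \<tau> d :: int
  assumes "\<bar>\<tau>\<bar> > 2" "\<bar>d\<bar> = 1" "m \<noteq> 0"
  shows "k * k - \<tau> * k * m + d * m * m \<noteq> 0"
proof
  assume eq: "k * k - \<tau> * k * m + d * m * m = 0"
  define g where "g = gcd k m"
  have g: "g \<noteq> 0" using assms by (simp add: g_def)
  obtain k' m' where km: "k = k' * g" "m = m' * g" "coprime k' m'"
    using gcd_coprime_exists[of k m] assms(3) unfolding g_def by auto
  have "(k' * k' - \<tau> * k' * m' + d * m' * m') * (g * g) = 0"
    using eq by (simp add: km algebra_simps)
  then have eq': "k' * k' - \<tau> * k' * m' + d * m' * m' = 0" using g by simp
  then have "k' * k' = m' * (\<tau> * k' - d * m')" by (simp add: algebra_simps)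
  then have "m' dvd k' * k'" by simp
  then have "m' dvd k'"
    using km(3) coprime_dvd_mult_left_iff[of m' k' k'] by (simp add: coprime_commute)
  then have m': "\<bar>m'\<bar> = 1"
    using coprime_common_divisor[OF km(3), of m'] by simp
  have "d * (m' * m') = k' * (\<tau> * m' - k')" using eq' by (simp add: algebra_simps)
  moreover have "m' * m' = 1" using m' by (auto simp: abs_if split: if_splits)
  ultimately have "k' dvd d" by (metis dvd_triv_left mult.right_neutral)
  then have k': "\<bar>k'\<bar> = 1" using assms(2) dvd_abs_iff[of k' d] by simp
  show False using eq' k' m' assms(1,2) by (auto simp: abs_if split: if_splits)
qed

section \<open>Abelian quotients of groups with two generators\<close>

context group
begin

lemma quotient_map_hom:
  assumes "N \<lhd> G"
  shows "group_hom G (G Mod N) (\<lambda>x. N #> x)"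
  using assms by (intro group_hom.intro group_hom_axioms.intro is_group)
    (auto simp: normal.factorgroup_is_group normal.r_coset_hom_Mod)

lemma quotient_map_eq_one_iff:
  assumes "N \<lhd> G" "x \<in> carrier G"
  shows "N #> x = \<one>\<^bsub>G Mod N\<^esub> \<longleftrightarrow> x \<in> N"
  using assms coset_join1 coset_join2 normal_imp_subgroup by (metis FactGroup_def one_FactGroup subgroup.subset)

lemma quotient_comm_group:
  assumes N: "N \<lhd> G" and der: "derived G (carrier G) \<subseteq> N"
  shows "comm_group (G Mod N)"
proof -
  define Q where "Q = G Mod N"
  define q where "q = (\<lambda>x. N #> x)"
  interpret q: group_hom G Q q unfolding Q_def q_def by (rule quotient_map_hom[OF N])
  have "comm_group Q"
  proof (rule q.H.group_comm_groupI)
    fix X Y assume "X \<in> carrier Q" "Y \<in> carrier Q"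
    then obtain x y where xy [simp]: "x \<in> carrier G" "y \<in> carrier G" and XY: "X = q x" "Y = q y"
      by (auto simp: FactGroup_def RCOSETS_def Q_def q_def)
    have "x \<otimes> y \<otimes> inv x \<otimes> inv y \<in> derived G (carrier G)"
      unfolding derived_def using xy by (intro generate.incl) blast
    then have "q (x \<otimes> y \<otimes> inv x \<otimes> inv y) = \<one>\<^bsub>Q\<^esub>"
      using quotient_map_eq_one_iff[OF N, of "x \<otimes> y \<otimes> inv x \<otimes> inv y"] xy
      unfolding q_def Q_def by (metis der inv_closed m_closed subsetD)
    then have "q x \<otimes>\<^bsub>Q\<^esub> q y \<otimes>\<^bsub>Q\<^esub> inv\<^bsub>Q\<^esub> q x = q y"
      using q.H.inv_equality[of "q x \<otimes>\<^bsub>Q\<^esub> q y \<otimes>\<^bsub>Q\<^esub> inv\<^bsub>Q\<^esub> q x" "inv\<^bsub>Q\<^esub> q y"] by simp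
    then show "X \<otimes>\<^bsub>Q\<^esub> Y = Y \<otimes>\<^bsub>Q\<^esub> X"
      using q.H.inv_solve_right[of "q y" "q x \<otimes>\<^bsub>Q\<^esub> q y" "q x"] by (simp add: XY)
  qed
  then show ?thesis by (simp add: Q_def)
qed

lemma two_generated_hom_image:
  assumes gen: "generate G {a, b} = carrier G" and ab [simp]: "a \<in> carrier G" "b \<in> carrier G"
    and q: "comm_group Q" "q \<in> hom G Q" and g: "g \<in> carrier G"
  obtains i j :: int where "q g = q a [^]\<^bsub>Q\<^esub> i \<otimes>\<^bsub>Q\<^esub> q b [^]\<^bsub>Q\<^esub> j"
proof -
  interpret Q: comm_group Q by (rule q)
  interpret q: group_hom G Q q using q(2) by (simp add: group_hom_def group_hom_axioms_def Q.is_group)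
  let ?P = "\<lambda>g. \<exists>(i::int) (j::int). q g = q a [^]\<^bsub>Q\<^esub> i \<otimes>\<^bsub>Q\<^esub> q b [^]\<^bsub>Q\<^esub> j"
  have gens: "?P x \<and> ?P (inv x)" if "x \<in> {a, b}" for x
  proof -
    have "q a = q a [^]\<^bsub>Q\<^esub> (1::int) \<otimes>\<^bsub>Q\<^esub> q b [^]\<^bsub>Q\<^esub> (0::int)"
      "q b = q a [^]\<^bsub>Q\<^esub> (0::int) \<otimes>\<^bsub>Q\<^esub> q b [^]\<^bsub>Q\<^esub> (1::int)"
      "q (inv a) = q a [^]\<^bsub>Q\<^esub> (-1::int) \<otimes>\<^bsub>Q\<^esub> q b [^]\<^bsub>Q\<^esub> (0::int)"
      "q (inv b) = q a [^]\<^bsub>Q\<^esub> (0::int) \<otimes>\<^bsub>Q\<^esub> q b [^]\<^bsub>Q\<^esub> (-1::int)"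
      using Q.int_pow_neg[of "q a" 1] Q.int_pow_neg[of "q b" 1] by simp_all
    then show ?thesis using that by blast
  qed
  have "?P g" if "g \<in> generate G {a, b}" for g
    using that
  proof (induction rule: generate.induct)
    case one
    have "q \<one> = q a [^]\<^bsub>Q\<^esub> (0::int) \<otimes>\<^bsub>Q\<^esub> q b [^]\<^bsub>Q\<^esub> (0::int)"
      using q.hom_one by simp
    then show ?case by blast
  next
    case (eng x y)
    then obtain i j k l :: int where
      x: "q x = q a [^]\<^bsub>Q\<^esub> i \<otimes>\<^bsub>Q\<^esub> q b [^]\<^bsub>Q\<^esub> j" and
      y: "q y = q a [^]\<^bsub>Q\<^esub> k \<otimes>\<^bsub>Q\<^esub> q b [^]\<^bsub>Q\<^esub> l" by blast
    have xy: "x \<in> carrier G" "y \<in> carrier G" using eng gen by auto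
    have "q (x \<otimes> y) = q a [^]\<^bsub>Q\<^esub> (i + k) \<otimes>\<^bsub>Q\<^esub> q b [^]\<^bsub>Q\<^esub> (j + l)"
      using xy x y by (simp add: Q.int_pow_mult Q.m_ac)
    then show ?case by blast
  qed (use gens in blast)+
  then show ?thesis using that g gen by blast
qed

lemma two_generated_normal_form:
  assumes gen: "generate G {a, b} = carrier G" and ab: "a \<in> carrier G" "b \<in> carrier G"
    and g: "g \<in> carrier G"
  obtains c and i j :: int where "c \<in> derived G (carrier G)" "g = c \<otimes> (a [^] i \<otimes> b [^] j)"
proof -
  let ?N = "derived G (carrier G)"
  have N: "?N \<lhd> G" using derived_is_normal[OF normal_self] .
  interpret q: group_hom G "G Mod ?N" "\<lambda>x. ?N #> x" by (rule quotient_map_hom[OF N])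
  interpret N: normal ?N G by (fact N)
  obtain i j :: int where ij: "?N #> g = (?N #> a) [^]\<^bsub>G Mod ?N\<^esub> i \<otimes>\<^bsub>G Mod ?N\<^esub> (?N #> b) [^]\<^bsub>G Mod ?N\<^esub> j"
    by (rule two_generated_hom_image[OF gen ab quotient_comm_group[OF N order_refl] q.homh g])
  then have "?N #> g = ?N #> (a [^] i \<otimes> b [^] j)"
    using ab by (simp add: q.hom_int_pow)
  then have "g \<in> ?N #> (a [^] i \<otimes> b [^] j)"
    using rcos_self[OF g N.is_subgroup] by simp
  then have "g \<otimes> inv (a [^] i \<otimes> b [^] j) \<in> ?N"
    by (rule N.rcos_module_imp[OF is_group, rotated]) (use ab in simp)
  moreover have "g = g \<otimes> inv (a [^] i \<otimes> b [^] j) \<otimes> (a [^] i \<otimes> b [^] j)"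
    using ab g by (simp add: m_assoc)
  ultimately show ?thesis by (rule that)
qed

text \<open>In the torsion-free abelian quotient by \<open>N\<close> the relation between
  \<open>a\<close> and \<open>b\<close> makes \<open>a^m\<close> a power of \<open>b\<close>. The
  map induced by \<open>\<alpha>\<close> then acts on \<open>b\<close> like the rational number
  \<open>k / m\<close>: the \<open>m\<close>-th power of \<open>\<alpha> b\<close> is
  \<open>b^k\<close>. Now \<open>CH\<close> at \<open>b\<close>, raised to the power
  \<open>m * m\<close>, says that \<open>b\<close> is annihilated by the homogenized characteristic
  polynomial at \<open>(k, m)\<close>, which is not zero. So \<open>b\<close>, and after it
  \<open>a\<close>, vanishes in the quotient.\<close>

lemma two_generated_rank_one:
  fixes \<tau> d m n :: int
  assumes gen: "generate G {a, b} = carrier G" and ab: "a \<in> carrier G" "b \<in> carrier G"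
    and N: "N \<lhd> G" "derived G (carrier G) \<subseteq> N"
    and torsion_free: "\<And>g n. \<lbrakk>g \<in> carrier G; (n::int) \<noteq> 0; g [^] n \<in> N\<rbrakk> \<Longrightarrow> g \<in> N"
    and \<alpha>: "\<alpha> \<in> hom G G" "\<And>g. g \<in> N \<Longrightarrow> \<alpha> g \<in> N"
    and CH: "\<And>g. g \<in> carrier G \<Longrightarrow> \<alpha> (\<alpha> g) \<otimes> inv (\<alpha> g [^] \<tau>) \<otimes> g [^] d \<in> N"
    and \<tau>: "\<bar>\<tau>\<bar> > 2" and d: "\<bar>d\<bar> = 1"
    and m: "m \<noteq> 0" and mn: "a [^] m \<otimes> b [^] n \<in> N"
  shows "N = carrier G"
proof -
  define Q where "Q = G Mod N"
  define q where "q = (\<lambda>x. N #> x)"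
  interpret Q: comm_group Q unfolding Q_def by (rule quotient_comm_group[OF N])
  interpret q: group_hom G Q q unfolding Q_def q_def by (rule quotient_map_hom[OF N(1)])
  interpret \<alpha>: group_hom G G \<alpha> using \<alpha>(1) by (simp add: group_hom_def group_hom_axioms_def)
  have q1: "q x = \<one>\<^bsub>Q\<^esub> \<longleftrightarrow> x \<in> N" if "x \<in> carrier G" for x
    unfolding Q_def q_def using quotient_map_eq_one_iff[OF N(1) that] .
  have q_eq: "q x = q y \<longleftrightarrow> x \<otimes> inv y \<in> N" if "x \<in> carrier G" "y \<in> carrier G" for x y
    using q1[of "x \<otimes> inv y"] that Q.inv_equality[of "q x" "inv\<^bsub>Q\<^esub> q y"] by auto
  have q\<alpha>: "q (\<alpha> x) = q (\<alpha> y)" if "q x = q y" "x \<in> carrier G" "y \<in> carrier G" for x y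
    using that q_eq \<alpha>(2)[of "x \<otimes> inv y"] q_eq[of "\<alpha> x" "\<alpha> y"] by simp
  note [simp] = ab
  obtain i j :: int where ij: "q (\<alpha> b) = q a [^]\<^bsub>Q\<^esub> i \<otimes>\<^bsub>Q\<^esub> q b [^]\<^bsub>Q\<^esub> j"
    using two_generated_hom_image[OF gen ab Q.comm_group_axioms q.homh \<alpha>.hom_closed[OF ab(2)]] .
  have am: "q a [^]\<^bsub>Q\<^esub> m = q b [^]\<^bsub>Q\<^esub> (- n)"
    using q1[of "a [^] m \<otimes> b [^] n"] mn by (simp add: q.hom_int_pow Q.int_pow_neg Q.inv_equality)
  \<comment> \<open>The quotient has \<open>\<alpha> b = a^i b^j\<close>; in the \<open>m\<close>-th
    power of this, \<open>a^(m i)\<close> becomes \<open>b^(- n i)\<close>.\<close>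
  define k where "k = - n * i + j * m"
  have "q (\<alpha> b) [^]\<^bsub>Q\<^esub> m = (q a [^]\<^bsub>Q\<^esub> m) [^]\<^bsub>Q\<^esub> i \<otimes>\<^bsub>Q\<^esub> q b [^]\<^bsub>Q\<^esub> (j * m)"
    by (simp add: ij Q.int_pow_distrib Q.int_pow_pow mult.commute)
  also have "\<dots> = q b [^]\<^bsub>Q\<^esub> k"
    using Q.int_pow_mult[of "q b" "- n * i" "j * m"] by (simp add: am Q.int_pow_pow k_def)
  finally have b1: "q (\<alpha> b) [^]\<^bsub>Q\<^esub> m = q b [^]\<^bsub>Q\<^esub> k" .
  then have "q (\<alpha> (\<alpha> b [^] m)) = q (\<alpha> (b [^] k))"
    by (intro q\<alpha>) (simp_all add: q.hom_int_pow)
  then have b2: "q (\<alpha> (\<alpha> b)) [^]\<^bsub>Q\<^esub> m = q (\<alpha> b) [^]\<^bsub>Q\<^esub> k"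
    by (simp add: q.hom_int_pow \<alpha>.hom_int_pow)
  have b3: "q (\<alpha> (\<alpha> b)) [^]\<^bsub>Q\<^esub> (m * m) = q b [^]\<^bsub>Q\<^esub> (k * k)"
  proof -
    have "q (\<alpha> (\<alpha> b)) [^]\<^bsub>Q\<^esub> (m * m) = (q (\<alpha> b) [^]\<^bsub>Q\<^esub> k) [^]\<^bsub>Q\<^esub> m"
      by (simp flip: b2 add: Q.int_pow_pow)
    also have "\<dots> = (q (\<alpha> b) [^]\<^bsub>Q\<^esub> m) [^]\<^bsub>Q\<^esub> k" by (simp add: Q.int_pow_pow mult.commute)
    finally show ?thesis by (simp add: b1 Q.int_pow_pow)
  qed
  have b4: "(q (\<alpha> b) [^]\<^bsub>Q\<^esub> \<tau>) [^]\<^bsub>Q\<^esub> (m * m) = q b [^]\<^bsub>Q\<^esub> (\<tau> * k * m)"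
  proof -
    have "(q (\<alpha> b) [^]\<^bsub>Q\<^esub> \<tau>) [^]\<^bsub>Q\<^esub> (m * m) = (q (\<alpha> b) [^]\<^bsub>Q\<^esub> m) [^]\<^bsub>Q\<^esub> (\<tau> * m)"
      by (simp add: Q.int_pow_pow mult_ac)
    then show ?thesis by (simp add: b1 Q.int_pow_pow mult_ac)
  qed
  have "q (\<alpha> (\<alpha> b) \<otimes> inv (\<alpha> b [^] \<tau>) \<otimes> b [^] d) = \<one>\<^bsub>Q\<^esub>"
    using CH[of b] by (subst q1) simp_all
  then have "(q (\<alpha> (\<alpha> b)) \<otimes>\<^bsub>Q\<^esub> inv\<^bsub>Q\<^esub> (q (\<alpha> b) [^]\<^bsub>Q\<^esub> \<tau>) \<otimes>\<^bsub>Q\<^esub> q b [^]\<^bsub>Q\<^esub> d) [^]\<^bsub>Q\<^esub> (m * m) = \<one>\<^bsub>Q\<^esub>"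
    by (simp add: q.hom_int_pow)
  then have "q b [^]\<^bsub>Q\<^esub> (k * k) \<otimes>\<^bsub>Q\<^esub> q b [^]\<^bsub>Q\<^esub> (- (\<tau> * k * m)) \<otimes>\<^bsub>Q\<^esub> q b [^]\<^bsub>Q\<^esub> (d * m * m) = \<one>\<^bsub>Q\<^esub>"
    by (simp add: Q.int_pow_distrib b3 Q.int_pow_inv b4 Q.int_pow_pow Q.int_pow_neg mult_ac)
  then have "q b [^]\<^bsub>Q\<^esub> (k * k - \<tau> * k * m + d * m * m) = \<one>\<^bsub>Q\<^esub>"
    by (simp flip: Q.int_pow_mult add: algebra_simps)
  then have "b [^] (k * k - \<tau> * k * m + d * m * m) \<in> N"
    using q1[of "b [^] (k * k - \<tau> * k * m + d * m * m)"] by (simp add: q.hom_int_pow)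
  then have bN: "b \<in> N" using torsion_free no_rational_eigenvalue[OF \<tau> d m] ab by blast
  then have "q a [^]\<^bsub>Q\<^esub> m = \<one>\<^bsub>Q\<^esub>" using am q1[of b] by (simp add: Q.int_pow_neg)
  then have "a [^] m \<in> N" using q1[of "a [^] m"] by (simp add: q.hom_int_pow)
  then have "a \<in> N" using torsion_free m ab by blast
  then have "generate G {a, b} \<subseteq> N"
    using bN N(1) by (intro generate_subgroup_incl) (auto simp: normal_imp_subgroup)
  then show ?thesis using gen normal_imp_subgroup[OF N(1)] subgroup.subset by blast
qed

end

section \<open>Extensions of the integers by a two-generator group\<close>

text \<open>Conjugation by \<open>t\<close> takes the place of the automorphism induced by
  \<open>h\<close>. In \<open>G\<close> it is inner, so it is trivial on every abelian quotient, and
  this determines the maximal convex subgroup of \<open>G\<close>. On \<open>F\<close> it preserves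
  the restricted order and satisfies the quadratic equation \<open>CH\<close> modulo commutators,
  and this determines the maximal convex subgroup of \<open>F\<close>.\<close>

lemma maximal_convex_subgroups_of_extension:
  fixes G :: "('a, 'b) monoid_scheme" (structure) and less :: "'a rel" and deg :: "'a \<Rightarrow> int"
  assumes "group G" and order: "bi_ordering G less"
    and deg: "\<And>x y. \<lbrakk>x \<in> carrier G; y \<in> carrier G\<rbrakk> \<Longrightarrow> deg (x \<otimes> y) = deg x + deg y"
    and F: "F = {x \<in> carrier G. deg x = 0}"
    and t: "t \<in> carrier G" "deg t = 1"
    and gen: "F = generate G {a, b}" and ab: "a \<in> carrier G" "b \<in> carrier G"
    and nontriv: "F \<noteq> {\<one>}"
    and CH: "\<And>g. g \<in> F \<Longrightarrow> inv t \<otimes> (inv t \<otimes> g \<otimes> t) \<otimes> t \<otimes> inv ((inv t \<otimes> g \<otimes> t) [^] \<tau>) \<otimes> g [^] d \<in> derived G F"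
    and \<tau>: "\<bar>\<tau>\<bar> > (2::int)" and d: "\<bar>d\<bar> = (1::int)"
  shows "maximal_convex_subgroup G less F"
    and "maximal_convex_subgroup (G\<lparr>carrier := F\<rparr>) (less \<inter> F \<times> F) (derived G F)"
proof -
  interpret G: group G by fact
  interpret G: bi_ordered_group G less by (rule bi_ordered_group.intro[OF \<open>group G\<close>]) (unfold_locales, fact order)
  note [simp] = t ab
  have deg1 [simp]: "deg \<one> = 0" using deg[of \<one> \<one>] by simp
  have deg_inv [simp]: "deg (inv x) = - deg x" if "x \<in> carrier G" for x
    using deg[of x "inv x"] that by simp
  have deg_nat_pow: "deg (t [^] (n::nat)) = int n" for n
    by (induction n) (simp_all add: deg)
  have deg_pow [simp]: "deg (t [^] (n::int)) = n" for n
  proof (cases n)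
    case (neg k)
    have "deg (inv (t [^] Suc k)) = - int (Suc k)"
      using deg_nat_pow[of "Suc k"] deg_inv[of "t [^] Suc k"] by (simp only: G.nat_pow_closed t)
    then show ?thesis by (simp only: neg G.int_pow_neg_int t)
  qed (simp add: int_pow_int deg_nat_pow)
  have subF: "subgroup F G"
    unfolding gen by (rule G.generate_is_subgroup) simp
  have abF: "a \<in> F" "b \<in> F" unfolding gen by (auto intro: generate.incl)
  have FG: "g \<in> carrier G" if "g \<in> F" for g using that F by simp
  have conjF: "inv t \<otimes> g \<otimes> t \<in> F" if "g \<in> F" for g using that F by (simp add: deg)
  have decomp: "x \<otimes> inv (t [^] deg x) \<in> F" if "x \<in> carrier G" for x using that F by (simp add: deg)

  have genG: "generate G {a, b, t} = carrier G"
  proof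
    show "generate G {a, b, t} \<subseteq> carrier G" by (rule G.generate_incl) simp
    have sub: "subgroup (generate G {a, b, t}) G" by (rule G.generate_is_subgroup) simp
    show "carrier G \<subseteq> generate G {a, b, t}"
    proof
      fix x assume x: "x \<in> carrier G"
      have "F \<subseteq> generate G {a, b, t}" unfolding gen by (rule G.mono_generate) auto
      then have "x \<otimes> inv (t [^] deg x) \<in> generate G {a, b, t}" using decomp[OF x] by blast
      moreover have "t [^] deg x \<in> generate G {a, b, t}"
        using sub by (intro G.subgroup_int_pow_closed) (auto intro: generate.incl)
      ultimately have "x \<otimes> inv (t [^] deg x) \<otimes> t [^] deg x \<in> generate G {a, b, t}"
        by (rule subgroup.m_closed[OF sub])
      then show "x \<in> generate G {a, b, t}" using x by (simp add: G.m_assoc)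
    qed
  qed
  have "carrier G \<noteq> {\<one>}" using t deg1 by (metis singletonD zero_neq_one)
  then obtain C where C: "maximal_convex_subgroup G less C"
    using G.ex_maximal_convex_subgroup[OF genG] by auto
  then have conv: "convex_subgroup G less C" and "C \<noteq> carrier G" by (auto simp: maximal_convex_subgroup_def)
  note subC = G.convex_subgroupD(1)[OF conv]
  have normC: "C \<lhd> G" by (rule G.maximal_convex_normal[OF C])
  have derC: "derived G (carrier G) \<subseteq> C" by (rule G.derived_subset_maximal_convex[OF C])
  define Q where "Q = G Mod C"
  define q where "q = (\<lambda>x. C #> x)"
  interpret Q: comm_group Q unfolding Q_def by (rule G.quotient_comm_group[OF normC derC])
  interpret q: group_hom G Q q unfolding Q_def q_def by (rule G.quotient_map_hom[OF normC])
  have q1: "q x = \<one>\<^bsub>Q\<^esub> \<longleftrightarrow> x \<in> C" if "x \<in> carrier G" for x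
    unfolding Q_def q_def using G.quotient_map_eq_one_iff[OF normC that] .
  have "F \<subseteq> C"
  proof
    fix g assume g: "g \<in> F"
    note [simp] = FG[OF g]
    have conj: "q (inv t \<otimes> x \<otimes> t) = q x" if "x \<in> carrier G" for x
      using that by (simp add: Q.m_comm[of "inv\<^bsub>Q\<^esub> q t" "q x"] Q.m_assoc)
    define u where "u = inv t \<otimes> g \<otimes> t"
    define w where "w = inv t \<otimes> u \<otimes> t"
    have uw [simp]: "u \<in> carrier G" "w \<in> carrier G" by (simp_all add: u_def w_def)
    have quw: "q u = q g" "q w = q g" using conj[of g] conj[of u] by (simp_all add: u_def[symmetric] w_def[symmetric])
    have "derived G F \<subseteq> C" using derC G.mono_derived[of F "carrier G"] F by blast
    then have "w \<otimes> inv (u [^] \<tau>) \<otimes> g [^] d \<in> C"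
      using CH[OF g] unfolding u_def w_def by blast
    then have "q (w \<otimes> inv (u [^] \<tau>) \<otimes> g [^] d) = \<one>\<^bsub>Q\<^esub>" by (subst q1) simp_all
    then have "q g \<otimes>\<^bsub>Q\<^esub> inv\<^bsub>Q\<^esub> (q g [^]\<^bsub>Q\<^esub> \<tau>) \<otimes>\<^bsub>Q\<^esub> q g [^]\<^bsub>Q\<^esub> d = \<one>\<^bsub>Q\<^esub>"
      by (simp add: q.hom_int_pow quw)
    then have "q g [^]\<^bsub>Q\<^esub> (1 - \<tau> + d) = \<one>\<^bsub>Q\<^esub>"
      using Q.int_pow_mult[of "q g" "1 - \<tau>" d] Q.int_pow_diff[of "q g" 1 \<tau>] by simp
    then have "g [^] (1 - \<tau> + d) \<in> C" using q1[of "g [^] (1 - \<tau> + d)"] by (simp add: q.hom_int_pow)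
    \<comment> \<open>As \<open>d\<close> is 1 or -1, the sum \<open>1 + d\<close> is 2 or 0 and so
      different from \<open>\<tau>\<close>.\<close>
    moreover have "1 - \<tau> + d \<noteq> 0" using \<tau> d by auto
    ultimately show "g \<in> C" using G.convex_root_closed[OF conv FG[OF g]] by blast
  qed
  moreover have "C \<subseteq> F"
  proof
    fix g assume g: "g \<in> C"
    have gG: "g \<in> carrier G" using subgroup.mem_carrier[OF subC g] .
    show "g \<in> F"
    proof (rule ccontr)
      assume "g \<notin> F"
      then have n: "deg g \<noteq> 0" using gG F by simp
      \<comment> \<open>Since \<open>F \<subseteq> C\<close>, an element of \<open>C\<close> of
        degree \<open>n \<noteq> 0\<close> puts \<open>t [^] n\<close> into \<open>C\<close>. Root
        closure then gives \<open>t\<close>, and \<open>F\<close> together with \<open>t\<close>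
        gives the whole group.\<close>
      have fC: "x \<otimes> inv (t [^] deg x) \<in> C" if "x \<in> carrier G" for x using decomp[OF that] \<open>F \<subseteq> C\<close> by blast
      have "inv (g \<otimes> inv (t [^] deg g)) \<otimes> g \<in> C"
        using fC[OF gG] g subgroup.m_closed[OF subC] subgroup.m_inv_closed[OF subC] by blast
      then have "t [^] deg g \<in> C" using gG by (simp add: G.inv_mult_group G.m_assoc)
      then have tC: "t \<in> C" using G.convex_root_closed[OF conv t(1) n] by blast
      have "x \<in> C" if x: "x \<in> carrier G" for x
      proof -
        have "x \<otimes> inv (t [^] deg x) \<otimes> t [^] deg x \<in> C"
          using fC[OF x] G.subgroup_int_pow_closed[OF subC tC] subgroup.m_closed[OF subC] by blast
        then show ?thesis using x by (simp add: G.m_assoc)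
      qed
      then show False using \<open>C \<noteq> carrier G\<close> subgroup.subset[OF subC] by blast
    qed
  qed
  ultimately show "maximal_convex_subgroup G less F" using C by simp

  define H where "H = G\<lparr>carrier := F\<rparr>"
  have H_simps: "carrier H = F" "mult H = mult G" "one H = one G" by (simp_all add: H_def)
  interpret H: group H unfolding H_def by (rule subgroup.subgroup_is_group[OF subF \<open>group G\<close>])
  have H_inv: "inv\<^bsub>H\<^esub> x = inv x" if "x \<in> F" for x
    using G.m_inv_consistent[OF subF that] by (simp add: H_def)
  have H_pow: "x [^]\<^bsub>H\<^esub> (n::int) = x [^] n" if "x \<in> F" for x n
    using G.int_pow_consistent[OF subF that] by (simp add: H_def)
  have H_der: "derived H F = derived G F"
    using G.derived_consistent[OF order_refl subF] by (simp add: H_def)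
  have H_gen: "generate H {a, b} = carrier H"
    using G.generate_consistent[of "{a, b}" F] abF subF gen by (simp add: H_def)
  define lessF where "lessF = less \<inter> F \<times> F"
  have "bi_ordering H lessF"
    using order FG subgroup.m_closed[OF subF] unfolding bi_ordering_def lessF_def H_simps strict_linear_order_on_def
    by (auto simp: trans_def irrefl_def total_on_def)
  then interpret H: bi_ordered_group H lessF
    by (intro bi_ordered_group.intro bi_ordered_group_axioms.intro H.is_group)
  obtain D where D: "maximal_convex_subgroup H lessF D"
    using H.ex_maximal_convex_subgroup[OF H_gen] abF nontriv by (auto simp: H_simps)
  then have convD: "convex_subgroup H lessF D" and properD: "D \<noteq> F"
    by (auto simp: maximal_convex_subgroup_def H_simps)
  have normD: "D \<lhd> H" by (rule H.maximal_convex_normal[OF D])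
  have derD: "derived H (carrier H) \<subseteq> D" by (rule H.derived_subset_maximal_convex[OF D])
  define \<alpha> where "\<alpha> = (\<lambda>g. inv t \<otimes> g \<otimes> t)"
  have \<alpha>hom: "\<alpha> \<in> hom H H"
  proof (rule homI)
    show "\<alpha> x \<in> carrier H" if "x \<in> carrier H" for x using conjF that by (simp add: \<alpha>_def H_simps)
    show "\<alpha> (x \<otimes>\<^bsub>H\<^esub> y) = \<alpha> x \<otimes>\<^bsub>H\<^esub> \<alpha> y" if "x \<in> carrier H" "y \<in> carrier H" for x y
    proof -
      have "t \<otimes> (inv t \<otimes> (y \<otimes> t)) = y \<otimes> t" using that FG by (simp add: H_simps flip: G.m_assoc)
      then show ?thesis using that FG by (simp add: \<alpha>_def H_simps G.m_assoc)
    qed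
  qed
  have \<alpha>D: "\<alpha> g \<in> D" if "g \<in> D" for g
  proof (rule H.maximal_convex_invariant[OF D \<alpha>hom _ _ that])
    have "g \<in> \<alpha> ` F" if g: "g \<in> F" for g
    proof (rule image_eqI)
      show "t \<otimes> g \<otimes> inv t \<in> F" using g F by (simp add: deg)
      have "inv t \<otimes> (t \<otimes> g \<otimes> inv t) \<otimes> t = (inv t \<otimes> t) \<otimes> g \<otimes> (inv t \<otimes> t)"
        using FG[OF g] by (simp only: G.m_assoc G.m_closed G.inv_closed t)
      then show "g = \<alpha> (t \<otimes> g \<otimes> inv t)" using FG[OF g] by (simp add: \<alpha>_def)
    qed
    then show "\<alpha> ` carrier H = carrier H" using conjF by (auto simp: H_simps \<alpha>_def)
    show "H.lt (\<alpha> x) (\<alpha> y)" if "H.lt x y" for x y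
      using that G.lt_mult_right[OF G.lt_mult_left[of x y "inv t"], of t] conjF
      unfolding H.lt_def G.lt_def by (auto simp: lessF_def \<alpha>_def)
  qed
  have torsD: "g \<in> D" if "g \<in> carrier H" "n \<noteq> 0" "g [^]\<^bsub>H\<^esub> n \<in> D" for g and n :: int
    using H.convex_root_closed[OF convD that] .
  have CHD: "\<alpha> (\<alpha> g) \<otimes>\<^bsub>H\<^esub> inv\<^bsub>H\<^esub> (\<alpha> g [^]\<^bsub>H\<^esub> \<tau>) \<otimes>\<^bsub>H\<^esub> g [^]\<^bsub>H\<^esub> d \<in> D" if g: "g \<in> carrier H" for g
  proof -
    have "\<alpha> g \<in> F" using conjF g by (simp add: \<alpha>_def H_simps)
    moreover have "\<alpha> g [^] \<tau> \<in> F" using G.subgroup_int_pow_closed[OF subF] calculation .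
    ultimately have "\<alpha> (\<alpha> g) \<otimes>\<^bsub>H\<^esub> inv\<^bsub>H\<^esub> (\<alpha> g [^]\<^bsub>H\<^esub> \<tau>) \<otimes>\<^bsub>H\<^esub> g [^]\<^bsub>H\<^esub> d \<in> derived G F"
      using CH[of g] g by (simp add: \<alpha>_def H_simps H_inv H_pow)
    then show ?thesis using derD H_der by (auto simp: H_simps)
  qed
  have rel: "i = 0 \<and> j = 0" if ij: "a [^]\<^bsub>H\<^esub> i \<otimes>\<^bsub>H\<^esub> b [^]\<^bsub>H\<^esub> j \<in> D" for i j :: int
  proof (rule ccontr)
    have abH: "a \<in> carrier H" "b \<in> carrier H" using abF by (simp_all add: H_simps)
    assume "\<not> ?thesis"
    moreover have "D = carrier H" if "i \<noteq> 0"
      using H.two_generated_rank_one[OF H_gen abH normD derD torsD \<alpha>hom \<alpha>D CHD \<tau> d that ij] .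
    moreover have "D = carrier H" if "j \<noteq> 0"
    proof -
      \<comment> \<open>Conjugation by the power of \<open>b\<close> reverses the order of the two
        factors, so that \<open>two_generated_rank_one\<close> applies with \<open>a\<close> and
        \<open>b\<close> exchanged.\<close>
      have "b [^]\<^bsub>H\<^esub> j \<otimes>\<^bsub>H\<^esub> (a [^]\<^bsub>H\<^esub> i \<otimes>\<^bsub>H\<^esub> b [^]\<^bsub>H\<^esub> j) \<otimes>\<^bsub>H\<^esub> inv\<^bsub>H\<^esub> (b [^]\<^bsub>H\<^esub> j) \<in> D"
        using normal.inv_op_closed2[OF normD _ ij] abH by simp
      then have "b [^]\<^bsub>H\<^esub> j \<otimes>\<^bsub>H\<^esub> a [^]\<^bsub>H\<^esub> i \<in> D" using abH by (simp add: H.m_assoc)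
      moreover have "generate H {b, a} = carrier H" using H_gen by (simp only: insert_commute)
      ultimately show ?thesis
        by (intro H.two_generated_rank_one[OF _ abH(2,1) normD derD torsD \<alpha>hom \<alpha>D CHD \<tau> d that])
    qed
    ultimately show False using properD by (auto simp: H_simps)
  qed
  \<comment> \<open>In the normal form \<open>c a^i b^j\<close> of an element of \<open>D\<close>
    the factor \<open>c\<close> already lies in \<open>D\<close>, so \<open>rel\<close> makes both
    exponents vanish.\<close>
  have "D \<subseteq> derived H F"
  proof
    fix g assume g: "g \<in> D"
    have subD: "subgroup D H" by (rule H.convex_subgroupD(1)[OF convD])
    have abH: "a \<in> carrier H" "b \<in> carrier H" using abF by (simp_all add: H_simps)
    obtain c and i j :: int where c: "c \<in> derived H (carrier H)" "g = c \<otimes>\<^bsub>H\<^esub> (a [^]\<^bsub>H\<^esub> i \<otimes>\<^bsub>H\<^esub> b [^]\<^bsub>H\<^esub> j)"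
      using H.two_generated_normal_form[OF H_gen abH subgroup.mem_carrier[OF subD g]] .
    have cD: "c \<in> D" using derD c(1) by blast
    then have cH: "c \<in> carrier H" using subgroup.mem_carrier[OF subD] by blast
    have "inv\<^bsub>H\<^esub> c \<otimes>\<^bsub>H\<^esub> g \<in> D" using cD g subD by (simp add: subgroup.m_closed subgroup.m_inv_closed)
    moreover have "inv\<^bsub>H\<^esub> c \<otimes>\<^bsub>H\<^esub> g = a [^]\<^bsub>H\<^esub> i \<otimes>\<^bsub>H\<^esub> b [^]\<^bsub>H\<^esub> j" using c(2) cH abH by (simp flip: H.m_assoc)
    ultimately have "i = 0 \<and> j = 0" using rel by simp
    then have "g = c" using c(2) cH by simp
    then show "g \<in> derived H F" using c(1) by (simp add: H_simps)
  qed
  then have "D = derived G F" using derD H_der by (auto simp: H_simps)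
  then show "maximal_convex_subgroup (G\<lparr>carrier := F\<rparr>) (less \<inter> F \<times> F) (derived G F)"
    using D by (simp add: H_def lessF_def)
qed

section \<open>Path homotopy and the fundamental group\<close>

text \<open>On loops at \<open>x\<close> this is the relation behind \<open>loop_class\<close>.
  Taking the end points from \<open>p\<close> extends it to paths that are not closed.\<close>

definition path_homotopic :: "'a topology \<Rightarrow> (real \<Rightarrow> 'a) \<Rightarrow> (real \<Rightarrow> 'a) \<Rightarrow> bool" where
  "path_homotopic X p q \<longleftrightarrow>
     homotopic_with (\<lambda>r. r 0 = p 0 \<and> r 1 = p 1) (top_of_set {0..1}) X p q"

definition path_inverse :: "(real \<Rightarrow> 'a) \<Rightarrow> real \<Rightarrow> 'a" where
  "path_inverse p = (\<lambda>t. p (1 - t))"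

lemma path_inverse_ends [simp]: "path_inverse p 0 = p 1" "path_inverse p 1 = p 0"
  by (simp_all add: path_inverse_def)

lemma loop_concat_ends [simp]: "loop_concat p q 0 = p 0" "loop_concat p q 1 = q 1"
  by (simp_all add: loop_concat_def)

lemma comp_loop_concat: "f \<circ> loop_concat p q = loop_concat (f \<circ> p) (f \<circ> q)"
  by (auto simp: loop_concat_def)

lemma comp_path_inverse: "f \<circ> path_inverse p = path_inverse (f \<circ> p)"
  by (auto simp: path_inverse_def)

lemma prod_top_of_set: "prod_topology (top_of_set A) (top_of_set B) = top_of_set (A \<times> B)"
  by (metis prod_topology_euclidean subtopology_Times)

lemma path_homotopicD:
  assumes "path_homotopic X p q"
  shows "pathin X p" "pathin X q" "q 0 = p 0" "q 1 = p 1"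
  using homotopic_with_imp_continuous_maps[OF assms[unfolded path_homotopic_def]]
    homotopic_with_imp_property[OF assms[unfolded path_homotopic_def]]
  by (auto simp: pathin_def)

lemma path_homotopic_refl [simp]: "path_homotopic X p p \<longleftrightarrow> pathin X p"
  by (simp add: path_homotopic_def pathin_def)

lemma path_homotopic_sym: "path_homotopic X p q \<Longrightarrow> path_homotopic X q p"
  using path_homotopicD[of X p q] by (simp add: path_homotopic_def homotopic_with_symD)

lemma path_homotopic_trans [trans]:
  "path_homotopic X p q \<Longrightarrow> path_homotopic X q r \<Longrightarrow> path_homotopic X p r"
  using path_homotopicD(3,4)[of X p q] unfolding path_homotopic_def
  by (auto elim: homotopic_with_trans)

text \<open>Paths are functions on all reals, but only their values on \<open>{0..1}\<close> count;
  formulas for concatenations and lifts are compared through this lemma.\<close>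

lemma path_homotopic_eq:
  assumes "pathin X p" "\<And>t. t \<in> {0..1} \<Longrightarrow> p t = q t"
  shows "path_homotopic X p q"
  using assms unfolding path_homotopic_def pathin_def
  by (intro homotopic_with_equal) auto

lemma path_homotopic_comp:
  assumes "path_homotopic X p q" "continuous_map X Y f"
  shows "path_homotopic Y (f \<circ> p) (f \<circ> q)"
  using assms unfolding path_homotopic_def
  by (elim homotopic_with_compose_continuous_map_left) auto

lemma path_homotopic_top_of_set:
  "path_homotopic (top_of_set S) p q \<longleftrightarrow> homotopic_paths S p q"
  by (simp add: path_homotopic_def homotopic_paths_def pathstart_def pathfinish_def)

text \<open>A straight-line homotopy in \<open>K\<close> followed by \<open>w\<close>. For the group
  laws \<open>K\<close> is the unit interval and one path is reparametrized; for loops on a circle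
  \<open>K\<close> is the line of angles.\<close>

lemma path_homotopic_convex:
  fixes K :: "'b::real_normed_vector set"
  assumes K: "convex K" and w: "continuous_map (top_of_set K) X w"
    and f: "continuous_on {0..1} f" "f \<in> {0..1} \<rightarrow> K"
    and g: "continuous_on {0..1} g" "g \<in> {0..1} \<rightarrow> K"
    and ends: "f 0 = g 0" "f 1 = g 1"
  shows "path_homotopic X (w \<circ> f) (w \<circ> g)"
proof -
  have "homotopic_paths K f g"
    by (rule homotopic_paths_linear)
      (use f g ends K in \<open>auto simp: path_def pathstart_def pathfinish_def convex_contains_segment Pi_def\<close>)
  then show ?thesis
    using path_homotopic_comp[OF _ w] by (simp add: path_homotopic_top_of_set)
qed

lemma path_homotopic_reparametrize:
  assumes "pathin X p"
    and "continuous_on {0..1} f" "f \<in> {0..1} \<rightarrow> {0..1}"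
    and "continuous_on {0..1} g" "g \<in> {0..1} \<rightarrow> {0..1}"
    and "f 0 = g 0" "f 1 = g 1"
  shows "path_homotopic X (p \<circ> f) (p \<circ> g)"
  using assms by (intro path_homotopic_convex[of "{0..1::real}"]) (auto simp: pathin_def)

lemma pathin_comp: "pathin X p \<Longrightarrow> continuous_map X Y f \<Longrightarrow> pathin Y (f \<circ> p)"
  by (simp add: pathin_def continuous_map_compose)

lemma continuous_on_loop_concat:
  assumes "continuous_on {0..1} p" "continuous_on {0..1} q" "p 1 = q 0"
  shows "continuous_on {0..1} (loop_concat p q)"
  using assms path_join[of p q]
  by (simp add: path_def loop_concat_def joinpaths_def pathstart_def pathfinish_def)

text \<open>The pasting lemma with a parameter in \<open>Z\<close>, which in
  \<open>path_homotopic_concat\<close> is the parameter of the homotopy.\<close>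

lemma continuous_map_concat:
  fixes H K :: "'z \<times> real \<Rightarrow> 'a"
  assumes H: "continuous_map (prod_topology Z (top_of_set {0..1})) X H"
    and K: "continuous_map (prod_topology Z (top_of_set {0..1})) X K"
    and eq: "\<And>z. z \<in> topspace Z \<Longrightarrow> H (z, 1) = K (z, 0)"
  shows "continuous_map (prod_topology Z (top_of_set {0..1})) X
     (\<lambda>y. if snd y \<le> 1/2 then (H \<circ> (\<lambda>y. (fst y, 2 * snd y))) y else (K \<circ> (\<lambda>y. (fst y, 2 * snd y - 1))) y)"
proof (rule continuous_map_cases_le)
  let ?ZI = "prod_topology Z (top_of_set {0..1::real})"
  have snd: "continuous_map ?ZI euclideanreal snd"
    using continuous_map_snd continuous_map_into_fulltopology by blast
  show "continuous_map ?ZI euclideanreal snd" by (rule snd)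
  show "continuous_map (subtopology ?ZI {y \<in> topspace ?ZI. snd y \<le> 1/2}) X (H \<circ> (\<lambda>y. (fst y, 2 * snd y)))"
  proof (rule continuous_map_compose[OF _ H])
    show "continuous_map (subtopology ?ZI {y \<in> topspace ?ZI. snd y \<le> 1/2}) ?ZI (\<lambda>y. (fst y, 2 * snd y))"
      by (intro continuous_map_pairedI continuous_map_into_subtopology continuous_intros
          continuous_map_from_subtopology[OF snd] continuous_map_from_subtopology[OF continuous_map_fst]) auto
  qed
  show "continuous_map (subtopology ?ZI {y \<in> topspace ?ZI. 1/2 \<le> snd y}) X (K \<circ> (\<lambda>y. (fst y, 2 * snd y - 1)))"
  proof (rule continuous_map_compose[OF _ K])
    show "continuous_map (subtopology ?ZI {y \<in> topspace ?ZI. 1/2 \<le> snd y}) ?ZI (\<lambda>y. (fst y, 2 * snd y - 1))"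
      by (intro continuous_map_pairedI continuous_map_into_subtopology continuous_intros
          continuous_map_from_subtopology[OF snd] continuous_map_from_subtopology[OF continuous_map_fst]) auto
  qed
  show "(H \<circ> (\<lambda>y. (fst y, 2 * snd y))) y = (K \<circ> (\<lambda>y. (fst y, 2 * snd y - 1))) y"
    if "y \<in> topspace ?ZI" "snd y = 1/2" for y
  proof -
    have "2 * snd y = 1" "2 * snd y - 1 = 0" using that(2) by simp_all
    then show ?thesis using that(1) eq[of "fst y"] by (auto simp only: comp_apply topspace_prod_topology mem_Times_iff)
  qed
qed simp

lemma path_homotopic_concat:
  assumes pp: "path_homotopic X p p'" and qq: "path_homotopic X q q'" and pq: "p 1 = q 0"
  shows "path_homotopic X (loop_concat p q) (loop_concat p' q')"
proof -
  let ?I = "top_of_set {0..1::real}"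
  obtain H where H: "continuous_map (prod_topology ?I ?I) X H" "\<And>t. H (0, t) = p t" "\<And>t. H (1, t) = p' t"
    "\<And>s. s \<in> {0..1} \<Longrightarrow> H (s, 0) = p 0 \<and> H (s, 1) = p 1"
    using pp unfolding path_homotopic_def homotopic_with_def by blast
  obtain K where K: "continuous_map (prod_topology ?I ?I) X K" "\<And>t. K (0, t) = q t" "\<And>t. K (1, t) = q' t"
    "\<And>s. s \<in> {0..1} \<Longrightarrow> K (s, 0) = q 0 \<and> K (s, 1) = q 1"
    using qq unfolding path_homotopic_def homotopic_with_def by blast
  let ?J = "\<lambda>y. if snd y \<le> 1/2 then (H \<circ> (\<lambda>y. (fst y, 2 * snd y))) y else (K \<circ> (\<lambda>y. (fst y, 2 * snd y - 1))) y"
  have "continuous_map (prod_topology ?I ?I) X ?J"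
    by (rule continuous_map_concat[OF H(1) K(1)]) (use H(4) K(4) pq in auto)
  then show ?thesis
    unfolding path_homotopic_def homotopic_with_def
    by (intro exI[of _ ?J]) (use H K in \<open>auto simp: loop_concat_def\<close>)
qed

lemma pathin_concat:
  assumes "pathin X p" "pathin X q" "p 1 = q 0"
  shows "pathin X (loop_concat p q)"
  using path_homotopicD(1)[OF path_homotopic_concat[of X p p q q]] assms by simp

lemma pathin_inverse: "pathin X p \<Longrightarrow> pathin X (path_inverse p)"
  using path_homotopic_reparametrize[of X p "\<lambda>t. 1 - t" "\<lambda>t. 1 - t"]
  by (auto simp: path_inverse_def comp_def continuous_intros)

lemma path_homotopic_rid:
  assumes "pathin X p"
  shows "path_homotopic X (loop_concat p (\<lambda>_. p 1)) p"
proof -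
  have "path_homotopic X (p \<circ> loop_concat id (\<lambda>_. 1)) (p \<circ> id)"
    by (rule path_homotopic_reparametrize[OF assms continuous_on_loop_concat])
      (auto simp: loop_concat_def)
  then show ?thesis by (simp add: comp_loop_concat comp_def[of p "\<lambda>_. _"])
qed

lemma path_homotopic_lid:
  assumes "pathin X p"
  shows "path_homotopic X (loop_concat (\<lambda>_. p 0) p) p"
proof -
  have "path_homotopic X (p \<circ> loop_concat (\<lambda>_. 0) id) (p \<circ> id)"
    by (rule path_homotopic_reparametrize[OF assms continuous_on_loop_concat])
      (auto simp: loop_concat_def)
  then show ?thesis by (simp add: comp_loop_concat comp_def[of p "\<lambda>_. _"])
qed

lemma path_homotopic_rinv:
  assumes "pathin X p"
  shows "path_homotopic X (loop_concat p (path_inverse p)) (\<lambda>_. p 0)"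
proof -
  have "path_homotopic X (p \<circ> loop_concat id (path_inverse id)) (p \<circ> (\<lambda>_. 0))"
    by (rule path_homotopic_reparametrize[OF assms continuous_on_loop_concat])
      (auto intro!: continuous_intros simp: loop_concat_def path_inverse_def)
  then show ?thesis by (simp add: comp_loop_concat comp_path_inverse comp_def[of p "\<lambda>_. _"])
qed

lemma path_homotopic_linv:
  assumes "pathin X p"
  shows "path_homotopic X (loop_concat (path_inverse p) p) (\<lambda>_. p 1)"
  using path_homotopic_rinv[OF pathin_inverse[OF assms]] by (simp add: path_inverse_def)

lemma path_homotopic_assoc:
  assumes "pathin X p" "pathin X q" "pathin X r" "p 1 = q 0" "q 1 = r 0"
  shows "path_homotopic X (loop_concat (loop_concat p q) r) (loop_concat p (loop_concat q r))"
proof -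
  let ?w = "loop_concat p (loop_concat q r)"
  \<comment> \<open>\<open>?w\<close> runs through \<open>p\<close>, \<open>q\<close>,
    \<open>r\<close> on \<open>[0, 1/2]\<close>, \<open>[1/2, 3/4]\<close>, \<open>[3/4, 1]\<close>.
    Onto these \<open>?f\<close> maps the intervals \<open>[0, 1/4]\<close>,
    \<open>[1/4, 1/2]\<close>, \<open>[1/2, 1]\<close> of the other bracketing.\<close>
  let ?f = "loop_concat (loop_concat (\<lambda>t. t / 2) (\<lambda>t. 1/2 + t / 4)) (\<lambda>t. 3/4 + t / 4) :: real \<Rightarrow> real"
  have w: "pathin X ?w" using assms by (intro pathin_concat) auto
  have f: "continuous_on {0..1} ?f" by (intro continuous_on_loop_concat continuous_intros) auto
  have f01: "?f \<in> {0..1} \<rightarrow> {0..1}" by (auto simp: loop_concat_def field_simps)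
  have h: "path_homotopic X (?w \<circ> ?f) (?w \<circ> id)"
    by (rule path_homotopic_reparametrize[OF w f f01]) auto
  have "(?w \<circ> ?f) t = loop_concat (loop_concat p q) r t" for t
  proof -
    consider "t \<le> 1/4" | "1/4 < t" "t \<le> 1/2" | "1/2 < t" by linarith
    then show ?thesis
    proof cases
      case 1
      then have "?f t = 2 * t" by (simp add: loop_concat_def)
      then show ?thesis using 1 by (simp add: loop_concat_def)
    next
      case 2
      then have "?f t = t + 1/4" by (simp add: loop_concat_def field_simps)
      moreover have "2 * (t + 1/4) - 1 \<le> 1/2" "2 * (2 * (t + 1/4) - 1) = 2 * (2 * t) - 1" using 2 by simp_all
      ultimately show ?thesis using 2 by (simp add: loop_concat_def)
    next
      case 3
      then have "?f t = 1/2 + t/2" by (simp add: loop_concat_def field_simps)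
      moreover have "\<not> 1/2 + t/2 \<le> 1/2" "\<not> 2 * (1/2 + t/2) - 1 \<le> 1/2"
        "2 * (2 * (1/2 + t/2) - 1) - 1 = 2 * t - 1" using 3 by simp_all
      ultimately show ?thesis using 3 by (simp add: loop_concat_def)
    qed
  qed
  then show ?thesis using h by (metis comp_id ext)
qed

section \<open>Loops, their classes and the group laws\<close>

lemma loopsD: "p \<in> loops X x \<Longrightarrow> pathin X p" "p \<in> loops X x \<Longrightarrow> p 0 = x" "p \<in> loops X x \<Longrightarrow> p 1 = x"
  by (auto simp: loops_def)

lemma loop_class_eq: "p \<in> loops X x \<Longrightarrow> loop_class X x p = {q. path_homotopic X p q}"
  by (simp add: loop_class_def path_homotopic_def loops_def)

lemma loop_class_eq_iff:
  assumes "p \<in> loops X x" "q \<in> loops X x"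
  shows "loop_class X x p = loop_class X x q \<longleftrightarrow> path_homotopic X p q"
proof -
  have qq: "path_homotopic X q q" using loopsD(1)[OF assms(2)] by simp
  have "{r. path_homotopic X p r} = {r. path_homotopic X q r} \<longleftrightarrow> path_homotopic X p q"
  proof
    assume "{r. path_homotopic X p r} = {r. path_homotopic X q r}"
    then show "path_homotopic X p q" using qq by (simp add: set_eq_iff)
  next
    assume pq: "path_homotopic X p q"
    show "{r. path_homotopic X p r} = {r. path_homotopic X q r}"
      using path_homotopic_trans[OF pq] path_homotopic_trans[OF path_homotopic_sym[OF pq]] by auto
  qed
  then show ?thesis by (simp add: loop_class_eq assms)
qed

lemma loops_homotopic: "p \<in> loops X x \<Longrightarrow> path_homotopic X p q \<Longrightarrow> q \<in> loops X x"
  using path_homotopicD[of X p q] by (auto simp: loops_def)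

lemma loops_concat: "p \<in> loops X x \<Longrightarrow> q \<in> loops X x \<Longrightarrow> loop_concat p q \<in> loops X x"
  by (auto simp: loops_def pathin_concat)

lemma loops_inverse: "p \<in> loops X x \<Longrightarrow> path_inverse p \<in> loops X x"
  by (auto simp: loops_def pathin_inverse)

lemma loops_const: "x \<in> topspace X \<Longrightarrow> (\<lambda>_. x) \<in> loops X x"
  by (auto simp: loops_def)

lemma loops_comp: "p \<in> loops X x \<Longrightarrow> continuous_map X Y f \<Longrightarrow> f \<circ> p \<in> loops Y (f x)"
  by (auto simp: loops_def pathin_comp)

lemma carrier_fundamental_group: "carrier (fundamental_group X x) = loop_class X x ` loops X x"
  by (simp add: fundamental_group_def)

lemma loop_class_in_carrier: "p \<in> loops X x \<Longrightarrow> loop_class X x p \<in> carrier (fundamental_group X x)"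
  by (simp add: fundamental_group_def)

lemma one_fundamental_group: "\<one>\<^bsub>fundamental_group X x\<^esub> = loop_class X x (\<lambda>_. x)"
  by (simp add: fundamental_group_def)

text \<open>Evaluates the definitions that take a union of equal classes over all
  representatives.\<close>

lemma UN_eq_const:
  assumes "a \<in> A" "\<And>a. a \<in> A \<Longrightarrow> f a = c"
  shows "(\<Union>a\<in>A. f a) = c"
  using assms by blast

lemma mult_fundamental_group:
  assumes p: "p \<in> loops X x" and q: "q \<in> loops X x"
  shows "loop_class X x p \<otimes>\<^bsub>fundamental_group X x\<^esub> loop_class X x q = loop_class X x (loop_concat p q)"
proof -
  have "loop_class X x (loop_concat p' q') = loop_class X x (loop_concat p q)"
    if "p' \<in> loop_class X x p" "q' \<in> loop_class X x q" for p' q'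
  proof -
    have h: "path_homotopic X p p'" "path_homotopic X q q'"
      using that by (simp_all add: loop_class_eq p q)
    then have "path_homotopic X (loop_concat p q) (loop_concat p' q')"
      using p q by (intro path_homotopic_concat) (auto simp: loops_def)
    moreover have "p' \<in> loops X x" "q' \<in> loops X x" using loops_homotopic[OF p] loops_homotopic[OF q] h by simp_all
    ultimately show ?thesis
      using p q by (simp add: loop_class_eq_iff loops_concat path_homotopic_sym)
  qed
  moreover have "p \<in> loop_class X x p" "q \<in> loop_class X x q"
    using p q by (simp_all add: loop_class_eq loopsD)
  ultimately have "(\<Union>p'\<in>loop_class X x p. \<Union>q'\<in>loop_class X x q. loop_class X x (loop_concat p' q'))
      = loop_class X x (loop_concat p q)"
    by (intro UN_eq_const[of p] UN_eq_const[of q])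
  then show ?thesis by (simp add: fundamental_group_def)
qed

lemma group_fundamental_group:
  assumes "x \<in> topspace X"
  shows "group (fundamental_group X x)"
proof (rule groupI)
  let ?G = "fundamental_group X x"
  fix a b c assume "a \<in> carrier ?G" "b \<in> carrier ?G" "c \<in> carrier ?G"
  then obtain p q r where [simp]: "p \<in> loops X x" "q \<in> loops X x" "r \<in> loops X x"
    and abc: "a = loop_class X x p" "b = loop_class X x q" "c = loop_class X x r"
    by (auto simp: carrier_fundamental_group)
  show "a \<otimes>\<^bsub>?G\<^esub> b \<in> carrier ?G"
    by (simp add: abc mult_fundamental_group loops_concat loop_class_in_carrier)
  show "a \<otimes>\<^bsub>?G\<^esub> b \<otimes>\<^bsub>?G\<^esub> c = a \<otimes>\<^bsub>?G\<^esub> (b \<otimes>\<^bsub>?G\<^esub> c)"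
    using path_homotopic_assoc[of X p q r] loopsD[of p X x] loopsD[of q X x] loopsD[of r X x]
    by (simp add: abc mult_fundamental_group loops_concat loop_class_eq_iff)
next
  let ?G = "fundamental_group X x"
  show "\<one>\<^bsub>?G\<^esub> \<in> carrier ?G" by (simp add: one_fundamental_group loop_class_in_carrier loops_const assms)
  fix a assume "a \<in> carrier ?G"
  then obtain p where p [simp]: "p \<in> loops X x" and a: "a = loop_class X x p"
    by (auto simp: carrier_fundamental_group)
  show "\<one>\<^bsub>?G\<^esub> \<otimes>\<^bsub>?G\<^esub> a = a"
    using path_homotopic_lid[of X p] loopsD[OF p]
    by (simp add: a one_fundamental_group mult_fundamental_group loops_concat loop_class_eq_iff loops_const assms)
  have "loop_class X x (path_inverse p) \<otimes>\<^bsub>?G\<^esub> a = \<one>\<^bsub>?G\<^esub>"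
    using path_homotopic_linv[of X p] loopsD[OF p]
    by (simp add: a one_fundamental_group mult_fundamental_group loops_concat loop_class_eq_iff loops_const loops_inverse assms)
  then show "\<exists>y\<in>carrier ?G. y \<otimes>\<^bsub>?G\<^esub> a = \<one>\<^bsub>?G\<^esub>"
    using loop_class_in_carrier[OF loops_inverse[OF p]] by blast
qed

lemma inv_fundamental_group:
  assumes p: "p \<in> loops X x"
  shows "inv\<^bsub>fundamental_group X x\<^esub> (loop_class X x p) = loop_class X x (path_inverse p)"
proof -
  have x: "x \<in> topspace X" using loopsD(1,2)[OF p] path_start_in_topspace[of X p] by simp
  interpret group "fundamental_group X x" by (rule group_fundamental_group[OF x])
  have "loop_class X x (path_inverse p) \<otimes>\<^bsub>fundamental_group X x\<^esub> loop_class X x p = \<one>\<^bsub>fundamental_group X x\<^esub>"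
    using path_homotopic_linv[of X p] loopsD[OF p]
    by (simp add: one_fundamental_group mult_fundamental_group loops_concat loop_class_eq_iff loops_const loops_inverse p x)
  then show ?thesis
    by (rule inv_equality) (simp_all add: p loop_class_in_carrier loops_inverse)
qed

lemma fundamental_group_map_class:
  assumes p: "p \<in> loops X x" and f: "continuous_map X Y f" and y: "f x = y"
  shows "fundamental_group_map Y y f (loop_class X x p) = loop_class Y y (f \<circ> p)"
proof -
  have "loop_class Y y (f \<circ> q) = loop_class Y y (f \<circ> p)" if "q \<in> loop_class X x p" for q
  proof -
    have "path_homotopic X p q" using that by (simp add: loop_class_eq p)
    then have h: "path_homotopic Y (f \<circ> p) (f \<circ> q)" and q: "q \<in> loops X x"
      using path_homotopic_comp[OF _ f] loops_homotopic[OF p] by simp_all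
    show ?thesis
      using loop_class_eq_iff[OF loops_comp[OF q f] loops_comp[OF p f]] path_homotopic_sym[OF h] y by simp
  qed
  moreover have "p \<in> loop_class X x p"
    using p by (simp add: loop_class_eq loopsD)
  ultimately show ?thesis unfolding fundamental_group_map_def by (intro UN_eq_const[of p])
qed

lemma fundamental_group_map_hom:
  assumes f: "continuous_map X Y f" and y: "f x = y"
  shows "fundamental_group_map Y y f \<in> hom (fundamental_group X x) (fundamental_group Y y)"
proof (rule homI)
  let ?f = "fundamental_group_map Y y f"
  fix a b assume "a \<in> carrier (fundamental_group X x)" "b \<in> carrier (fundamental_group X x)"
  then obtain p q where p: "p \<in> loops X x" "a = loop_class X x p" and q: "q \<in> loops X x" "b = loop_class X x q"
    by (auto simp: carrier_fundamental_group)
  have fpq: "f \<circ> p \<in> loops Y y" "f \<circ> q \<in> loops Y y" using loops_comp[OF p(1) f] loops_comp[OF q(1) f] y by simp_all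
  then show "?f a \<in> carrier (fundamental_group Y y)"
    using p f y by (simp add: fundamental_group_map_class[of _ X x] loop_class_in_carrier)
  show "?f (a \<otimes>\<^bsub>fundamental_group X x\<^esub> b) = ?f a \<otimes>\<^bsub>fundamental_group Y y\<^esub> ?f b"
    using p q fpq f y
    by (simp add: fundamental_group_map_class[of _ X x] mult_fundamental_group loops_concat comp_loop_concat)
qed

section \<open>The Hurewicz homomorphism\<close>

text \<open>The coordinate \<open>x 1\<close> runs from 0 at vertex 0 to 1 at vertex 1, so the
  simplex is oriented like \<open>p\<close>. Singular simplices are extensional functions, hence the
  restriction.\<close>

definition path_simplex :: "(real \<Rightarrow> 'a) \<Rightarrow> (nat \<Rightarrow> real) \<Rightarrow> 'a" where
  "path_simplex p = restrict (\<lambda>x. p (x 1)) (standard_simplex 1)"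

abbreviation path_chain :: "(real \<Rightarrow> 'a) \<Rightarrow> 'a chain" where
  "path_chain p \<equiv> frag_of (path_simplex p)"

abbreviation point_chain :: "'a \<Rightarrow> 'a chain" where
  "point_chain y \<equiv> frag_of (restrict (\<lambda>_. y) (standard_simplex 0))"

text \<open>The inverse of the coordinate \<open>x 1\<close> on the standard 1-simplex; it turns a
  singular 1-simplex back into a path.\<close>

definition simplex_edge :: "real \<Rightarrow> nat \<Rightarrow> real" where
  "simplex_edge t = (\<lambda>i. if i = 0 then 1 - t else if i = 1 then t else 0)"

lemma standard_simplex_1D:
  assumes "x \<in> standard_simplex 1"
  shows "x 0 = 1 - x 1" "x 1 \<in> {0..1}" "simplex_edge (x 1) = x"
proof -
  have x: "\<forall>i. 0 \<le> x i \<and> x i \<le> 1" "\<forall>i>1. x i = 0" "x 0 + x 1 = 1"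
    using assms by (auto simp: standard_simplex_def)
  then show "x 0 = 1 - x 1" "x 1 \<in> {0..1}" by auto
  then show "simplex_edge (x 1) = x" using x(2) by (auto simp: simplex_edge_def fun_eq_iff)
qed

lemma simplex_edge_in: "t \<in> {0..1} \<Longrightarrow> simplex_edge t \<in> standard_simplex 1"
  by (auto simp: simplex_edge_def standard_simplex_def)

lemma singular_simplex_euclidean:
  "singular_simplex n X f \<longleftrightarrow> continuous_map (top_of_set (standard_simplex n)) X f \<and> f \<in> extensional (standard_simplex n)"
  by (simp add: singular_simplex_def euclidean_product_topology)

lemma continuous_on_coordinate: "continuous_on S (\<lambda>x::nat \<Rightarrow> real. x i)"
  by (rule continuous_on_subset[OF continuous_on_product_coordinates]) simp

lemma singular_simplex_path_simplex:
  assumes "pathin X p"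
  shows "singular_simplex 1 X (path_simplex p)"
proof -
  have "continuous_map (top_of_set (standard_simplex 1)) (top_of_set {0..1}) (\<lambda>x::nat \<Rightarrow> real. x 1)"
    using standard_simplex_1D(2) by (auto intro!: continuous_on_coordinate)
  then have "continuous_map (top_of_set (standard_simplex 1)) X (p \<circ> (\<lambda>x. x 1))"
    using assms unfolding pathin_def by (rule continuous_map_compose)
  then have "continuous_map (top_of_set (standard_simplex 1)) X (path_simplex p)"
    by (rule continuous_map_eq) (simp add: path_simplex_def)
  then show ?thesis by (simp add: singular_simplex_euclidean path_simplex_def)
qed

lemma path_simplex_eq:
  assumes "\<And>t. t \<in> {0..1} \<Longrightarrow> p t = q t"
  shows "path_simplex p = path_simplex q"
  using assms standard_simplex_1D(2) by (auto simp: path_simplex_def restrict_def fun_eq_iff)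

lemma singular_simplex_1_path:
  assumes "singular_simplex 1 X \<sigma>"
  obtains s where "pathin X s" "\<sigma> = path_simplex s"
proof
  have "continuous_on {0..1} (\<lambda>t. simplex_edge t)"
  proof (rule continuous_on_coordinatewise_then_product)
    show "continuous_on {0..1} (\<lambda>t. simplex_edge t i)" for i
      by (cases "i = 0"; cases "i = 1") (auto simp: simplex_edge_def intro!: continuous_intros)
  qed
  then have "continuous_map (top_of_set {0..1}) (top_of_set (standard_simplex 1)) simplex_edge"
    using simplex_edge_in by auto
  moreover have "continuous_map (top_of_set (standard_simplex 1)) X \<sigma>"
    using assms by (simp only: singular_simplex_euclidean)
  ultimately show "pathin X (\<sigma> \<circ> simplex_edge)"
    unfolding pathin_def by (rule continuous_map_compose)
  have "\<sigma> x = path_simplex (\<sigma> \<circ> simplex_edge) x" for x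
    using assms standard_simplex_1D(3)[of x]
    by (cases "x \<in> standard_simplex 1") (auto simp: path_simplex_def singular_simplex_euclidean extensional_def)
  then show "\<sigma> = path_simplex (\<sigma> \<circ> simplex_edge)" by (rule ext)
qed

lemma singular_chain_path_chain: "pathin X p \<Longrightarrow> singular_chain 1 X (path_chain p)"
  using singular_simplex_path_simplex by (simp add: singular_chain_of)

lemma standard_simplex_0D: "x \<in> standard_simplex 0 \<Longrightarrow> x i = (if i = 0 then 1 else 0)"
  by (auto simp: standard_simplex_0)

lemma chain_boundary_path_chain: "chain_boundary 1 (path_chain p) = point_chain (p 1) - point_chain (p 0)"
proof -
  have face: "singular_face 1 k (path_simplex p) = restrict (\<lambda>_. p (if k = 0 then 1 else 0)) (standard_simplex 0)"
    if "k \<le> 1" for k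
  proof
    fix x
    have "simplical_face k x \<in> standard_simplex 1" if "x \<in> standard_simplex 0"
      using simplical_face_in_standard_simplex[of 1 k x] that \<open>k \<le> 1\<close> by simp
    then show "singular_face 1 k (path_simplex p) x = restrict (\<lambda>_. p (if k = 0 then 1 else 0)) (standard_simplex 0) x"
      using that by (auto simp: singular_face_def path_simplex_def simplical_face_def standard_simplex_0D restrict_def)
  qed
  show ?thesis
    using face[of 0] face[of 1] by (simp add: chain_boundary_of)
qed

text \<open>The affine 2-simplex in \<open>K\<close> with vertices \<open>a\<close>,
  \<open>b\<close>, \<open>c\<close>, followed by \<open>w\<close>, has the difference of the two
  sides as its boundary. Concatenation and path homotopy are both reduced to this by a choice of
  \<open>K\<close> and \<open>w\<close>.\<close>

lemma homologous_triangle: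
  fixes K :: "'b::real_normed_vector set"
  assumes K: "convex K" and w: "continuous_map (top_of_set K) X w"
    and abc: "a \<in> K" "b \<in> K" "c \<in> K"
  shows "homologous_rel 1 X {} (path_chain (w \<circ> linepath a b) + path_chain (w \<circ> linepath b c))
     (path_chain (w \<circ> linepath a c))"
proof -
  define \<sigma> where "\<sigma> = restrict (\<lambda>x::nat \<Rightarrow> real. w (x 0 *\<^sub>R a + x 1 *\<^sub>R b + x 2 *\<^sub>R c)) (standard_simplex 2)"
  have inK: "x 0 *\<^sub>R a + x 1 *\<^sub>R b + x 2 *\<^sub>R c \<in> K" if "x \<in> standard_simplex 2" for x
  proof -
    have "x 0 + x 1 + x 2 = 1" "x 0 \<ge> 0" "x 1 \<ge> 0" "x 2 \<ge> 0"
      using that by (auto simp: standard_simplex_def numeral_2_eq_2)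
    then have "x 0 *\<^sub>R a + x 1 *\<^sub>R b + x 2 *\<^sub>R c \<in> convex hull {a, b, c}"
      by (auto simp: convex_hull_3)
    moreover have "convex hull {a, b, c} \<subseteq> K" using abc K by (intro hull_minimal) auto
    ultimately show ?thesis by (rule subsetD[rotated])
  qed
  have "continuous_map (top_of_set (standard_simplex 2)) (top_of_set K) (\<lambda>x::nat \<Rightarrow> real. x 0 *\<^sub>R a + x 1 *\<^sub>R b + x 2 *\<^sub>R c)"
    using inK by (auto intro!: continuous_intros continuous_on_coordinate)
  then have "continuous_map (top_of_set (standard_simplex 2)) X (w \<circ> (\<lambda>x::nat \<Rightarrow> real. x 0 *\<^sub>R a + x 1 *\<^sub>R b + x 2 *\<^sub>R c))"
    using w by (rule continuous_map_compose)
  then have "continuous_map (top_of_set (standard_simplex 2)) X \<sigma>"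
    by (rule continuous_map_eq) (simp add: \<sigma>_def)
  then have simplex: "singular_simplex 2 X \<sigma>" by (simp add: singular_simplex_euclidean \<sigma>_def)
  \<comment> \<open>Face \<open>k\<close> omits vertex \<open>k\<close>, so it starts at
    \<open>b\<close> only for \<open>k = 0\<close> and ends at \<open>b\<close> only for
    \<open>k = 2\<close>.\<close>
  have face: "singular_face 2 k \<sigma> = path_simplex (w \<circ> linepath (if k = 0 then b else a) (if k = 2 then b else c))"
    if k: "k \<le> 2" for k
  proof
    fix x
    show "singular_face 2 k \<sigma> x = path_simplex (w \<circ> linepath (if k = 0 then b else a) (if k = 2 then b else c)) x"
    proof (cases "x \<in> standard_simplex 1")
      case True
      then have "simplical_face k x \<in> standard_simplex 2"
        using simplical_face_in_standard_simplex[of 2 k x] k by (simp add: numeral_2_eq_2)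
      moreover have "x 2 = 0" using True by (auto simp: standard_simplex_def)
      moreover have "k = 0 \<or> k = 1 \<or> k = 2" using k by auto
      ultimately show ?thesis
        using True standard_simplex_1D(1)[OF True]
        by (auto simp: singular_face_def path_simplex_def simplical_face_def \<sigma>_def linepath_def numeral_2_eq_2)
    qed (auto simp: singular_face_def path_simplex_def)
  qed
  have "chain_boundary (Suc 1) (frag_of \<sigma>) =
    path_chain (w \<circ> linepath b c) - path_chain (w \<circ> linepath a c) + path_chain (w \<circ> linepath a b)"
    using face[of 0] face[of 1] face[of 2] by (simp add: chain_boundary_of numeral_2_eq_2)
  then show ?thesis
    unfolding homologous_rel_def singular_boundary
    by (intro exI[of _ "frag_of \<sigma>"]) (use simplex in \<open>simp add: singular_chain_of numeral_2_eq_2 algebra_simps\<close>)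
qed

text \<open>This is the degenerate triangle with the collinear vertices 0, 1/2, 1, mapped by the
  concatenated path.\<close>

lemma homologous_concat:
  assumes "pathin X p" "pathin X q" "p 1 = q 0"
  shows "homologous_rel 1 X {} (path_chain p + path_chain q) (path_chain (loop_concat p q))"
proof -
  let ?w = "loop_concat p q"
  have "continuous_map (top_of_set {0..1}) X ?w" using pathin_concat[OF assms] by (simp add: pathin_def)
  then have "homologous_rel 1 X {} (path_chain (?w \<circ> linepath 0 (1/2)) + path_chain (?w \<circ> linepath (1/2) 1))
     (path_chain (?w \<circ> linepath 0 1))"
    by (rule homologous_triangle[rotated]) auto
  moreover have "path_simplex (?w \<circ> linepath 0 (1/2)) = path_simplex p"
    by (rule path_simplex_eq) (auto simp: loop_concat_def linepath_def)
  moreover have "path_simplex (?w \<circ> linepath (1/2) 1) = path_simplex q"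
  proof (rule path_simplex_eq)
    fix t :: real assume t: "t \<in> {0..1}"
    have "(?w \<circ> linepath (1/2) 1) t = ?w (1/2 + t/2)" by (simp add: linepath_def field_simps)
    also have "\<dots> = q t"
      using assms(3) t by (cases "t = 0") (auto simp: loop_concat_def)
    finally show "(?w \<circ> linepath (1/2) 1) t = q t" .
  qed
  moreover have "path_simplex (?w \<circ> linepath 0 1) = path_simplex ?w"
    by (rule path_simplex_eq) (auto simp: linepath_def)
  ultimately show ?thesis by simp
qed

text \<open>A constant path equals its own concatenation, so twice its chain is homologous to its
  chain.\<close>

lemma homologous_const:
  assumes "y \<in> topspace X"
  shows "homologous_rel 1 X {} (path_chain (\<lambda>_. y)) 0"
proof -
  have "homologous_rel 1 X {} (path_chain (\<lambda>_. y) + path_chain (\<lambda>_. y)) (path_chain (loop_concat (\<lambda>_. y) (\<lambda>_. y)))"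
    using assms by (intro homologous_concat) auto
  moreover have "loop_concat (\<lambda>_. y) (\<lambda>_. y) = (\<lambda>_. y)" by (auto simp: loop_concat_def)
  ultimately show ?thesis by (simp add: homologous_rel_def)
qed

text \<open>The diagonal cuts the square of the homotopy into two triangles. The sides along which
  an end point stays fixed are constant paths and contribute nothing to homology.\<close>

lemma homologous_path_homotopic:
  assumes "path_homotopic X p q"
  shows "homologous_rel 1 X {} (path_chain p) (path_chain q)"
proof -
  let ?I = "top_of_set {0..1::real}"
  obtain H where H: "continuous_map (prod_topology ?I ?I) X H" "\<And>t. H (0, t) = p t" "\<And>t. H (1, t) = q t"
    "\<And>s. s \<in> {0..1} \<Longrightarrow> H (s, 0) = p 0 \<and> H (s, 1) = p 1"
    using assms unfolding path_homotopic_def homotopic_with_def by blast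
  have K: "convex ({0..1::real} \<times> {0..1::real})" by (intro convex_Times) auto
  have cont: "continuous_map (top_of_set ({0..1} \<times> {0..1})) X H"
    using H(1) by (simp only: prod_top_of_set)
  have 1: "homologous_rel 1 X {} (path_chain (H \<circ> linepath (0,0) (0,1)) + path_chain (H \<circ> linepath (0,1) (1,1)))
     (path_chain (H \<circ> linepath (0,0) (1,1)))"
    by (rule homologous_triangle[OF K cont]) auto
  have 2: "homologous_rel 1 X {} (path_chain (H \<circ> linepath (0,0) (1,0)) + path_chain (H \<circ> linepath (1,0) (1,1)))
     (path_chain (H \<circ> linepath (0,0) (1,1)))"
    by (rule homologous_triangle[OF K cont]) auto
  have "path_simplex (H \<circ> linepath (0,0) (0,1)) = path_simplex p"
    "path_simplex (H \<circ> linepath (1,0) (1,1)) = path_simplex q"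
    "path_simplex (H \<circ> linepath (0,1) (1,1)) = path_simplex (\<lambda>_. p 1)"
    "path_simplex (H \<circ> linepath (0,0) (1,0)) = path_simplex (\<lambda>_. p 0)"
    by (rule path_simplex_eq; use H in \<open>simp add: linepath_def\<close>)+
  note eqs = this
  have c: "homologous_rel 1 X {} (path_chain (\<lambda>_. p 0)) 0" "homologous_rel 1 X {} (path_chain (\<lambda>_. p 1)) 0"
    using path_homotopicD(1)[OF assms]
    by (auto intro: homologous_const path_start_in_topspace path_finish_in_topspace simp del: One_nat_def)
  show ?thesis
    using homologous_rel_diff[OF homologous_rel_diff[OF 1 2] homologous_rel_diff[OF c(2,1)]]
    unfolding eqs by (simp add: homologous_rel_def algebra_simps)
qed

lemma singular_relcycle_loop: "p \<in> loops X x \<Longrightarrow> singular_relcycle 1 X {} (path_chain p)"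
  unfolding singular_cycle chain_boundary_path_chain
  by (auto simp: loops_def intro: singular_chain_path_chain[unfolded One_nat_def] singular_chain_path_chain)

definition hurewicz :: "'a topology \<Rightarrow> (real \<Rightarrow> 'a) set \<Rightarrow> 'a chain set" where
  "hurewicz X a = (\<Union>p\<in>a. homologous_rel_set 1 X {} (path_chain p))"

lemma hurewicz_class:
  assumes p: "p \<in> loops X x"
  shows "hurewicz X (loop_class X x p) = homologous_rel_set 1 X {} (path_chain p)"
  unfolding hurewicz_def
proof (rule UN_eq_const[of p])
  show "p \<in> loop_class X x p" using p by (simp add: loop_class_eq loopsD)
  fix q assume "q \<in> loop_class X x p"
  then have "path_homotopic X p q" using p by (simp add: loop_class_eq)
  then show "homologous_rel_set 1 X {} (path_chain q) = homologous_rel_set 1 X {} (path_chain p)"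
    using homologous_path_homotopic by (simp add: homologous_rel_set_eq homologous_rel_sym)
qed

lemma mult_homology_class:
  assumes "singular_relcycle n X S a" "singular_relcycle n X S b"
  shows "homologous_rel_set n X S a \<otimes>\<^bsub>relative_homology_group (int n) X S\<^esub> homologous_rel_set n X S b
    = homologous_rel_set n X S (a + b)"
  using normal.rcos_sum[OF normal_subgroup_singular_relboundary_relcycle[of n X S], of a b] assms
  by (simp add: right_coset_singular_relboundary nontrivial_relative_homology_group)

lemma hurewicz_hom:
  assumes "x \<in> topspace X"
  shows "hurewicz X \<in> hom (fundamental_group X x) (homology_group 1 X)"
proof (rule homI)
  fix a b assume "a \<in> carrier (fundamental_group X x)" "b \<in> carrier (fundamental_group X x)"
  then obtain p q where p: "p \<in> loops X x" "a = loop_class X x p" and q: "q \<in> loops X x" "b = loop_class X x q"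
    by (auto simp: carrier_fundamental_group)
  show "hurewicz X a \<in> carrier (homology_group 1 X)"
    using p singular_relcycle_loop[OF p(1)] carrier_relative_homology_group[of 1 X "{}"]
    by (simp add: hurewicz_class)
  have "homologous_rel 1 X {} (path_chain p + path_chain q) (path_chain (loop_concat p q))"
    using p q by (intro homologous_concat) (auto simp: loops_def)
  then show "hurewicz X (a \<otimes>\<^bsub>fundamental_group X x\<^esub> b) = hurewicz X a \<otimes>\<^bsub>homology_group 1 X\<^esub> hurewicz X b"
    using p q mult_homology_class[OF singular_relcycle_loop[OF p(1)] singular_relcycle_loop[OF q(1)]]
    by (simp add: mult_fundamental_group hurewicz_class loops_concat homologous_rel_set_eq homologous_rel_sym)
qed

lemma chain_map_path_chain: "chain_map 1 f (path_chain p) = path_chain (f \<circ> p)"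
proof -
  have "simplex_map 1 f (path_simplex p) = path_simplex (f \<circ> p)"
    by (rule ext) (simp add: simplex_map_def path_simplex_def restrict_def)
  then show ?thesis by simp
qed

lemma hurewicz_natural:
  assumes f: "continuous_map X Y f" and y: "f x = y" and a: "a \<in> carrier (fundamental_group X x)"
  shows "hurewicz Y (fundamental_group_map Y y f a) = hom_induced 1 X {} Y {} f (hurewicz X a)"
proof -
  obtain p where p: "p \<in> loops X x" "a = loop_class X x p" using a by (auto simp: carrier_fundamental_group)
  have fp: "f \<circ> p \<in> loops Y y" using loops_comp[OF p(1) f] y by simp
  show ?thesis
    using hom_induced_chain_map[OF f _ singular_relcycle_loop[OF p(1)], of "{}"] p fp
    by (simp add: hurewicz_class fundamental_group_map_class[OF p(1) f y] chain_map_path_chain[unfolded One_nat_def] del: chain_map_of)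
qed

lemma homologous_path_inverse:
  assumes "pathin X p"
  shows "homologous_rel 1 X {} (path_chain (path_inverse p)) (- path_chain p)"
proof -
  have 1: "homologous_rel 1 X {} (path_chain p + path_chain (path_inverse p)) (path_chain (loop_concat p (path_inverse p)))"
    using assms by (intro homologous_concat) (auto simp: pathin_inverse)
  have 2: "homologous_rel 1 X {} (path_chain (loop_concat p (path_inverse p))) (path_chain (\<lambda>_. p 0))"
    using assms by (intro homologous_path_homotopic path_homotopic_rinv)
  have 3: "homologous_rel 1 X {} (path_chain (\<lambda>_. p 0)) 0"
    using assms by (intro homologous_const path_start_in_topspace)
  have "homologous_rel 1 X {} (path_chain p + path_chain (path_inverse p)) 0"
    by (rule homologous_rel_trans[OF homologous_rel_trans[OF 3 2] 1])
  then show ?thesis by (simp add: homologous_rel_def algebra_simps)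
qed

text \<open>Completing the edges of a \<open>1\<close>-chain to loops at \<open>x\<close> by chosen paths \<open>g y\<close> from \<open>x\<close> to \<open>y\<close>
  changes it by a combination of the \<open>g y\<close> that depends only on the boundary, and so leaves cycles
  unchanged up to homology.\<close>

lemma hurewicz_surj:
  assumes X: "path_connected_space X" and x: "x \<in> topspace X"
  shows "hurewicz X ` carrier (fundamental_group X x) = carrier (homology_group 1 X)"
proof
  interpret group "fundamental_group X x" by (rule group_fundamental_group[OF x])
  show "hurewicz X ` carrier (fundamental_group X x) \<subseteq> carrier (homology_group 1 X)"
    using hurewicz_hom[OF x] by (auto simp: hom_def)
  have "\<exists>g. pathin X g \<and> g 0 = x \<and> g 1 = y" if "y \<in> topspace X" for y
    using X x that by (auto simp: path_connected_space_def)
  then obtain g where g: "\<And>y. y \<in> topspace X \<Longrightarrow> pathin X (g y) \<and> g y 0 = x \<and> g y 1 = y" by metis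
  \<comment> \<open>The function \<open>\<lambda>j. if j = 0 then 1 else 0\<close> is the only point
    of the standard 0-simplex, so \<open>B\<close> replaces each point by the path chosen for
    it.\<close>
  define B where "B = frag_extend (\<lambda>f::(nat \<Rightarrow> real) \<Rightarrow> 'a. path_chain (g (f (\<lambda>j. if j = 0 then 1 else 0))))"
  have B_point: "B (point_chain y) = path_chain (g y)" for y
    by (simp add: B_def)
  let ?L = "\<lambda>c. \<exists>p\<in>loops X x. homologous_rel 1 X {} (path_chain p) (c - B (chain_boundary 1 c))"
  have L: "?L c" if "singular_chain 1 X c" for c
    using that unfolding singular_chain_def
  proof (induction rule: frag_induction)
    case zero
    show ?case using x homologous_const[OF x] loops_const[OF x] by (auto simp: B_def)
  next
    case (one f)
    then have "singular_simplex 1 X f" by simp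
    then obtain s where s: "pathin X s" "f = path_simplex s" by (rule singular_simplex_1_path)
    have s01: "s 0 \<in> topspace X" "s 1 \<in> topspace X"
      using s(1) path_start_in_topspace path_finish_in_topspace by blast+
    note g0 = g[OF s01(1)] and g1 = g[OF s01(2)]
    define p where "p = loop_concat (g (s 0)) (loop_concat s (path_inverse (g (s 1))))"
    have in2: "pathin X (loop_concat s (path_inverse (g (s 1))))"
      using s g1 by (intro pathin_concat) (auto simp: pathin_inverse)
    have "p \<in> loops X x"
      using g0 g1 in2 unfolding p_def loops_def by (auto intro!: pathin_concat)
    moreover have "homologous_rel 1 X {} (path_chain p) (path_chain (g (s 0)) + (path_chain s + - path_chain (g (s 1))))"
    proof -
      have 1: "homologous_rel 1 X {} (path_chain (g (s 0)) + path_chain (loop_concat s (path_inverse (g (s 1))))) (path_chain p)"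
        unfolding p_def using g0 in2 by (intro homologous_concat) auto
      have 2: "homologous_rel 1 X {} (path_chain s + path_chain (path_inverse (g (s 1)))) (path_chain (loop_concat s (path_inverse (g (s 1)))))"
        using s g1 by (intro homologous_concat) (auto simp: pathin_inverse)
      have 3: "homologous_rel 1 X {} (path_chain (path_inverse (g (s 1)))) (- path_chain (g (s 1)))"
        using g1 by (intro homologous_path_inverse) auto
      show ?thesis
        using singular_relboundary_diff[OF 3[unfolded homologous_rel_def]
            singular_relboundary_add[OF 1[unfolded homologous_rel_def] 2[unfolded homologous_rel_def]]]
        by (simp add: homologous_rel_def algebra_simps)
    qed
    moreover have "B (chain_boundary 1 (frag_of f)) = path_chain (g (s 1)) - path_chain (g (s 0))"
      unfolding s(2) chain_boundary_path_chain using B_point by (simp add: B_def frag_extend_diff)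
    then have "frag_of f - B (chain_boundary 1 (frag_of f)) = path_chain (g (s 0)) + (path_chain s + - path_chain (g (s 1)))"
      by (simp add: s(2) algebra_simps)
    ultimately show ?case by (intro bexI[of _ p]) simp_all
  next
    case (diff a b)
    then obtain p q where p: "p \<in> loops X x" "homologous_rel 1 X {} (path_chain p) (a - B (chain_boundary 1 a))"
      and q: "q \<in> loops X x" "homologous_rel 1 X {} (path_chain q) (b - B (chain_boundary 1 b))" by blast
    have q': "path_inverse q \<in> loops X x" by (rule loops_inverse[OF q(1)])
    have 1: "homologous_rel 1 X {} (path_chain p + path_chain (path_inverse q)) (path_chain (loop_concat p (path_inverse q)))"
      using p q' by (intro homologous_concat) (auto simp: loops_def)
    have 2: "homologous_rel 1 X {} (path_chain (path_inverse q)) (- path_chain q)"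
      using q by (intro homologous_path_inverse) (auto simp: loops_def)
    have pq1: "homologous_rel 1 X {} (path_chain (loop_concat p (path_inverse q))) (path_chain p + - path_chain q)"
      using singular_relboundary_diff[OF 2[unfolded homologous_rel_def] 1[unfolded homologous_rel_def]]
      by (simp add: homologous_rel_def algebra_simps)
    have pq2: "homologous_rel 1 X {} (path_chain p + - path_chain q)
        ((a - B (chain_boundary 1 a)) - (b - B (chain_boundary 1 b)))"
      using homologous_rel_diff[OF p(2) q(2)] by simp
    have pq3: "(a - B (chain_boundary 1 a)) - (b - B (chain_boundary 1 b)) = (a - b) - B (chain_boundary 1 (a - b))"
      by (simp add: B_def frag_extend_diff chain_boundary_diff algebra_simps)
    have "homologous_rel 1 X {} (path_chain (loop_concat p (path_inverse q))) ((a - b) - B (chain_boundary 1 (a - b)))"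
      using homologous_rel_trans[OF pq2 pq1] unfolding pq3 .
    then show ?case using loops_concat[OF p(1) q'] by (rule bexI)
  qed
  show "carrier (homology_group 1 X) \<subseteq> hurewicz X ` carrier (fundamental_group X x)"
  proof
    fix c assume "c \<in> carrier (homology_group 1 X)"
    then obtain z where z: "singular_relcycle 1 X {} z" "c = homologous_rel_set 1 X {} z"
      using carrier_relative_homology_group[of 1 X "{}"] by auto
    then have zc: "singular_chain 1 X z" "chain_boundary 1 z = 0" by (simp_all add: singular_cycle)
    obtain p where p: "p \<in> loops X x" "homologous_rel 1 X {} (path_chain p) z"
      using L[OF zc(1)] zc(2) by (auto simp: B_def)
    then have "c = hurewicz X (loop_class X x p)"
      by (simp add: hurewicz_class z homologous_rel_set_eq homologous_rel_sym)
    then show "c \<in> hurewicz X ` carrier (fundamental_group X x)" using loop_class_in_carrier[OF p(1)] by simp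
  qed
qed

section \<open>Integer matrices of size two and homomorphisms onto \<open>Z2_group\<close>\<close>

lemma Z2_vec_eq: "(v :: int ^ 2) = w \<longleftrightarrow> v $ 1 = w $ 1 \<and> v $ 2 = w $ 2"
  by (simp add: vec_eq_iff forall_2)

lemma matrix_vector_mult_2:
  "((A :: int ^ 2 ^ 2) *v v) $ i = A $ i $ 1 * v $ 1 + A $ i $ 2 * v $ 2"
  by (simp add: matrix_vector_mult_def sum_2)

lemma trace_2: "trace (A :: int ^ 2 ^ 2) = A $ 1 $ 1 + A $ 2 $ 2"
  by (simp add: trace_def sum_2)

lemma cayley_hamilton_2:
  fixes A :: "int ^ 2 ^ 2"
  shows "A *v (A *v v) - trace A *s (A *v v) + det A *s v = 0"
  by (simp add: Z2_vec_eq matrix_vector_mult_2 trace_2 det_2 algebra_simps)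

text \<open>Determinants multiply: the matrix with rows \<open>(a, b)\<close>, \<open>(c, d)\<close>
  has the matrix with columns \<open>(u, v)\<close>, \<open>(u', v')\<close> as a right inverse.
  This serves both for the determinant of \<open>A\<close> and for the independence of the images of
  two generators.\<close>

lemma det_mult_2:
  fixes a b c d u v u' v' :: int
  assumes "a * u + b * v = 1" "c * u + d * v = 0" "a * u' + b * v' = 0" "c * u' + d * v' = 1"
  shows "(a * d - b * c) * (u * v' - v * u') = 1"
proof -
  have "(a * d - b * c) * (u * v' - v * u')
      = (a * u + b * v) * (c * u' + d * v') - (a * u' + b * v') * (c * u + d * v)"
    by (simp add: algebra_simps)
  then show ?thesis using assms by simp
qed

lemma det_unit_of_surj:
  fixes A :: "int ^ 2 ^ 2"
  assumes "surj ((*v) A)"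
  shows "\<bar>det A\<bar> = 1"
proof -
  obtain u where u: "A *v u = axis 1 1" using assms by (metis surjD)
  obtain v where v: "A *v v = axis 2 1" using assms by (metis surjD)
  have "A $ 1 $ 1 * u $ 1 + A $ 1 $ 2 * u $ 2 = 1" "A $ 2 $ 1 * u $ 1 + A $ 2 $ 2 * u $ 2 = 0"
    "A $ 1 $ 1 * v $ 1 + A $ 1 $ 2 * v $ 2 = 0" "A $ 2 $ 1 * v $ 1 + A $ 2 $ 2 * v $ 2 = 1"
    using arg_cong[OF u, of "\<lambda>w. w $ 1"] arg_cong[OF u, of "\<lambda>w. w $ 2"]
      arg_cong[OF v, of "\<lambda>w. w $ 1"] arg_cong[OF v, of "\<lambda>w. w $ 2"]
    by (simp_all add: matrix_vector_mult_2 axis_def)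
  then have "det A * (u $ 1 * v $ 2 - u $ 2 * v $ 1) = 1"
    unfolding det_2 by (rule det_mult_2)
  then have "det A dvd 1" by (metis dvd_triv_left)
  then show ?thesis by simp
qed

lemma comm_group_Z2: "comm_group Z2_group"
  by (rule comm_groupI) (auto simp: Z2_group_def intro: exI[of _ "- _"])

lemma Z2_group_simps:
  "carrier Z2_group = UNIV" "x \<otimes>\<^bsub>Z2_group\<^esub> y = x + y" "\<one>\<^bsub>Z2_group\<^esub> = 0"
  by (simp_all add: Z2_group_def)

lemma Z2_inv: "inv\<^bsub>Z2_group\<^esub> x = - x"
proof -
  interpret comm_group Z2_group by (rule comm_group_Z2)
  show ?thesis by (rule inv_equality) (simp_all add: Z2_group_simps)
qed

lemma Z2_pow: "x [^]\<^bsub>Z2_group\<^esub> (n::int) = n *s x"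
proof -
  interpret comm_group Z2_group by (rule comm_group_Z2)
  have nat: "x [^]\<^bsub>Z2_group\<^esub> (k::nat) = int k *s x" for k
    by (induction k) (simp_all add: Z2_group_simps Z2_vec_eq algebra_simps)
  show ?thesis
    by (cases n) (simp_all only: int_pow_int int_pow_neg_int nat Z2_inv UNIV_I Z2_group_simps Z2_vec_eq
        vector_smult_component vector_uminus_component mult_minus_left simp_thms)
qed

text \<open>The images of \<open>a\<close> and \<open>b\<close> generate \<open>Z2_group\<close>, so
  their determinant \<open>D\<close> is not zero and they are linearly independent. In the normal
  form \<open>c a^i b^j\<close> of an element of the kernel both exponents are therefore 0.\<close>

lemma (in group) kernel_of_surjection_onto_Z2:
  assumes gen: "generate G {a, b} = carrier G" and ab: "a \<in> carrier G" "b \<in> carrier G"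
    and \<phi>: "\<phi> \<in> hom G Z2_group" and surj: "\<phi> ` carrier G = UNIV"
    and g: "g \<in> carrier G" "\<phi> g = 0"
  shows "g \<in> derived G (carrier G)"
proof -
  interpret Z: comm_group Z2_group by (rule comm_group_Z2)
  interpret \<phi>: group_hom G Z2_group \<phi> using \<phi> by (simp add: group_hom_def group_hom_axioms_def Z.is_group)
  have image: "\<exists>(i::int) (j::int). \<phi> x = i *s \<phi> a + j *s \<phi> b" if x: "x \<in> carrier G" for x
  proof -
    obtain i j :: int where "\<phi> x = \<phi> a [^]\<^bsub>Z2_group\<^esub> i \<otimes>\<^bsub>Z2_group\<^esub> \<phi> b [^]\<^bsub>Z2_group\<^esub> j"
      by (rule two_generated_hom_image[OF gen ab comm_group_Z2 \<phi> x])
    then show ?thesis unfolding Z2_group_simps Z2_pow by blast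
  qed
  define D where "D = \<phi> a $ 1 * \<phi> b $ 2 - \<phi> a $ 2 * \<phi> b $ 1"
  have "D \<noteq> 0"
  proof -
    obtain x y where "x \<in> carrier G" "\<phi> x = axis 1 1" "y \<in> carrier G" "\<phi> y = axis 2 1" using surj by (metis UNIV_I imageE)
    then obtain i j k l where "axis 1 1 = i *s \<phi> a + j *s \<phi> b" and "axis 2 1 = k *s \<phi> a + l *s \<phi> b" using image by metis
    then have "\<phi> a $ 1 * i + \<phi> b $ 1 * j = 1" "\<phi> a $ 2 * i + \<phi> b $ 2 * j = 0"
        "\<phi> a $ 1 * k + \<phi> b $ 1 * l = 0" "\<phi> a $ 2 * k + \<phi> b $ 2 * l = 1"
      by (simp_all add: Z2_vec_eq axis_def mult.commute)
    from det_mult_2[OF this] have "D * (i * l - j * k) = 1" by (simp add: D_def algebra_simps)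
    then show ?thesis by auto
  qed
  obtain c and i j :: int where c: "c \<in> derived G (carrier G)" "g = c \<otimes> (a [^] i \<otimes> b [^] j)"
    by (rule two_generated_normal_form[OF gen ab g(1)])
  have cG: "c \<in> carrier G" using c(1) derived_in_carrier by blast
  have "\<phi> ` carrier G \<subseteq> carrier Z2_group" by (simp add: Z2_group_simps)
  have "\<phi> c = 0"
  proof -
    have "\<phi> c \<in> derived Z2_group (\<phi> ` carrier G)"
      using \<phi>.derived_img[OF order_refl] c(1) by blast
    also have "derived Z2_group (\<phi> ` carrier G) = {\<one>\<^bsub>Z2_group\<^esub>}"
      by (rule Z.derived_eq_singleton) (simp add: Z2_group_simps)
    finally show ?thesis by (simp add: Z2_group_simps)
  qed
  then have "i *s \<phi> a + j *s \<phi> b = 0"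
    using g(2) c(2) cG ab by (simp add: \<phi>.hom_int_pow Z2_group_simps Z2_pow)
  then have "i * \<phi> a $ 1 + j * \<phi> b $ 1 = 0" "i * \<phi> a $ 2 + j * \<phi> b $ 2 = 0"
    by (simp_all add: Z2_vec_eq)
  \<comment> \<open>Cramer's rule: eliminating one unknown at a time leaves \<open>i * D = 0\<close>
    and \<open>j * D = 0\<close>.\<close>
  then have "(i * \<phi> a $ 1 + j * \<phi> b $ 1) * \<phi> b $ 2 - (i * \<phi> a $ 2 + j * \<phi> b $ 2) * \<phi> b $ 1 = 0"
    "(i * \<phi> a $ 2 + j * \<phi> b $ 2) * \<phi> a $ 1 - (i * \<phi> a $ 1 + j * \<phi> b $ 1) * \<phi> a $ 2 = 0" by simp_all
  then have "i * D = 0" "j * D = 0" unfolding D_def by (simp_all add: algebra_simps)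
  then have "i = 0" "j = 0" using \<open>D \<noteq> 0\<close> by auto
  then have "g = c" using c(2) cG by simp
  then show ?thesis using c(1) by simp
qed

text \<open>The composite \<open>\<psi>\<close> of the Hurewicz map with \<open>\<phi>\<close>
  carries \<open>\<alpha>\<close> to multiplication by \<open>A\<close>. It sends the product in
  question to the left side of the Cayley-Hamilton equation, so the product lies in the kernel of
  \<open>\<psi>\<close>, which is contained in the derived subgroup. The determinant is a unit
  because \<open>A\<close> inherits surjectivity from the isomorphism that \<open>h\<close> induces
  on homology.\<close>

lemma fundamental_group_characteristic_polynomial:
  fixes A :: "int ^ 2 ^ 2"
  assumes X: "path_connected_space X" "x \<in> topspace X"
    and gen: "generate (fundamental_group X x) {a, b} = carrier (fundamental_group X x)"
      "a \<in> carrier (fundamental_group X x)" "b \<in> carrier (fundamental_group X x)"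
    and h: "homeomorphic_map X X h" "h x = x"
    and \<phi>: "\<phi> \<in> iso (homology_group 1 X) Z2_group"
    and A: "\<forall>c\<in>carrier (homology_group 1 X). \<phi> (hom_induced 1 X {} X {} h c) = A *v \<phi> c"
  defines "G \<equiv> fundamental_group X x" and "\<alpha> \<equiv> fundamental_group_map X x h"
  shows "\<bar>det A\<bar> = 1"
    and "carrier G \<noteq> {\<one>\<^bsub>G\<^esub>}"
    and "\<And>g. g \<in> carrier G \<Longrightarrow>
      \<alpha> (\<alpha> g) \<otimes>\<^bsub>G\<^esub> inv\<^bsub>G\<^esub> (\<alpha> g [^]\<^bsub>G\<^esub> trace A) \<otimes>\<^bsub>G\<^esub> g [^]\<^bsub>G\<^esub> det A \<in> derived G (carrier G)"
proof -
  interpret G: group G unfolding G_def by (rule group_fundamental_group[OF X(2)])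
  interpret Z: comm_group Z2_group by (rule comm_group_Z2)
  have conth: "continuous_map X X h" using h homeomorphic_imp_continuous_map by blast
  have \<phi>hom: "\<phi> \<in> hom (homology_group 1 X) Z2_group" and \<phi>im: "\<phi> ` carrier (homology_group 1 X) = UNIV"
    using \<phi> by (auto simp: iso_def bij_betw_def Z2_group_simps)
  have "hom_induced 1 X {} X {} h ` carrier (homology_group 1 X) = carrier (homology_group 1 X)"
    using homeomorphic_map_homology_iso[OF h(1), of 1] by (simp add: iso_def bij_betw_def)
  then have "\<phi> ` carrier (homology_group 1 X) = (\<lambda>c. A *v \<phi> c) ` carrier (homology_group 1 X)"
    using A image_image[of \<phi> "hom_induced 1 X {} X {} h" "carrier (homology_group 1 X)"] by (simp cong: image_cong)
  also have "\<dots> = range ((*v) A)" unfolding \<phi>im[symmetric] by (simp only: image_image)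
  finally have "surj ((*v) A)" using \<phi>im by simp
  then show "\<bar>det A\<bar> = 1" by (rule det_unit_of_surj)
  define \<psi> where "\<psi> = \<phi> \<circ> hurewicz X"
  have \<psi>hom: "\<psi> \<in> hom G Z2_group"
    unfolding \<psi>_def G_def using hurewicz_hom[OF X(2)] \<phi>hom by (rule hom_compose)
  have \<psi>im: "\<psi> ` carrier G = UNIV"
    using hurewicz_surj[OF X] \<phi>im unfolding \<psi>_def G_def by (metis image_comp)
  interpret \<psi>: group_hom G Z2_group \<psi> using \<psi>hom by (simp add: group_hom_def group_hom_axioms_def Z.is_group)
  show "carrier G \<noteq> {\<one>\<^bsub>G\<^esub>}"
  proof
    assume "carrier G = {\<one>\<^bsub>G\<^esub>}"
    then have "UNIV = {\<psi> \<one>\<^bsub>G\<^esub>}" using \<psi>im by auto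
    then have "axis 1 1 = (0 :: int ^ 2)" by (metis UNIV_I singletonD)
    then show False by (simp add: Z2_vec_eq axis_def)
  qed
  fix g assume g: "g \<in> carrier G"
  have \<alpha>: "\<alpha> y \<in> carrier G" "\<psi> (\<alpha> y) = A *v \<psi> y" if y: "y \<in> carrier G" for y
  proof -
    show "\<alpha> y \<in> carrier G"
      using fundamental_group_map_hom[OF conth h(2)] y by (auto simp: \<alpha>_def G_def hom_def)
    have "hurewicz X y \<in> carrier (homology_group 1 X)"
      using hurewicz_hom[OF X(2)] y by (auto simp: G_def hom_def)
    then show "\<psi> (\<alpha> y) = A *v \<psi> y"
      using hurewicz_natural[OF conth h(2), of y] y A by (simp add: \<psi>_def \<alpha>_def G_def)
  qed
  show "\<alpha> (\<alpha> g) \<otimes>\<^bsub>G\<^esub> inv\<^bsub>G\<^esub> (\<alpha> g [^]\<^bsub>G\<^esub> trace A) \<otimes>\<^bsub>G\<^esub> g [^]\<^bsub>G\<^esub> det A \<in> derived G (carrier G)"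
  proof (rule G.kernel_of_surjection_onto_Z2[OF gen[folded G_def] \<psi>hom \<psi>im])
    show "\<alpha> (\<alpha> g) \<otimes>\<^bsub>G\<^esub> inv\<^bsub>G\<^esub> (\<alpha> g [^]\<^bsub>G\<^esub> trace A) \<otimes>\<^bsub>G\<^esub> g [^]\<^bsub>G\<^esub> det A \<in> carrier G"
      using g \<alpha>(1) by simp
    show "\<psi> (\<alpha> (\<alpha> g) \<otimes>\<^bsub>G\<^esub> inv\<^bsub>G\<^esub> (\<alpha> g [^]\<^bsub>G\<^esub> trace A) \<otimes>\<^bsub>G\<^esub> g [^]\<^bsub>G\<^esub> det A) = 0"
      using g \<alpha> cayley_hamilton_2[of A "\<psi> g"]
      by (simp add: \<psi>.hom_int_pow Z2_group_simps Z2_inv Z2_pow)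
  qed
qed

section \<open>Generators of the fundamental group of the punctured torus\<close>

lemma path_homotopic_concat_left:
  "\<lbrakk>pathin X p; path_homotopic X q q'; p 1 = q 0\<rbrakk> \<Longrightarrow> path_homotopic X (loop_concat p q) (loop_concat p q')"
  by (simp add: path_homotopic_concat)

lemma path_homotopic_concat_right:
  "\<lbrakk>pathin X q; path_homotopic X p p'; p 1 = q 0\<rbrakk> \<Longrightarrow> path_homotopic X (loop_concat p q) (loop_concat p' q)"
  by (simp add: path_homotopic_concat)

lemma path_homotopic_rinv_cancel:
  assumes "pathin X p" "pathin X q" "p 0 = q 0"
  shows "path_homotopic X (loop_concat p (loop_concat (path_inverse p) q)) q"
proof -
  have "path_homotopic X (loop_concat p (loop_concat (path_inverse p) q)) (loop_concat (loop_concat p (path_inverse p)) q)"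
    using assms by (intro path_homotopic_sym[OF path_homotopic_assoc] pathin_inverse) auto
  also have "path_homotopic X \<dots> (loop_concat (\<lambda>_. p 0) q)"
    using assms by (intro path_homotopic_concat_right path_homotopic_rinv) auto
  also have "path_homotopic X \<dots> q"
    using path_homotopic_lid[OF assms(2)] assms(3) by simp
  finally show ?thesis .
qed

lemma path_homotopic_linv_cancel:
  assumes "pathin X p" "pathin X q" "p 1 = q 0"
  shows "path_homotopic X (loop_concat (path_inverse p) (loop_concat p q)) q"
proof -
  have "path_inverse (path_inverse p) = p" by (simp add: path_inverse_def)
  then show ?thesis
    using path_homotopic_rinv_cancel[of X "path_inverse p" q] assms by (simp add: pathin_inverse)
qed

text \<open>For \<open>x\<close> in \<open>W\<close> this is the image of the fundamental group of
  the subspace \<open>W\<close>, expressed without passing to that subspace.\<close>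

definition loop_classes_in :: "'a topology \<Rightarrow> 'a \<Rightarrow> 'a set \<Rightarrow> (real \<Rightarrow> 'a) set set" where
  "loop_classes_in X x W = loop_class X x ` {q \<in> loops X x. q ` {0..1} \<subseteq> W}"

text \<open>The part of van Kampen's theorem that concerns generators. In the proof,
  \<open>P t\<close> says that the initial piece of \<open>p\<close> up to \<open>t\<close>, closed
  by any path in \<open>U\<close> or in \<open>V\<close> from \<open>p t\<close> back to
  \<open>x\<close>, represents an element of the generated subgroup. At 0 only the closing path
  remains, and at 1 a constant closing path gives the class of \<open>p\<close>.\<close>

lemma generate_loop_classes_union:
  assumes U: "openin X U" and V: "openin X V" and UV: "topspace X = U \<union> V"
    and x: "x \<in> U \<inter> V" and pc: "path_connectedin X (U \<inter> V)"
  shows "generate (fundamental_group X x) (loop_classes_in X x U \<union> loop_classes_in X x V)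
    = carrier (fundamental_group X x)"
proof
  let ?G = "fundamental_group X x"
  let ?S = "loop_classes_in X x U \<union> loop_classes_in X x V"
  have xX: "x \<in> topspace X" using x UV by auto
  interpret G: group ?G by (rule group_fundamental_group[OF xX])
  show "generate ?G ?S \<subseteq> carrier ?G"
    by (rule G.generate_incl) (auto simp: loop_classes_in_def loop_class_in_carrier)
  show "carrier ?G \<subseteq> generate ?G ?S"
  proof
    fix c assume "c \<in> carrier ?G"
    then obtain p where p: "p \<in> loops X x" "c = loop_class X x p" by (auto simp: carrier_fundamental_group)
    note pp = loopsD(1)[OF p(1)] and p01 = loopsD(2,3)[OF p(1)]
    define sub where "sub s t = p \<circ> linepath s t" for s t
    have sub_ends [simp]: "sub s t 0 = p s" "sub s t 1 = p t" for s t
      by (simp_all add: sub_def linepath_0' linepath_1')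
    have seg01: "closed_segment s t \<subseteq> {0..1}" if "s \<in> {0..1}" "t \<in> {0..1}" for s t :: real
      using that by (simp add: closed_segment_subset)
    have lp01: "linepath s t \<in> {0..1} \<rightarrow> {0..1}" if "s \<in> {0..1}" "t \<in> {0..1}" for s t :: real
      using seg01[OF that] linepath_in_path by blast
    have sub_path: "pathin X (sub s t)" if "s \<in> {0..1}" "t \<in> {0..1}" for s t
      using path_homotopic_reparametrize[OF pp continuous_on_linepath lp01[OF that] continuous_on_linepath lp01[OF that]]
      by (simp add: sub_def)
    have sub_concat: "path_homotopic X (loop_concat (sub 0 s) (sub s t)) (sub 0 t)"
      if "s \<in> {0..1}" "t \<in> {0..1}" for s t
      unfolding sub_def comp_loop_concat[symmetric]
    proof (rule path_homotopic_reparametrize[OF pp])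
      show "loop_concat (linepath 0 s) (linepath s t) \<in> {0..1} \<rightarrow> {0..1}"
        using lp01[of 0 s] lp01[OF that] that by (auto simp: loop_concat_def Pi_iff)
      show "continuous_on {0..1} (loop_concat (linepath 0 s) (linepath s t))"
        by (intro continuous_on_loop_concat continuous_on_linepath) (simp add: linepath_0' linepath_1')
      show "linepath 0 t \<in> {0..1} \<rightarrow> {0..1}" using lp01[of 0 t] that by simp
    qed (simp_all only: loop_concat_ends linepath_0' linepath_1' continuous_on_linepath)
    \<comment> \<open>\<open>P\<close> is locally constant, which replaces a subdivision of \<open>p\<close> into pieces inside \<open>U\<close> or \<open>V\<close>.\<close>
    define P where "P t \<longleftrightarrow> (\<forall>W\<in>{U, V}. \<forall>d. pathin X d \<and> d ` {0..1} \<subseteq> W \<and> d 0 = p t \<and> d 1 = x \<longrightarrow>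
      loop_class X x (loop_concat (sub 0 t) d) \<in> generate ?G ?S)" for t
    have loop: "loop_concat (sub 0 t) d \<in> loops X x" if "t \<in> {0..1}" "pathin X d" "d 0 = p t" "d 1 = x" for t d
      using sub_path[of 0 t] that p01 by (auto simp: loops_def intro!: pathin_concat)
    \<comment> \<open>If the closing path stays in the same set as the piece of \<open>p\<close>
      between \<open>s\<close> and \<open>t\<close>, this piece can be counted as part of a closing
      path at \<open>s\<close>.\<close>
    have step1: "loop_class X x (loop_concat (sub 0 t) d) \<in> generate ?G ?S"
      if P: "P s" and st: "s \<in> {0..1}" "t \<in> {0..1}" and W: "W \<in> {U, V}" "p ` closed_segment s t \<subseteq> W"
        and d: "pathin X d" "d ` {0..1} \<subseteq> W" "d 0 = p t" "d 1 = x" for s t W d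
    proof -
      let ?d = "loop_concat (sub s t) d"
      have d': "pathin X ?d" using sub_path[OF st] d by (intro pathin_concat) auto
      have "?d ` {0..1} \<subseteq> W"
        using W(2) d(2) linepath_in_path[of _ s t] by (auto simp: loop_concat_def sub_def image_subset_iff)
      then have "loop_class X x (loop_concat (sub 0 s) ?d) \<in> generate ?G ?S"
        using P W(1) d d' unfolding P_def by auto
      moreover have "path_homotopic X (loop_concat (sub 0 s) ?d) (loop_concat (sub 0 t) d)"
      proof (rule path_homotopic_trans)
        show "path_homotopic X (loop_concat (sub 0 s) ?d) (loop_concat (loop_concat (sub 0 s) (sub s t)) d)"
          using sub_path[of 0 s] sub_path[OF st] st d by (intro path_homotopic_sym[OF path_homotopic_assoc]) auto
        show "path_homotopic X (loop_concat (loop_concat (sub 0 s) (sub s t)) d) (loop_concat (sub 0 t) d)"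
          using sub_concat[OF st] d by (intro path_homotopic_concat_right) auto
      qed
      ultimately show ?thesis
        using loop_class_eq_iff[OF loop[OF st(1) d'] loop[OF st(2) d(1)]] d by simp
    qed
    have step: "P t" if P: "P s" and st: "s \<in> {0..1}" "t \<in> {0..1}" and W: "W \<in> {U, V}" "p ` closed_segment s t \<subseteq> W"
      for s t W
      unfolding P_def
    proof (intro ballI allI impI, elim conjE)
      fix W' d assume W': "W' \<in> {U, V}" and d: "pathin X d" "d ` {0..1} \<subseteq> W'" "d 0 = p t" "d 1 = x"
      show "loop_class X x (loop_concat (sub 0 t) d) \<in> generate ?G ?S"
      proof (cases "W' = W")
        case True
        then show ?thesis using step1[OF P st W] d by simp
      next
        case False
        \<comment> \<open>Here \<open>d\<close> lies in the other set. A path \<open>e\<close> in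
          the intersection splits the loop into the one closed by \<open>e\<close>, treated in
          \<open>step1\<close>, and the inverse of \<open>e\<close> followed by \<open>d\<close>,
          which lies in \<open>W'\<close> and represents a generator.\<close>
        have "p t \<in> W" using W(2) by auto
        moreover have "p t \<in> W'" using d by (metis atLeastAtMost_iff image_subset_iff order_refl zero_le_one)
        ultimately have "p t \<in> U \<inter> V" using W(1) W' False by auto
        then obtain e where e: "pathin (subtopology X (U \<inter> V)) e" "e 0 = p t" "e 1 = x"
          using pc x unfolding path_connectedin_def path_connected_space_def by (metis IntI UV Un_iff topspace_subtopology Int_iff)
        have eX: "pathin X e" and "e ` {0..1} \<subseteq> U \<inter> V"
          using e(1) by (auto simp: pathin_subtopology image_subset_iff Pi_iff)
        then have eW: "e ` {0..1} \<subseteq> W" "e ` {0..1} \<subseteq> W'" using W(1) W' by auto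
        let ?f = "loop_concat (path_inverse e) d"
        have f: "?f \<in> loops X x"
          using eX e d by (auto simp: loops_def pathin_inverse intro!: pathin_concat)
        have "?f ` {0..1} \<subseteq> W'"
          using eW(2) d(2) by (auto simp: loop_concat_def path_inverse_def image_subset_iff)
        then have "loop_class X x ?f \<in> ?S" using f W' by (auto simp: loop_classes_in_def)
        then have "loop_class X x (loop_concat (sub 0 t) e) \<otimes>\<^bsub>?G\<^esub> loop_class X x ?f \<in> generate ?G ?S"
          using step1[OF P st W eX eW(1) e(2,3)] by (intro generate.eng) (auto intro: generate.incl)
        moreover have "path_homotopic X (loop_concat (loop_concat (sub 0 t) e) ?f) (loop_concat (sub 0 t) d)"
        proof -
          have t0: "pathin X (sub 0 t)" using sub_path[of 0 t] st by simp
          have "path_homotopic X (loop_concat (loop_concat (sub 0 t) e) ?f) (loop_concat (sub 0 t) (loop_concat e ?f))"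
            using t0 eX e d f by (intro path_homotopic_assoc) (auto simp: loops_def)
          also have "path_homotopic X \<dots> (loop_concat (sub 0 t) d)"
            using t0 eX e d by (intro path_homotopic_concat_left path_homotopic_rinv_cancel) auto
          finally show ?thesis .
        qed
        moreover note tE = loop[OF st(2) eX e(2,3)] and tD = loop[OF st(2) d(1,3,4)]
        ultimately show ?thesis
          using mult_fundamental_group[OF tE f] loop_class_eq_iff[OF loops_concat[OF tE f] tD] by simp
      qed
    qed
    have "P 0 \<longleftrightarrow> P 1"
    proof (rule connected_equivalence_relation[of "{0..1::real}" 0 1 "\<lambda>s t. P s \<longleftrightarrow> P t"])
      fix s :: real assume s: "s \<in> {0..1}"
      have "p s \<in> topspace X" using pp s unfolding pathin_def continuous_map_def by auto
      then obtain W where W: "W \<in> {U, V}" "p s \<in> W" "openin X W" using UV U V by auto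
      have "openin (top_of_set {0..1}) {r \<in> {0..1}. p r \<in> W}"
        using pp W(3) unfolding pathin_def continuous_map_def by auto
      then obtain T where T: "open T" "{r \<in> {0..1}. p r \<in> W} = {0..1} \<inter> T" by (auto simp: openin_open)
      have "s \<in> T" using T(2) s W(2) by blast
      then obtain e where e: "e > 0" "ball s e \<subseteq> T" using T(1) open_contains_ball by blast
      have seg: "p ` closed_segment r s \<subseteq> W" "p ` closed_segment s r \<subseteq> W" if r: "r \<in> {0..1} \<inter> ball s e" for r
      proof -
        have "closed_segment s r \<subseteq> {0..1} \<inter> ball s e"
          using r s e(1) by (intro closed_segment_subset convex_Int) auto
        then show "p ` closed_segment s r \<subseteq> W" using e(2) T(2) by blast
        then show "p ` closed_segment r s \<subseteq> W" by (simp add: closed_segment_commute)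
      qed
      show "\<exists>T. openin (top_of_set {0..1}) T \<and> s \<in> T \<and> (\<forall>r\<in>T. P s \<longleftrightarrow> P r)"
      proof (intro exI conjI ballI)
        show "openin (top_of_set {0..1}) ({0..1} \<inter> ball s e)" by (simp add: openin_open_Int)
        show "s \<in> {0..1} \<inter> ball s e" using s e by simp
        fix r assume r: "r \<in> {0..1} \<inter> ball s e"
        then show "P s \<longleftrightarrow> P r" using step[OF _ s _ W(1) seg(2)[OF r]] step[OF _ _ s W(1) seg(1)[OF r]] by auto
      qed
    qed auto
    moreover have "P 0"
      unfolding P_def
    proof (intro ballI allI impI, elim conjE)
      fix W d assume W: "W \<in> {U, V}" and d: "pathin X d" "d ` {0..1} \<subseteq> W" "d 0 = p 0" "d 1 = x"
      have dl: "d \<in> loops X x" using d p01 by (auto simp: loops_def)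
      have "sub 0 0 = (\<lambda>_. x)" using p01 by (auto simp: sub_def linepath_def)
      then have "path_homotopic X (loop_concat (sub 0 0) d) d"
        using path_homotopic_lid[OF d(1)] d p01 by simp
      then have "loop_class X x (loop_concat (sub 0 0) d) = loop_class X x d"
        using loop_class_eq_iff[OF loop[of 0 d] dl] d by simp
      moreover have "loop_class X x d \<in> ?S" using dl d W by (auto simp: loop_classes_in_def)
      ultimately show "loop_class X x (loop_concat (sub 0 0) d) \<in> generate ?G ?S"
        by (auto intro: generate.incl)
    qed
    ultimately have "P 1" by simp
    then have "loop_class X x (loop_concat (sub 0 1) (\<lambda>_. x)) \<in> generate ?G ?S"
      using x xX p01 unfolding P_def by (elim ballE[of _ _ U] allE[of _ "\<lambda>_. x"] impE) auto
    moreover have "path_homotopic X (loop_concat (sub 0 1) (\<lambda>_. x)) p"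
    proof -
      have "sub 0 1 = p" by (auto simp: sub_def linepath_def)
      then show ?thesis using path_homotopic_rid[OF pp] p01 by simp
    qed
    moreover have "loop_concat (sub 0 1) (\<lambda>_. x) \<in> loops X x"
      by (rule loop) (use p01 xX in simp_all)
    ultimately show "c \<in> generate ?G ?S"
      unfolding p(2) using loop_class_eq_iff[OF _ p(1)] by metis
  qed
qed

section \<open>Change of base point\<close>

definition change_base :: "'a topology \<Rightarrow> (real \<Rightarrow> 'a) \<Rightarrow> (real \<Rightarrow> 'a) set \<Rightarrow> (real \<Rightarrow> 'a) set" where
  "change_base X d a = (\<Union>p\<in>a. loop_class X (d 0) (loop_concat d (loop_concat p (path_inverse d))))"

lemma
  assumes d: "pathin X d" and p: "p \<in> loops X (d 1)"
  shows loops_change_base: "loop_concat d (loop_concat p (path_inverse d)) \<in> loops X (d 0)"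
    and change_base_class: "change_base X d (loop_class X (d 1) p) = loop_class X (d 0) (loop_concat d (loop_concat p (path_inverse d)))"
proof -
  have in1: "loop_concat d (loop_concat q (path_inverse d)) \<in> loops X (d 0)" if "q \<in> loops X (d 1)" for q
    using that d by (auto simp: loops_def pathin_inverse intro!: pathin_concat)
  then show "loop_concat d (loop_concat p (path_inverse d)) \<in> loops X (d 0)" using p .
  show "change_base X d (loop_class X (d 1) p) = loop_class X (d 0) (loop_concat d (loop_concat p (path_inverse d)))"
    unfolding change_base_def
  proof (rule UN_eq_const[of p])
    show "p \<in> loop_class X (d 1) p" using p by (simp add: loop_class_eq loopsD)
    fix q assume "q \<in> loop_class X (d 1) p"
    then have pq: "path_homotopic X p q" using p by (simp add: loop_class_eq)
    have q: "q \<in> loops X (d 1)" by (rule loops_homotopic[OF p pq])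
    have "path_homotopic X (loop_concat d (loop_concat q (path_inverse d))) (loop_concat d (loop_concat p (path_inverse d)))"
      using path_homotopic_sym[OF pq] d loopsD[OF q] by (intro path_homotopic_concat) (auto simp: pathin_inverse)
    then show "loop_class X (d 0) (loop_concat d (loop_concat q (path_inverse d))) = loop_class X (d 0) (loop_concat d (loop_concat p (path_inverse d)))"
      by (simp add: loop_class_eq_iff in1 p q)
  qed
qed

lemma change_base_hom:
  assumes d: "pathin X d"
  shows "change_base X d \<in> hom (fundamental_group X (d 1)) (fundamental_group X (d 0))"
proof (rule homI)
  fix a b assume "a \<in> carrier (fundamental_group X (d 1))" "b \<in> carrier (fundamental_group X (d 1))"
  then obtain p q where p: "p \<in> loops X (d 1)" "a = loop_class X (d 1) p" and q: "q \<in> loops X (d 1)" "b = loop_class X (d 1) q"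
    by (auto simp: carrier_fundamental_group)
  note pp = loopsD[OF p(1)] and qq = loopsD[OF q(1)]
  show "change_base X d a \<in> carrier (fundamental_group X (d 0))"
    by (simp add: p change_base_class d loop_class_in_carrier loops_change_base)
  let ?i = "path_inverse d"
  have i: "pathin X ?i" using d pathin_inverse by blast
  have pi: "pathin X (loop_concat p ?i)" and qi: "pathin X (loop_concat q ?i)"
    using pp qq i by (auto intro!: pathin_concat)
  have "path_homotopic X (loop_concat (loop_concat d (loop_concat p ?i)) (loop_concat d (loop_concat q ?i)))
      (loop_concat d (loop_concat (loop_concat p ?i) (loop_concat d (loop_concat q ?i))))"
    using d i pi qi qq pp by (intro path_homotopic_assoc) (auto intro!: pathin_concat)
  also have "path_homotopic X \<dots> (loop_concat d (loop_concat (loop_concat p q) ?i))"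
  proof (rule path_homotopic_concat_left[OF d])
    have "path_homotopic X (loop_concat (loop_concat p ?i) (loop_concat d (loop_concat q ?i)))
        (loop_concat p (loop_concat ?i (loop_concat d (loop_concat q ?i))))"
      using d i qi qq pp by (intro path_homotopic_assoc) (auto intro!: pathin_concat)
    also have "path_homotopic X \<dots> (loop_concat p (loop_concat q ?i))"
      using d qi qq pp by (intro path_homotopic_concat_left path_homotopic_linv_cancel) auto
    also have "path_homotopic X \<dots> (loop_concat (loop_concat p q) ?i)"
      using i qq pp by (intro path_homotopic_sym[OF path_homotopic_assoc]) auto
    finally show "path_homotopic X (loop_concat (loop_concat p ?i) (loop_concat d (loop_concat q ?i)))
      (loop_concat (loop_concat p q) ?i)" .
  qed (use pp in simp)
  finally show "change_base X d (a \<otimes>\<^bsub>fundamental_group X (d 1)\<^esub> b) = change_base X d a \<otimes>\<^bsub>fundamental_group X (d 0)\<^esub> change_base X d b"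
    by (simp add: p q change_base_class d mult_fundamental_group loops_change_base loops_concat loop_class_eq_iff path_homotopic_sym)
qed

lemma change_base_surj:
  assumes d: "pathin X d"
  shows "change_base X d ` carrier (fundamental_group X (d 1)) = carrier (fundamental_group X (d 0))"
proof
  show "change_base X d ` carrier (fundamental_group X (d 1)) \<subseteq> carrier (fundamental_group X (d 0))"
    using change_base_hom[OF d] by (auto simp: hom_def)
  show "carrier (fundamental_group X (d 0)) \<subseteq> change_base X d ` carrier (fundamental_group X (d 1))"
  proof
    fix c assume "c \<in> carrier (fundamental_group X (d 0))"
    then obtain p where p: "p \<in> loops X (d 0)" "c = loop_class X (d 0) p" by (auto simp: carrier_fundamental_group)
    note pp = loopsD[OF p(1)]
    let ?i = "path_inverse d"
    have i: "pathin X ?i" using d pathin_inverse by blast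
    let ?q = "loop_concat ?i (loop_concat p d)"
    have q: "?q \<in> loops X (d 1)" using d i pp by (auto simp: loops_def intro!: pathin_concat)
    have pd: "pathin X (loop_concat p d)" using d pp by (auto intro!: pathin_concat)
    have "path_homotopic X (loop_concat d (loop_concat ?q ?i)) (loop_concat (loop_concat d ?q) ?i)"
      using d i pd pp by (intro path_homotopic_sym[OF path_homotopic_assoc]) (auto intro!: pathin_concat)
    also have "path_homotopic X \<dots> (loop_concat (loop_concat p d) ?i)"
      using d i pd pp by (intro path_homotopic_concat_right path_homotopic_rinv_cancel) auto
    also have "path_homotopic X \<dots> (loop_concat p (loop_concat d ?i))"
      using d i pp by (intro path_homotopic_assoc) auto
    also have "path_homotopic X \<dots> (loop_concat p (\<lambda>_. d 0))"
      using d pp by (intro path_homotopic_concat_left path_homotopic_rinv) auto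
    also have "path_homotopic X \<dots> p"
      using path_homotopic_rid[of X p] pp by simp
    finally have "loop_class X (d 0) p = change_base X d (loop_class X (d 1) ?q)"
      using p by (simp add: change_base_class d q loop_class_eq_iff loops_change_base path_homotopic_sym)
    then show "c \<in> change_base X d ` carrier (fundamental_group X (d 1))"
      unfolding p(2) using loop_class_in_carrier[OF q] by (rule image_eqI)
  qed
qed

section \<open>Coordinates and contractions on the punctured torus\<close>

lemma norm_diff_1_unit: "norm (z::complex) = 1 \<Longrightarrow> (norm (z - 1))\<^sup>2 = 2 - 2 * Re z"
proof -
  assume "norm z = 1"
  then have "(Re z)\<^sup>2 + (Im z)\<^sup>2 = 1" by (metis cmod_power2 one_power2)
  moreover have "(norm (z - 1))\<^sup>2 = (Re z - 1)\<^sup>2 + (Im z)\<^sup>2" by (simp add: cmod_power2)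
  ultimately show ?thesis by (simp add: power2_diff)
qed

text \<open>The squared distance from \<open>(1, 1)\<close> is
  \<open>4 - 2 * Re z - 2 * Re w\<close> by \<open>norm_diff_1_unit\<close>. In this form it is
  visible that moving along a circle so that the real part drops does not leave the set.\<close>

lemma in_punctured_torus:
  "(z, w) \<in> punctured_torus_set \<longleftrightarrow> norm z = 1 \<and> norm w = 1 \<and> Re z + Re w \<le> 3/2"
proof (cases "norm z = 1 \<and> norm w = 1")
  case True
  have "dist (1, 1) (z, w) = sqrt ((norm (z - 1))\<^sup>2 + (norm (w - 1))\<^sup>2)"
    by (simp add: dist_prod_def dist_norm norm_minus_commute)
  also have "\<dots> = sqrt (4 - 2 * Re z - 2 * Re w)"
    using True by (simp add: norm_diff_1_unit)
  finally have "dist (1, 1) (z, w) < 1 \<longleftrightarrow> 4 - 2 * Re z - 2 * Re w < 1"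
    by (simp add: real_sqrt_less_iff)
  then show ?thesis using True by (auto simp: punctured_torus_set_def)
qed (auto simp: punctured_torus_set_def)

lemma punctured_torus_not_both_1: "(z, w) \<in> punctured_torus_set \<Longrightarrow> z \<noteq> 1 \<or> w \<noteq> 1"
  by (auto simp: in_punctured_torus)

text \<open>As \<open>s\<close> decreases to \<open>0\<close> the real part does not increase, so contracting either factor stays in the
  punctured torus.\<close>

definition contract :: "real \<Rightarrow> complex \<Rightarrow> complex" where
  "contract s z = - cis (s * Arg (- z))"

lemma contract_0 [simp]: "contract 0 z = -1"
  by (simp add: contract_def)

lemma contract_1: "norm z = 1 \<Longrightarrow> contract 1 z = z"
proof -
  assume z: "norm z = 1"
  then have "- z \<noteq> 0" by auto
  then have "cis (Arg (- z)) = - z" using z by (simp add: cis_Arg sgn_div_norm)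
  then show ?thesis by (simp add: contract_def)
qed

lemma contract_minus_1 [simp]: "contract s (-1) = -1"
  by (simp add: contract_def)

lemma norm_contract [simp]: "norm (contract s z) = 1"
  by (simp add: contract_def)

lemma minus_not_nonpos: "norm (z::complex) = 1 \<Longrightarrow> z \<noteq> 1 \<Longrightarrow> - z \<notin> \<real>\<^sub>\<le>\<^sub>0"
proof
  assume z: "norm z = 1" "z \<noteq> 1" and "- z \<in> \<real>\<^sub>\<le>\<^sub>0"
  then obtain r where r: "z = of_real r" "r \<ge> 0" by (auto simp: nonpos_Reals_def equation_minus_iff[of z])
     (metis minus_minus neg_0_le_iff_le of_real_minus)
  then show False using z by simp
qed

text \<open>The real part is minus the cosine of \<open>s * Arg (- z)\<close>, and the cosine
  decreases on \<open>[0, pi]\<close>.\<close>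

lemma Re_contract_le:
  assumes "norm z = 1" "s \<in> {0..1}"
  shows "Re (contract s z) \<le> Re z"
proof -
  have "\<bar>s * Arg (- z)\<bar> \<le> \<bar>Arg (- z)\<bar>" using assms(2) by (simp add: abs_mult mult_left_le_one_le)
  moreover have "\<bar>Arg (- z)\<bar> \<le> pi" using mpi_less_Arg[of "-z"] Arg_le_pi[of "-z"] by linarith
  ultimately have "cos \<bar>Arg (- z)\<bar> \<le> cos \<bar>s * Arg (- z)\<bar>" by (intro cos_monotone_0_pi_le) auto
  then have "Re (contract s z) \<le> Re (contract 1 z)" by (simp add: contract_def)
  then show ?thesis using contract_1[OF assms(1)] by simp
qed

lemma contract_neq_1:
  assumes "norm z = 1" "z \<noteq> 1" "s \<in> {0..1}"
  shows "contract s z \<noteq> 1"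
proof
  assume "contract s z = 1"
  then have "Re z \<ge> 1" using Re_contract_le[OF assms(1,3)] by simp
  moreover have "(norm (z - 1))\<^sup>2 = 2 - 2 * Re z" by (rule norm_diff_1_unit[OF assms(1)])
  ultimately have "(norm (z - 1))\<^sup>2 \<le> 0" by simp
  then show False using assms(2) by simp
qed

text \<open>\<open>Arg\<close> jumps on the negative real axis, which \<open>- z\<close> meets on
  the unit circle only for \<open>z = 1\<close>; hence the condition.\<close>

lemma continuous_on_contract:
  assumes s: "continuous_on S s" and z: "continuous_on S z"
    and "\<And>y. y \<in> S \<Longrightarrow> norm (z y) = 1 \<and> z y \<noteq> 1"
  shows "continuous_on S (\<lambda>y. contract (s y) (z y))"
proof -
  have "continuous_on S (\<lambda>y. Arg (- z y))"
    using assms minus_not_nonpos by (intro continuous_intros) blast+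
  then show ?thesis
    unfolding contract_def by (intro continuous_on_minus continuous_on_cis continuous_on_mult s)
qed

text \<open>Contracting the second factor deforms \<open>left_part\<close> onto the circle
  \<open>w = -1\<close>; the first factor does the same for \<open>right_part\<close> and
  \<open>z = -1\<close>. The two parts cover the punctured torus because \<open>(1, 1)\<close> was
  removed.\<close>

abbreviation "left_part \<equiv> {y \<in> punctured_torus_set. snd y \<noteq> 1}"
abbreviation "right_part \<equiv> {y \<in> punctured_torus_set. fst y \<noteq> 1}"

lemma contract_in_torus:
  assumes "(z, w) \<in> punctured_torus_set" "s \<in> {0..1}"
  shows "(contract s z, w) \<in> punctured_torus_set" "(z, contract s w) \<in> punctured_torus_set" "(contract s z, contract s w) \<in> punctured_torus_set"
  using assms Re_contract_le[of z s] Re_contract_le[of w s] by (auto simp: in_punctured_torus)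

lemma minus_1_in_torus: "(-1, -1) \<in> punctured_torus_set" "norm w = 1 \<Longrightarrow> (w, -1) \<in> punctured_torus_set" "norm w = 1 \<Longrightarrow> (-1, w) \<in> punctured_torus_set"
  using complex_Re_le_cmod[of w] by (auto simp: in_punctured_torus)

lemma pathin_top_of_set: "pathin (top_of_set S) p \<longleftrightarrow> continuous_on {0..1} p \<and> p ` {0..1} \<subseteq> S"
  by (auto simp: pathin_def)

text \<open>Contracting both coordinates at once joins every point to
  \<open>(-1, -1)\<close>.\<close>

lemma path_connectedin_middle: "path_connectedin punctured_torus (left_part \<inter> right_part)"
proof -
  let ?S = "left_part \<inter> right_part"
  have m: "(-1, -1) \<in> ?S" using minus_1_in_torus by auto
  have "path_component ?S (-1, -1) y" if y: "y \<in> ?S" for y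
  proof -
    obtain z w where zw: "y = (z, w)" by force
    then have n: "norm z = 1" "norm w = 1" "z \<noteq> 1" "w \<noteq> 1" "(z, w) \<in> punctured_torus_set" using y by (auto simp: in_punctured_torus)
    let ?g = "\<lambda>s. (contract s z, contract s w)"
    have "path ?g"
      unfolding path_def using n by (intro continuous_on_Pair continuous_on_contract continuous_intros) auto
    moreover have "path_image ?g \<subseteq> ?S"
      using contract_in_torus[OF n(5)] contract_neq_1 n by (auto simp: path_image_def)
    moreover have "pathstart ?g = (-1, -1)" "pathfinish ?g = y"
      using n by (simp_all add: pathstart_def pathfinish_def contract_1 zw)
    ultimately show ?thesis unfolding path_component_def by blast
  qed
  then have "path_connected ?S"
    unfolding path_connected_component by (meson path_component_sym path_component_trans)
  then show ?thesis by (auto simp: path_connectedin_subtopology path_connectedin_euclidean)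
qed

text \<open>It winds \<open>n\<close> times around the circle \<open>w = -1\<close> and is based at
  \<open>(-1, -1)\<close>, a point that \<open>contract\<close> leaves fixed.\<close>

definition torus_loop :: "int \<Rightarrow> real \<Rightarrow> complex \<times> complex" where
  "torus_loop n = (\<lambda>t. (- cis (2 * pi * n * t), -1))"

lemma cis_2pi_int: "cis (2 * pi * of_int n) = 1"
  by (simp add: cis_multiple_2pi)

lemma continuous_angle_map: "continuous_map (top_of_set UNIV) punctured_torus (\<lambda>\<theta>::real. (- cis \<theta>, -1))"
proof -
  have "continuous_on UNIV (\<lambda>\<theta>::real. (- cis \<theta>, -1 :: complex))" by (intro continuous_intros)
  then show ?thesis using minus_1_in_torus(2) by (simp add: continuous_map_in_subtopology)
qed

lemma torus_loop_in_loops: "torus_loop n \<in> loops punctured_torus (-1, -1)"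
  using minus_1_in_torus(2)[of "- cis _"] cis_2pi_int[of n]
  by (auto simp: loops_def pathin_top_of_set torus_loop_def intro!: continuous_intros)

lemma torus_loop_homotopic:
  fixes \<theta> :: "real \<Rightarrow> real"
  assumes "continuous_on {0..1} \<theta>" "\<theta> 0 = 0" "\<theta> 1 = 2 * pi * of_int n"
  shows "path_homotopic punctured_torus (\<lambda>t. (- cis (\<theta> t), -1)) (torus_loop n)"
  using path_homotopic_convex[OF convex_UNIV continuous_angle_map, of \<theta> "\<lambda>t. 2 * pi * n * t"] assms
  by (simp add: comp_def torus_loop_def continuous_intros)

lemma torus_loop_add:
  "path_homotopic punctured_torus (loop_concat (torus_loop n) (torus_loop m)) (torus_loop (n + m))"
proof -
  let ?\<theta> = "loop_concat (\<lambda>t. 2 * pi * n * t) (\<lambda>t. 2 * pi * n + 2 * pi * m * t)"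
  have "path_homotopic punctured_torus (\<lambda>t. (- cis (?\<theta> t), -1)) (torus_loop (n + m))"
    by (rule torus_loop_homotopic)
      (auto intro!: continuous_on_loop_concat continuous_intros simp: algebra_simps)
  moreover have "(\<lambda>t. (- cis (?\<theta> t), -1)) = loop_concat (torus_loop n) (torus_loop m)"
    using cis_2pi_int[of n] by (auto simp: loop_concat_def torus_loop_def fun_eq_iff simp flip: cis_mult)
  ultimately show ?thesis by simp
qed

text \<open>Contracting the second coordinate moves \<open>q\<close> onto the circle
  \<open>w = -1\<close>. There a continuous logarithm provides the angle of \<open>- z\<close>,
  whose total change is \<open>2 * pi * n\<close>, and angle functions with the same end values are
  homotopic along straight lines.\<close>

lemma left_loop_homotopic:
  assumes q: "q \<in> loops punctured_torus (-1, -1)" and left: "q ` {0..1} \<subseteq> left_part"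
  obtains n where "path_homotopic punctured_torus q (torus_loop n)"
proof -
  define z where "z = fst \<circ> q"
  define w where "w = snd \<circ> q"
  have qzw: "q t = (z t, w t)" for t by (simp add: z_def w_def)
  have qT: "q t \<in> punctured_torus_set" "norm (z t) = 1" "norm (w t) = 1" "w t \<noteq> 1" if "t \<in> {0..1}" for t
    using left that by (auto simp: image_subset_iff qzw in_punctured_torus)
  have contq: "continuous_on {0..1} q" using q by (auto simp: loops_def pathin_top_of_set)
  then have cont: "continuous_on {0..1} z" "continuous_on {0..1} w"
    unfolding z_def w_def comp_def by (auto intro!: continuous_intros)
  have ends: "z 0 = -1" "z 1 = -1" "w 0 = -1" "w 1 = -1"
    using q by (auto simp: loops_def z_def w_def)
  let ?q1 = "\<lambda>t. (z t, -1)"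
  have "path_homotopic punctured_torus ?q1 q"
    unfolding path_homotopic_def homotopic_with_def
  proof (intro exI conjI allI ballI)
    \<comment> \<open>\<open>homotopic_with\<close> asks for the right values at
      \<open>s = 0\<close> and \<open>s = 1\<close> for every real \<open>t\<close>, hence the cases
      outside the unit interval.\<close>
    let ?H = "\<lambda>(s, t). if t \<in> {0..1} then (z t, contract s (w t)) else if s = 0 then ?q1 t else q t"
    have "continuous_on ({0..1} \<times> {0..1}) (\<lambda>y. (z (snd y), contract (fst y) (w (snd y))))"
      using qT by (intro continuous_on_Pair continuous_on_contract continuous_intros
          continuous_on_compose2[OF cont(1)] continuous_on_compose2[OF cont(2)]) auto
    moreover have "(z t, contract s (w t)) \<in> punctured_torus_set" if "s \<in> {0..1}" "t \<in> {0..1}" for s t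
      using contract_in_torus(2)[of "z t" "w t" s] qT(1)[OF that(2)] that qzw by simp
    ultimately have "continuous_map (top_of_set ({0..1} \<times> {0..1})) punctured_torus (\<lambda>y. (z (snd y), contract (fst y) (w (snd y))))"
      by auto
    then show "continuous_map (prod_topology (top_of_set {0..1}) (top_of_set {0..1})) punctured_torus ?H"
      unfolding prod_top_of_set by (rule continuous_map_eq) auto
    show "?H (0, t) = ?q1 t" for t by simp
    show "?H (1, t) = q t" for t using qT by (auto simp: contract_1 qzw)
    show "?H (s, 0) = ?q1 0" if "s \<in> {0..1}" for s using that ends by simp
    show "?H (s, 1) = ?q1 1" if "s \<in> {0..1}" for s using that ends by simp
  qed
  moreover obtain n where "path_homotopic punctured_torus ?q1 (torus_loop n)"
  proof -
    have contr: "contractible {0..1::real}" by (simp add: convex_imp_contractible)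
    have "continuous_on {0..1} (\<lambda>t. - z t)" using cont(1) by (intro continuous_intros)
    moreover have "- z t \<noteq> 0" if "t \<in> {0..1}" for t using qT(2)[OF that] by auto
    ultimately obtain g where g: "continuous_on {0..1} g" "\<And>t. t \<in> {0..1} \<Longrightarrow> - z t = exp (g t)"
      using contr continuous_logarithm_on_contractible[of "{0..1}" "\<lambda>t. - z t"] by blast
    have "Re (g t) = 0" if "t \<in> {0..1}" for t
      using g(2)[OF that] qT(2)[OF that] by (metis exp_eq_one_iff norm_exp_eq_Re norm_minus_cancel)
    then have zt: "- z t = cis (Im (g t))" if "t \<in> {0..1}" for t
      using g(2)[OF that] that by (simp add: exp_eq_polar)
    have "cis (Im (g 0)) = 1" using zt[of 0] ends by simp
    have "cis (Im (g 1) - Im (g 0)) = 1" using zt[of 0] zt[of 1] ends by (simp flip: cis_divide)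
    then obtain n where n: "Im (g 1) - Im (g 0) = 2 * pi * of_int n"
      by (auto simp: complex_eq_iff cos_one_2pi_int)
    have "path_homotopic punctured_torus (\<lambda>t. (- cis (Im (g t) - Im (g 0)), -1)) (torus_loop n)"
      by (rule torus_loop_homotopic) (use g n in \<open>auto intro!: continuous_intros\<close>)
    moreover have "path_homotopic punctured_torus ?q1 (\<lambda>t. (- cis (Im (g t) - Im (g 0)), -1))"
    proof (rule path_homotopic_eq)
      show "pathin punctured_torus ?q1"
        using cont qT minus_1_in_torus(2) by (auto simp: pathin_top_of_set intro!: continuous_intros)
      show "(z t, -1) = (- cis (Im (g t) - Im (g 0)), -1)" if "t \<in> {0..1}" for t
        using zt[OF that] \<open>cis (Im (g 0)) = 1\<close> by (simp flip: cis_divide) (metis minus_minus)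
    qed
    ultimately show ?thesis using that path_homotopic_trans by blast
  qed
  ultimately show ?thesis using that path_homotopic_trans path_homotopic_sym by blast
qed

lemma torus_loop_0: "torus_loop 0 = (\<lambda>_. (-1, -1))"
  by (simp add: torus_loop_def)

lemma torus_loop_class_power:
  "loop_class punctured_torus (-1, -1) (torus_loop n)
    = loop_class punctured_torus (-1, -1) (torus_loop 1) [^]\<^bsub>fundamental_group punctured_torus (-1, -1)\<^esub> n"
proof -
  let ?G = "fundamental_group punctured_torus (-1, -1)"
  let ?c = "\<lambda>n. loop_class punctured_torus (-1, -1) (torus_loop n)"
  interpret G: group ?G by (rule group_fundamental_group) (simp add: minus_1_in_torus)
  have mem [simp]: "?c n \<in> carrier ?G" for n by (rule loop_class_in_carrier[OF torus_loop_in_loops])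
  have add: "?c n \<otimes>\<^bsub>?G\<^esub> ?c m = ?c (n + m)" for n m
    unfolding mult_fundamental_group[OF torus_loop_in_loops torus_loop_in_loops]
    by (simp add: loop_class_eq_iff loops_concat torus_loop_in_loops torus_loop_add)
  have zero: "?c 0 = \<one>\<^bsub>?G\<^esub>" by (simp add: torus_loop_0 one_fundamental_group)
  have nat: "?c (int k) = ?c 1 [^]\<^bsub>?G\<^esub> k" for k
  proof (induction k)
    case (Suc k)
    have "?c (int (Suc k)) = ?c (int k) \<otimes>\<^bsub>?G\<^esub> ?c 1" by (simp add: add add.commute)
    then show ?case by (simp add: Suc)
  qed (simp add: zero)
  show ?thesis
  proof (cases n)
    case (nonneg k)
    then show ?thesis by (simp add: nat int_pow_int)
  next
    case (neg k)
    have "?c n \<otimes>\<^bsub>?G\<^esub> ?c (int (Suc k)) = \<one>\<^bsub>?G\<^esub>" unfolding add neg by (simp add: zero)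
    then have "?c n = inv\<^bsub>?G\<^esub> (?c (int (Suc k)))" by (simp add: G.inv_equality[symmetric])
    then show ?thesis unfolding nat[of "Suc k"] by (simp only: neg G.int_pow_neg_int mem)
  qed
qed

text \<open>Paths are built inside the punctured torus to points with \<open>w \<noteq> 1\<close>; a
  point with \<open>w = 1\<close> has \<open>z \<noteq> 1\<close> and is reached by swapping the
  coordinates.\<close>

lemma path_connected_punctured_torus: "path_connected punctured_torus_set"
proof -
  have left: "path_component punctured_torus_set (-1, -1) (z, w)" if zw: "(z, w) \<in> punctured_torus_set" "w \<noteq> 1" for z w
  proof -
    have n: "norm z = 1" "norm w = 1" using zw by (auto simp: in_punctured_torus)
    have "path_component punctured_torus_set (z, -1) (z, w)"
      unfolding path_component_def
    proof (intro exI conjI)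
      let ?g = "\<lambda>s. (z, contract s w)"
      show "path ?g" unfolding path_def
        using n zw by (intro continuous_on_Pair continuous_on_contract continuous_intros) auto
      show "path_image ?g \<subseteq> punctured_torus_set"
        using contract_in_torus(2)[OF zw(1)] by (auto simp: path_image_def)
      show "pathstart ?g = (z, -1)" "pathfinish ?g = (z, w)"
        using n by (simp_all add: pathstart_def pathfinish_def contract_1)
    qed
    moreover have "path_component punctured_torus_set (-1, -1) (z, -1)"
      unfolding path_component_def
    proof (intro exI conjI)
      let ?g = "\<lambda>s. (- cis (s * Arg (- z)), -1)"
      show "path ?g" unfolding path_def by (intro continuous_intros)
      show "path_image ?g \<subseteq> punctured_torus_set"
        using minus_1_in_torus(2) by (auto simp: path_image_def)
      show "pathstart ?g = (-1, -1)" "pathfinish ?g = (z, -1)"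
        using contract_1[OF n(1)] by (simp_all add: pathstart_def pathfinish_def contract_def)
    qed
    ultimately show ?thesis using path_component_trans by blast
  qed
  have cont: "continuous_on punctured_torus_set prod.swap"
    by (intro continuous_on_swap)
  have swap: "prod.swap ` punctured_torus_set \<subseteq> punctured_torus_set"
    by (auto simp: in_punctured_torus)
  have "path_component punctured_torus_set (-1, -1) y" if y: "y \<in> punctured_torus_set" for y
  proof -
    obtain z w where zw: "y = (z, w)" by force
    show ?thesis
    proof (cases "w = 1")
      case True
      then have "z \<noteq> 1" using punctured_torus_not_both_1 y zw by blast
      then have "path_component punctured_torus_set (-1, -1) (w, z)"
        using y zw by (intro left) (auto simp: in_punctured_torus)
      then obtain g where g: "path g" "path_image g \<subseteq> punctured_torus_set" "pathstart g = (-1, -1)" "pathfinish g = (w, z)"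
        by (auto simp: path_component_def)
      have "path (prod.swap \<circ> g)" using g(1,2) cont by (intro path_continuous_image) (auto intro: continuous_on_subset)
      moreover have "path_image (prod.swap \<circ> g) \<subseteq> punctured_torus_set"
        using g(2) swap by (auto simp: path_image_compose)
      moreover have "pathstart (prod.swap \<circ> g) = (-1, -1)" "pathfinish (prod.swap \<circ> g) = y"
        using g(3,4) zw by (simp_all add: pathstart_compose pathfinish_compose)
      ultimately show ?thesis unfolding path_component_def by blast
    qed (use left y zw in auto)
  qed
  then show ?thesis
    unfolding path_connected_component by (meson path_component_sym path_component_trans)
qed

text \<open>At the base point \<open>(-1, -1)\<close> the loops in \<open>left_part\<close> give
  powers of one class \<open>a\<close>. Swapping the coordinates exchanges the two parts, so the
  loops in \<open>right_part\<close> give powers of \<open>f a\<close>. The generators are finally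
  moved to \<open>x\<close> along a path.\<close>

lemma punctured_torus_two_generators:
  assumes x: "x \<in> punctured_torus_set"
  obtains a b where "a \<in> carrier (fundamental_group punctured_torus x)" "b \<in> carrier (fundamental_group punctured_torus x)"
    "generate (fundamental_group punctured_torus x) {a, b} = carrier (fundamental_group punctured_torus x)"
proof -
  let ?y = "(-1, -1) :: complex \<times> complex"
  let ?G = "fundamental_group punctured_torus ?y"
  interpret G: group ?G by (rule group_fundamental_group) (simp add: minus_1_in_torus)
  have swap: "continuous_map punctured_torus punctured_torus prod.swap"
    by (auto simp: continuous_map_in_subtopology in_punctured_torus intro: continuous_on_swap)
  define f where "f = fundamental_group_map punctured_torus ?y prod.swap"
  have fhom: "f \<in> hom ?G ?G"
    unfolding f_def by (rule fundamental_group_map_hom[OF swap]) simp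
  interpret f: group_hom ?G ?G f using fhom by (simp add: group_hom_def group_hom_axioms_def G.is_group)
  define a where "a = loop_class punctured_torus ?y (torus_loop 1)"
  have a: "a \<in> carrier ?G" unfolding a_def by (rule loop_class_in_carrier[OF torus_loop_in_loops])
  have sub: "subgroup (generate ?G {a, f a}) ?G" using a by (intro G.generate_is_subgroup) simp
  have left: "\<exists>n::int. loop_class punctured_torus ?y q = a [^]\<^bsub>?G\<^esub> n"
    if q: "q \<in> loops punctured_torus ?y" "q ` {0..1} \<subseteq> left_part" for q
  proof -
    obtain n where "path_homotopic punctured_torus q (torus_loop n)" by (rule left_loop_homotopic[OF q])
    then have "loop_class punctured_torus ?y q = loop_class punctured_torus ?y (torus_loop n)"
      using loop_class_eq_iff[OF q(1) torus_loop_in_loops] by simp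
    then show ?thesis using torus_loop_class_power[of n] unfolding a_def by blast
  qed
  have right: "\<exists>n::int. loop_class punctured_torus ?y q = f a [^]\<^bsub>?G\<^esub> n"
    if q: "q \<in> loops punctured_torus ?y" "q ` {0..1} \<subseteq> right_part" for q
  proof -
    have sq: "prod.swap \<circ> q \<in> loops punctured_torus ?y" using loops_comp[OF q(1) swap] by simp
    have "(prod.swap \<circ> q) ` {0..1} \<subseteq> left_part"
    proof (rule image_subsetI)
      fix t :: real assume t: "t \<in> {0..1}"
      obtain z w where zw: "q t = (z, w)" by force
      have "q t \<in> right_part" using q(2) t by (auto simp only: image_subset_iff)
      then show "(prod.swap \<circ> q) t \<in> left_part" by (auto simp: zw in_punctured_torus)
    qed
    then obtain n :: int where "loop_class punctured_torus ?y (prod.swap \<circ> q) = a [^]\<^bsub>?G\<^esub> n" using left[OF sq] by blast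
    then have "f (loop_class punctured_torus ?y (prod.swap \<circ> q)) = f a [^]\<^bsub>?G\<^esub> n"
      using a by (simp add: f.hom_int_pow)
    moreover have "f (loop_class punctured_torus ?y (prod.swap \<circ> q)) = loop_class punctured_torus ?y (prod.swap \<circ> (prod.swap \<circ> q))"
      unfolding f_def by (rule fundamental_group_map_class[OF sq swap]) simp
    moreover have "prod.swap \<circ> (prod.swap \<circ> q) = q" by (auto simp: fun_eq_iff)
    ultimately show ?thesis by auto
  qed
  have openL: "openin punctured_torus left_part"
    using openin_continuous_map_preimage[of punctured_torus euclidean snd "- {1}"]
    by (simp add: continuous_on_snd open_Compl)
  have openR: "openin punctured_torus right_part"
    using openin_continuous_map_preimage[of punctured_torus euclidean fst "- {1}"]
    by (simp add: continuous_on_fst open_Compl)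
  have "generate ?G (loop_classes_in punctured_torus ?y left_part \<union> loop_classes_in punctured_torus ?y right_part) = carrier ?G"
    using punctured_torus_not_both_1 minus_1_in_torus(1)
    by (intro generate_loop_classes_union openL openR path_connectedin_middle) auto
  moreover have incl: "loop_classes_in punctured_torus ?y left_part \<union> loop_classes_in punctured_torus ?y right_part \<subseteq> generate ?G {a, f a}"
  proof -
    have mem: "a \<in> generate ?G {a, f a}" "f a \<in> generate ?G {a, f a}" by (simp_all add: generate.incl)
    show ?thesis
      unfolding loop_classes_in_def
    proof (safe, goal_cases)
      case (1 _ q)
      then obtain n :: int where "loop_class punctured_torus ?y q = a [^]\<^bsub>?G\<^esub> n" using left by meson
      then show ?case using G.subgroup_int_pow_closed[OF sub mem(1)] by simp
    next
      case (2 _ q)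
      then obtain n :: int where "loop_class punctured_torus ?y q = f a [^]\<^bsub>?G\<^esub> n" using right by meson
      then show ?case using G.subgroup_int_pow_closed[OF sub mem(2)] by simp
    qed
  qed
  ultimately have "carrier ?G \<subseteq> generate ?G {a, f a}"
    using G.generate_subgroup_incl[OF incl sub] by simp
  then have gen: "generate ?G {a, f a} = carrier ?G"
    using a by (intro antisym G.generate_incl) auto
  obtain d where d: "pathin punctured_torus d" "d 0 = x" "d 1 = ?y"
    using path_connected_punctured_torus x minus_1_in_torus(1)
    unfolding path_connected_def pathin_top_of_set by (metis path_def path_image_def pathfinish_def pathstart_def)
  let ?H = "fundamental_group punctured_torus x"
  define \<beta> where "\<beta> = change_base punctured_torus d"
  interpret H: group ?H by (rule group_fundamental_group) (simp add: x)
  interpret \<beta>: group_hom ?G ?H \<beta>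
    using change_base_hom[OF d(1)] d by (simp add: group_hom_def group_hom_axioms_def G.is_group H.is_group \<beta>_def)
  have "generate ?H (\<beta> ` {a, f a}) = \<beta> ` generate ?G {a, f a}"
    using a by (subst \<beta>.generate_img) simp_all
  also have "\<dots> = carrier ?H"
    using change_base_surj[OF d(1)] d gen by (simp add: \<beta>_def)
  finally have "generate ?H {\<beta> a, \<beta> (f a)} = carrier ?H" by simp
  then show ?thesis using a by (intro that[of "\<beta> a" "\<beta> (f a)"]) simp_all
qed

section \<open>The infinite cyclic cover of a mapping torus\<close>

text \<open>A compact fibre in a Euclidean space allows the mapping torus to be realized as a
  compact Euclidean set, where continuity can be checked in coordinates.\<close>

locale compact_mapping_torus =
  fixes S :: "'a::euclidean_space set" and h :: "'a \<Rightarrow> 'a"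
  assumes compact_S: "compact S"
    and homeo: "homeomorphic_map (top_of_set S) (top_of_set S) h"
begin

abbreviation "M \<equiv> mapping_torus (top_of_set S) h"
abbreviation "cl \<equiv> mapping_torus_class (top_of_set S) h"

definition h_inv :: "'a \<Rightarrow> 'a" where "h_inv = inv_into S h"

lemma h_bij: "h ` S = S" "inj_on h S"
  using homeomorphic_imp_surjective_map[OF homeo] homeomorphic_imp_injective_map[OF homeo] by auto

lemma h_in [simp]: "y \<in> S \<Longrightarrow> h y \<in> S"
  using h_bij by blast

lemma h_inv_in [simp]: "y \<in> S \<Longrightarrow> h_inv y \<in> S"
  using h_bij by (simp add: h_inv_def inv_into_into)

lemma h_h_inv [simp]: "y \<in> S \<Longrightarrow> h (h_inv y) = y"
  using h_bij by (simp add: h_inv_def f_inv_into_f)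

lemma h_inv_h [simp]: "y \<in> S \<Longrightarrow> h_inv (h y) = y"
  using h_bij by (simp add: h_inv_def inv_into_f_f)

lemma continuous_h: "continuous_on S h"
  using homeomorphic_imp_continuous_map[OF homeo] by simp

lemma continuous_h_inv: "continuous_on S h_inv"
  using continuous_on_inv[OF continuous_h compact_S, of h_inv] h_bij(1) by simp

definition h_pow :: "int \<Rightarrow> 'a \<Rightarrow> 'a" where
  "h_pow n = (if n \<ge> 0 then h ^^ nat n else h_inv ^^ nat (- n))"

lemma h_pow_0 [simp]: "h_pow 0 y = y"
  by (simp add: h_pow_def)

lemma funpow_in: "y \<in> S \<Longrightarrow> (h ^^ k) y \<in> S" "y \<in> S \<Longrightarrow> (h_inv ^^ k) y \<in> S"
  by (induction k) auto

lemma h_pow_in [simp]: "y \<in> S \<Longrightarrow> h_pow n y \<in> S"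
  by (simp add: h_pow_def funpow_in)

lemma continuous_h_pow: "continuous_on S (h_pow n)"
proof -
  have "continuous_on S (h ^^ k)" "continuous_on S (h_inv ^^ k)" for k
    using funpow_in by (induction k) (auto intro!: continuous_on_compose2[OF continuous_h] continuous_on_compose2[OF continuous_h_inv])
  then show ?thesis by (simp add: h_pow_def)
qed

lemma h_pow_Suc: assumes "y \<in> S" shows "h_pow (n + 1) y = h (h_pow n y)"
proof (cases "n \<ge> 0")
  case True
  then have "nat (n + 1) = Suc (nat n)" by simp
  then show ?thesis using True by (simp add: h_pow_def)
next
  case False
  then have "nat (- n) = Suc (nat (- (n + 1)))" by simp
  then have "h_pow n y = h_inv ((h_inv ^^ nat (- (n + 1))) y)" using False by (simp add: h_pow_def)
  then have "h (h_pow n y) = (h_inv ^^ nat (- (n + 1))) y" using assms by (simp add: funpow_in)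
  moreover have "(h_inv ^^ nat (- (n + 1))) y = h_pow (n + 1) y"
    using False by (cases "n = -1") (simp_all add: h_pow_def)
  ultimately show ?thesis by simp
qed

lemma h_pow_add: assumes "y \<in> S" shows "h_pow (n + m) y = h_pow n (h_pow m y)"
proof (induction n rule: int_induct[where k = 0])
  case (step1 i)
  have "h_pow (i + 1 + m) y = h (h_pow (i + m) y)"
    using h_pow_Suc[OF assms, of "i + m"] by (simp add: algebra_simps)
  then show ?case using step1 h_pow_Suc[of "h_pow m y" i] assms by simp
next
  case (step2 i)
  have "h (h_pow (i - 1 + m) y) = h_pow (i + m) y"
    using h_pow_Suc[OF assms, of "i - 1 + m"] by (simp add: algebra_simps)
  moreover have "h (h_pow (i - 1) (h_pow m y)) = h_pow i (h_pow m y)"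
    using h_pow_Suc[of "h_pow m y" "i - 1"] assms by simp
  ultimately have "h (h_pow (i - 1 + m) y) = h (h_pow (i - 1) (h_pow m y))" using step2 by simp
  then show ?case using h_bij(2) assms by (simp add: inj_on_eq_iff)
qed simp

lemma h_pow_inverse: "y \<in> S \<Longrightarrow> h_pow n (h_pow (- n) y) = y" "y \<in> S \<Longrightarrow> h_pow (- n) (h_pow n y) = y"
  by (simp_all flip: h_pow_add)

lemma h_pow_eq_iff: "y \<in> S \<Longrightarrow> y' \<in> S \<Longrightarrow> h_pow n y = h_pow n y' \<longleftrightarrow> y = y'"
  using h_pow_inverse(2) by metis

lemma h_pow_fixed: "x \<in> S \<Longrightarrow> h x = x \<Longrightarrow> h_pow n x = x"
proof (induction n rule: int_induct[where k = 0])
  case (step2 i)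
  then show ?case using h_pow_Suc[of x "i - 1"] h_inv_h[of "h_pow (i - 1) x"] h_inv_h[of x] by simp
qed (simp_all add: h_pow_Suc)

text \<open>The last coordinate determines \<open>y\<close> for \<open>0 < s < 1\<close>; the middle one agrees on glued points and
  determines \<open>y\<close> for \<open>s \<in> {0, 1}\<close>.\<close>

definition emb :: "'a \<times> real \<Rightarrow> complex \<times> 'a \<times> 'a" where
  "emb = (\<lambda>(y, s). (cis (2 * pi * s), (1 - s) *\<^sub>R y + s *\<^sub>R h y, (s * (1 - s)) *\<^sub>R y))"

definition "K = emb ` (S \<times> {0..1})"

text \<open>\<open>emb\<close> is constant on classes, so the chosen representative does not
  matter.\<close>

definition emb_cl :: "('a \<times> real) set \<Rightarrow> complex \<times> 'a \<times> 'a" where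
  "emb_cl c = emb (SOME p. p \<in> c)"

lemma continuous_emb: "continuous_on (S \<times> {0..1}) emb"
  unfolding emb_def case_prod_unfold
  by (intro continuous_intros continuous_on_compose2[OF continuous_h]) auto

lemma emb_1: "emb (y, 1) = emb (h y, 0)"
  by (simp add: emb_def)

lemma cis_2pi_eq_iff: "cis (2 * pi * s) = cis (2 * pi * t) \<longleftrightarrow> (\<exists>n::int. s = t + n)"
proof
  assume "cis (2 * pi * s) = cis (2 * pi * t)"
  then have "cis (2 * pi * s - 2 * pi * t) = 1" by (simp flip: cis_divide)
  then obtain n :: int where "2 * pi * s - 2 * pi * t = 2 * pi * of_int n"
    by (auto simp: complex_eq_iff cos_one_2pi_int)
  then have "2 * pi * s = 2 * pi * (t + of_int n)" by (simp add: algebra_simps)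
  then show "\<exists>n::int. s = t + n" by auto
next
  assume "\<exists>n::int. s = t + n"
  then show "cis (2 * pi * s) = cis (2 * pi * t)"
    by (auto simp: distrib_left cis_mult[symmetric])
qed

lemma emb_eq_same_height:
  assumes "emb (y, s) = emb (y', s)" "y \<in> S" "y' \<in> S"
  shows "y = y'"
proof (cases "s = 0 \<or> s = 1")
  case True
  then show ?thesis using assms h_bij(2) by (auto simp: emb_def inj_on_eq_iff)
qed (use assms in \<open>auto simp: emb_def\<close>)

definition glue :: "(('a \<times> real) \<times> ('a \<times> real)) set" where
  "glue = {((y, 1), (h y, 0)) | y. y \<in> S}"

lemma cl_eq: "cl p = (glue \<union> glue\<inverse>)\<^sup>* `` {p}"
  by (simp add: mapping_torus_class_def glue_def Let_def)

lemma cl_refl: "p \<in> cl p"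
  by (simp add: cl_eq)

lemma emb_cl_mem: "q \<in> cl p \<Longrightarrow> emb q = emb p"
proof -
  assume "q \<in> cl p"
  then have "(p, q) \<in> (glue \<union> glue\<inverse>)\<^sup>*" by (simp add: cl_eq)
  then show "emb q = emb p"
    by (induction rule: rtrancl_induct) (auto simp: glue_def emb_1)
qed

lemma emb_cl_cl [simp]: "emb_cl (cl p) = emb p"
  using emb_cl_mem someI[of "\<lambda>q. q \<in> cl p", OF cl_refl] by (simp add: emb_cl_def)

lemma cl_glue: assumes "y \<in> S" shows "cl (y, 1) = cl (h y, 0)"
proof -
  let ?R = "glue \<union> glue\<inverse>"
  have "((y, 1), (h y, 0)) \<in> ?R\<^sup>*" "((h y, 0), (y, 1)) \<in> ?R\<^sup>*" using assms by (auto simp: glue_def)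
  then show ?thesis unfolding cl_eq by (auto intro: rtrancl_trans)
qed

lemma emb_inj:
  assumes "p \<in> S \<times> {0..1}" "p' \<in> S \<times> {0..1}" "emb p = emb p'"
  shows "cl p = cl p'"
proof -
  obtain y s y' s' where p: "p = (y, s)" "p' = (y', s')" by force
  then have yS: "y \<in> S" "y' \<in> S" and s: "0 \<le> s" "s \<le> 1" "0 \<le> s'" "s' \<le> 1" using assms by auto
  have "cis (2 * pi * s) = cis (2 * pi * s')" using assms(3) p by (simp add: emb_def)
  then obtain n :: int where n: "s = s' + n" by (auto simp: cis_2pi_eq_iff)
  \<comment> \<open>Two heights in the unit interval with the same circle coordinate are equal or
    are 0 and 1, the glued case.\<close>
  then have "n \<in> {-1, 0, 1}" using s by auto
  then consider "s = s'" | "s = 1" "s' = 0" | "s = 0" "s' = 1" using n s by force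
  then show ?thesis
  proof cases
    case 1
    then show ?thesis using emb_eq_same_height[of y s y'] assms(3) yS p by simp
  next
    case 2
    then have "emb (h y, 0) = emb (y', 0)" using assms(3) p emb_1 by simp
    then have "h y = y'" using emb_eq_same_height yS by simp
    then show ?thesis using cl_glue[OF yS(1)] 2 p by simp
  next
    case 3
    then have "emb (y, 0) = emb (h y', 0)" using assms(3) p emb_1 by simp
    then have "y = h y'" using emb_eq_same_height yS by simp
    then show ?thesis using cl_glue[OF yS(2)] 3 p by simp
  qed
qed

lemma quotient_cl: "quotient_map (top_of_set (S \<times> {0..1})) M cl"
  using quotient_map_quotient_topology unfolding mapping_torus_def prod_top_of_set .

lemma topspace_M: "topspace M = cl ` (S \<times> {0..1})"
  using quotient_imp_surjective_map[OF quotient_cl] by simp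

text \<open>A continuous injection of a compact space into a Hausdorff space is a homeomorphism onto
  its image; the continuity of \<open>emb\<close> passes to the quotient.\<close>

lemma homeomorphic_emb_cl: "homeomorphic_map M (top_of_set K) emb_cl"
proof (rule continuous_imp_homeomorphic_map)
  have "compact_space (top_of_set (S \<times> {0..1::real}))"
    using compact_S by (simp add: compact_space_subtopology compact_Times)
  then show "compact_space M"
    using image_compactin[OF _ quotient_imp_continuous_map[OF quotient_cl], of "S \<times> {0..1}"]
    unfolding compact_space_def topspace_M by simp
  show "Hausdorff_space (top_of_set K)" by (simp add: Hausdorff_space_subtopology)
  have "continuous_map (top_of_set (S \<times> {0..1})) (top_of_set K) (emb_cl \<circ> cl)"
    using continuous_emb by (simp add: comp_def K_def)
  then show "continuous_map M (top_of_set K) emb_cl"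
    by (rule continuous_compose_quotient_map[OF quotient_cl])
  show "emb_cl ` topspace M = topspace (top_of_set K)"
    by (simp add: topspace_M image_image K_def)
  show "inj_on emb_cl (topspace M)"
  proof (rule inj_onI)
    fix c c' assume "c \<in> topspace M" "c' \<in> topspace M" and eq: "emb_cl c = emb_cl c'"
    then obtain p p' where p: "p \<in> S \<times> {0..1}" "p' \<in> S \<times> {0..1}" "c = cl p" "c' = cl p'"
      unfolding topspace_M by blast
    show "c = c'" unfolding p(3,4) by (rule emb_inj[OF p(1,2)]) (use eq p(3,4) in simp)
  qed
qed

lemma continuous_map_into_M:
  assumes f: "f \<in> topspace Z \<rightarrow> topspace M" and cont: "continuous_map Z (top_of_set K) (emb_cl \<circ> f)"
  shows "continuous_map Z M f"
proof -
  obtain g where g: "homeomorphic_maps M (top_of_set K) emb_cl g"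
    using homeomorphic_emb_cl by (auto simp: homeomorphic_map_maps)
  then have "continuous_map (top_of_set K) M g" by (simp add: homeomorphic_maps_def)
  then have "continuous_map Z M (g \<circ> (emb_cl \<circ> f))" by (rule continuous_map_compose[OF cont])
  then show ?thesis
    by (rule continuous_map_eq) (use f g in \<open>auto simp: homeomorphic_maps_def Pi_iff\<close>)
qed

text \<open>The infinite cyclic covering map. Passing an integer height upwards replaces
  \<open>y\<close> by \<open>h y\<close> because of the gluing, which accounts for the power of
  \<open>h\<close> on each strip.\<close>

definition cover :: "'a \<times> real \<Rightarrow> ('a \<times> real) set" where
  "cover = (\<lambda>(y, s). cl (h_pow \<lfloor>s\<rfloor> y, frac s))"

lemma cover_in: "y \<in> S \<Longrightarrow> cover (y, s) \<in> topspace M"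
  using frac_lt_1[of s] frac_ge_0[of s] by (auto simp: cover_def topspace_M intro!: imageI)

text \<open>At the upper end of the strip the floor has already jumped, but the gluing relation
  makes both descriptions agree. Thus one formula holds on a closed strip, and continuity there
  follows from it.\<close>

lemma cover_strip:
  assumes y: "y \<in> S" and s: "of_int n \<le> s" "s \<le> of_int n + 1"
  shows "cover (y, s) = cl (h_pow n y, s - of_int n)"
proof (cases "s = of_int n + 1")
  case True
  then have "\<lfloor>s\<rfloor> = n + 1" "frac s = 0" by (simp_all add: frac_def)
  then show ?thesis using True cl_glue[of "h_pow n y"] y by (simp add: cover_def h_pow_Suc)
next
  case False
  then have "\<lfloor>s\<rfloor> = n" using s by (intro floor_unique) auto
  then show ?thesis by (simp add: cover_def frac_def)
qed

lemma cover_0: "cover (y, 0) = cl (y, 0)"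
  by (simp add: cover_def)

lemma cover_shift: assumes "y \<in> S" shows "cover (y, s + of_int n) = cover (h_pow n y, s)"
proof -
  have "\<lfloor>s + of_int n\<rfloor> = \<lfloor>s\<rfloor> + n" "frac (s + of_int n) = frac s" by (simp_all add: frac_def)
  then show ?thesis using assms by (simp add: cover_def h_pow_add)
qed

lemma fst_emb_cover: "fst (emb_cl (cover (y, s))) = cis (2 * pi * s)"
  by (simp add: cover_def emb_def) (auto simp: cis_2pi_eq_iff frac_def intro: exI[of _ "- \<lfloor>s\<rfloor>"])

text \<open>Equal circle coordinates provide \<open>n\<close>. After a shift by \<open>n\<close>
  both points have the same height, where \<open>emb\<close> determines the fibre coordinate. So
  points over the same point differ by the deck transformation that takes \<open>(y, s)\<close> to
  \<open>(h_pow (- n) y, s + n)\<close>.\<close>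

lemma cover_eqD:
  assumes eq: "cover (y, s) = cover (y', s')" and y: "y \<in> S" "y' \<in> S"
  obtains n :: int where "s' = s + n" "y = h_pow n y'"
proof -
  have "cis (2 * pi * s') = cis (2 * pi * s)" using arg_cong[OF eq, of "\<lambda>c. fst (emb_cl c)"] by (simp add: fst_emb_cover)
  then obtain n :: int where n: "s' = s + n" by (auto simp: cis_2pi_eq_iff)
  have "cover (y, s) = cover (h_pow n y', s)" using eq cover_shift[OF y(2)] n by simp
  from arg_cong[OF this, of emb_cl] have "emb (h_pow \<lfloor>s\<rfloor> y, frac s) = emb (h_pow \<lfloor>s\<rfloor> (h_pow n y'), frac s)"
    unfolding cover_def prod.case emb_cl_cl .
  then have "h_pow \<lfloor>s\<rfloor> y = h_pow \<lfloor>s\<rfloor> (h_pow n y')" by (rule emb_eq_same_height) (use y in simp_all)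
  then have "y = h_pow n y'" using y by (simp add: h_pow_eq_iff)
  then show ?thesis using that n by blast
qed

lemma cover_same_height: "cover (y, s) = cover (y', s) \<Longrightarrow> y \<in> S \<Longrightarrow> y' \<in> S \<Longrightarrow> y = y'"
  by (erule cover_eqD) auto

lemma continuous_emb_cover_strip: "continuous_on (S \<times> {of_int n..of_int n + 1}) (emb_cl \<circ> cover)"
proof -
  have "continuous_on (S \<times> {of_int n..of_int n + 1}) (\<lambda>p. emb (h_pow n (fst p), snd p - of_int n))"
    by (intro continuous_on_compose2[OF continuous_emb] continuous_intros continuous_on_compose2[OF continuous_h_pow]) auto
  then show ?thesis
    by (rule continuous_on_eq) (auto simp: cover_strip)
qed

lemma continuous_emb_cover_strips: "continuous_on (S \<times> {of_int n..of_int n + real k}) (emb_cl \<circ> cover)"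
proof (induction k)
  case 0
  show ?case by (rule continuous_on_subset[OF continuous_emb_cover_strip[of n]]) auto
next
  case (Suc k)
  have "continuous_on (S \<times> {of_int n + real k..of_int n + real k + 1}) (emb_cl \<circ> cover)"
    using continuous_emb_cover_strip[of "n + int k"] by simp
  then have "continuous_on (S \<times> {of_int n..of_int n + real k} \<union> S \<times> {of_int n + real k..of_int n + real k + 1}) (emb_cl \<circ> cover)"
    using Suc compact_S by (intro continuous_on_closed_Un) (auto simp: compact_Times compact_imp_closed)
  moreover have "S \<times> {of_int n..of_int n + real k} \<union> S \<times> {of_int n + real k..of_int n + real k + 1} = S \<times> {of_int n..of_int n + real (Suc k)}"
    by auto
  ultimately show ?case by simp
qed

lemma continuous_emb_cover_Icc: "continuous_on (S \<times> {a..b}) (emb_cl \<circ> cover)"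
proof -
  obtain k :: nat where k: "b - of_int \<lfloor>a\<rfloor> \<le> real k" using real_arch_simple by blast
  have "s \<in> {of_int \<lfloor>a\<rfloor>..of_int \<lfloor>a\<rfloor> + real k}" if "s \<in> {a..b}" for s
    using that k of_int_floor_le[of a] unfolding atLeastAtMost_iff by linarith
  then show ?thesis
    by (intro continuous_on_subset[OF continuous_emb_cover_strips[of "\<lfloor>a\<rfloor>" k]]) auto
qed

text \<open>Continuity is local, and every point has a neighbourhood in a bounded slab, which
  finitely many closed strips cover.\<close>

lemma continuous_emb_cover: "continuous_on (S \<times> UNIV) (emb_cl \<circ> cover)"
  unfolding continuous_on_eq_continuous_within
proof
  fix p assume p: "p \<in> S \<times> (UNIV :: real set)"
  let ?U = "UNIV \<times> {snd p - 1<..<snd p + 1}"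
  have "continuous_on ((S \<times> UNIV) \<inter> ?U) (emb_cl \<circ> cover)"
    by (rule continuous_on_subset[OF continuous_emb_cover_Icc[of "snd p - 1" "snd p + 1"]]) auto
  then have "continuous (at p within ((S \<times> UNIV) \<inter> ?U)) (emb_cl \<circ> cover)"
    using p by (intro continuous_on_eq_continuous_within[THEN iffD1, rule_format]) (auto simp: mem_Times_iff)
  moreover have "at p within ((S \<times> UNIV) \<inter> ?U) = at p within (S \<times> UNIV)"
    by (rule at_within_nhd[of _ ?U]) (auto simp: mem_Times_iff intro: open_Times)
  ultimately show "continuous (at p within (S \<times> UNIV)) (emb_cl \<circ> cover)" by simp
qed

lemma continuous_cover: "continuous_map (top_of_set (S \<times> UNIV)) M cover"
proof (rule continuous_map_into_M)
  show "cover \<in> topspace (top_of_set (S \<times> UNIV)) \<rightarrow> topspace M" using cover_in by auto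
  have "emb_cl (cover (y, s)) \<in> K" if "y \<in> S" for y s
    using cover_in[OF that, of s] homeomorphic_imp_surjective_map[OF homeomorphic_emb_cl] by auto
  then show "continuous_map (top_of_set (S \<times> UNIV)) (top_of_set K) (emb_cl \<circ> cover)"
    using continuous_emb_cover by auto
qed

lemma cover_surj:
  assumes m: "m \<in> topspace M" and s: "fst (emb_cl m) = cis (2 * pi * s)"
  obtains y where "y \<in> S" "cover (y, s) = m"
proof -
  obtain y0 s0 where m0: "m = cl (y0, s0)" "y0 \<in> S" "0 \<le> s0" "s0 \<le> 1" using m by (auto simp: topspace_M)
  have "cover (y0, s0) = m" using cover_strip[of y0 0 s0] m0 by simp
  moreover have "cis (2 * pi * s) = cis (2 * pi * s0)" using s m0 by (simp add: emb_def)
  then obtain n :: int where "s = s0 + n" by (auto simp: cis_2pi_eq_iff)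
  ultimately have "cover (h_pow (- n) y0, s) = m" using m0 by (simp add: cover_shift h_pow_inverse)
  then show ?thesis using that[of "h_pow (- n) y0"] m0 by simp
qed

text \<open>The height \<open>\<tau>\<close> comes from a continuous logarithm of the circle
  coordinate, which exists because the convex set \<open>Z\<close> is contractible. The height and
  \<open>f\<close> determine the fibre coordinate. It is continuous because \<open>F\<close>, which
  records the height and the image in \<open>K\<close>, is a continuous injection of a compact slab
  and so has a continuous inverse.\<close>

lemma cover_lift:
  fixes Z :: "'z::real_normed_vector set"
  assumes Z: "compact Z" "convex Z" and z0: "z0 \<in> Z"
    and f: "continuous_map (top_of_set Z) M f" and y0: "y0 \<in> S" "f z0 = cover (y0, s0)"
  obtains Y \<tau> where "continuous_on Z Y" "continuous_on Z \<tau>" "Y ` Z \<subseteq> S" "\<And>z. z \<in> Z \<Longrightarrow> cover (Y z, \<tau> z) = f z"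
    "Y z0 = y0" "\<tau> z0 = s0"
proof -
  have "continuous_map (top_of_set Z) (top_of_set K) (emb_cl \<circ> f)"
    using f homeomorphic_imp_continuous_map[OF homeomorphic_emb_cl] by (rule continuous_map_compose)
  then have Ef: "continuous_on Z (emb_cl \<circ> f)" "\<And>z. z \<in> Z \<Longrightarrow> emb_cl (f z) \<in> K" by auto
  have fM: "f z \<in> topspace M" if "z \<in> Z" for z using f that unfolding continuous_map_def by auto
  have norm1: "norm (fst k) = 1" if "k \<in> K" for k using that by (auto simp: K_def emb_def)
  have contc: "continuous_on Z (\<lambda>z. fst (emb_cl (f z)))"
    using Ef(1) unfolding comp_def by (intro continuous_on_fst)
  have nz: "fst (emb_cl (f z)) \<noteq> 0" if "z \<in> Z" for z using norm1[OF Ef(2)[OF that]] by auto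
  obtain g where g: "continuous_on Z g" "\<And>z. z \<in> Z \<Longrightarrow> fst (emb_cl (f z)) = exp (g z)"
  proof (rule continuous_logarithm_on_contractible[OF contc convex_imp_contractible[OF Z(2)]])
    show "fst (emb_cl (f z)) \<noteq> 0" if "z \<in> Z" for z by (rule nz[OF that])
  qed (use that in blast)
  have cis_g: "fst (emb_cl (f z)) = cis (2 * pi * (Im (g z) / (2 * pi)))" if "z \<in> Z" for z
  proof -
    have "Re (g z) = 0"
      using norm1[OF Ef(2)[OF that]] g(2)[OF that] by simp
    then show ?thesis using g(2)[OF that] by (simp add: exp_eq_polar)
  qed
  \<comment> \<open>The added constant is an integer, since both heights give the circle coordinate
    of \<open>f z0\<close>; it makes the lift start at \<open>s0\<close>.\<close>
  define \<tau> where "\<tau> z = Im (g z) / (2 * pi) + (s0 - Im (g z0) / (2 * pi))" for z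
  have cont\<tau>: "continuous_on Z \<tau>" unfolding \<tau>_def using g(1) by (intro continuous_intros) auto
  have "cis (2 * pi * s0) = cis (2 * pi * (Im (g z0) / (2 * pi)))"
    using cis_g[OF z0] fst_emb_cover[of y0 s0] y0 by simp
  then obtain n :: int where n: "s0 = Im (g z0) / (2 * pi) + n" unfolding cis_2pi_eq_iff by blast
  have \<tau>: "fst (emb_cl (f z)) = cis (2 * pi * \<tau> z)" if "z \<in> Z" for z
    unfolding cis_g[OF that] cis_2pi_eq_iff by (rule exI[of _ "- n"]) (simp add: \<tau>_def n)
  have "compact (\<tau> ` Z)" using cont\<tau> Z(1) by (rule compact_continuous_image)
  \<comment> \<open>A bound on the height cuts \<open>S \<times> UNIV\<close> down to a compact
    slab.\<close>
  then obtain c where c: "\<And>z. z \<in> Z \<Longrightarrow> \<bar>\<tau> z\<bar> \<le> c"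
    using bounded_iff[THEN iffD1, OF compact_imp_bounded] by force
  let ?C = "S \<times> {- c..c}"
  define F where "F = (\<lambda>p. (snd p, (emb_cl \<circ> cover) p))"
  have contF: "continuous_on ?C F"
    unfolding F_def by (intro continuous_on_Pair continuous_on_snd continuous_on_id continuous_emb_cover_Icc)
  have compC: "compact ?C" using compact_S by (simp add: compact_Times)
  have injM: "inj_on emb_cl (topspace M)" using homeomorphic_imp_injective_map[OF homeomorphic_emb_cl] .
  have injF: "inj_on F ?C"
  proof (rule inj_onI)
    fix p p' assume p: "p \<in> ?C" "p' \<in> ?C" "F p = F p'"
    obtain y s y' s' where ys: "p = (y, s)" "p' = (y', s')" by force
    then have y: "y \<in> S" "y' \<in> S" and s: "s' = s" and "emb_cl (cover (y, s)) = emb_cl (cover (y', s))"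
      using p by (auto simp: F_def)
    then have "cover (y, s) = cover (y', s)" using injM cover_in by (auto simp: inj_on_eq_iff)
    then have "y = y'" using y by (rule cover_same_height)
    then show "p = p'" using s ys by simp
  qed
  have cont_inv: "continuous_on (F ` ?C) (inv_into ?C F)"
    by (rule continuous_on_inv[OF contF compC]) (use injF in auto)
  have im: "(\<tau> z, emb_cl (f z)) \<in> F ` ?C" if z: "z \<in> Z" for z
  proof -
    obtain y where y: "y \<in> S" "cover (y, \<tau> z) = f z" by (rule cover_surj[OF fM[OF z] \<tau>[OF z]])
    then have "F (y, \<tau> z) = (\<tau> z, emb_cl (f z))" by (simp add: F_def)
    then show ?thesis using c[OF z] y(1) by (intro image_eqI[of _ _ "(y, \<tau> z)"]) auto
  qed
  define Y where "Y z = fst (inv_into ?C F (\<tau> z, emb_cl (f z)))" for z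
  have contY: "continuous_on Z Y"
    unfolding Y_def using cont\<tau> Ef(1) im
    by (intro continuous_on_fst continuous_on_compose2[OF cont_inv] continuous_on_Pair) (auto simp: comp_def)
  have YS: "Y z \<in> S" and YC: "cover (Y z, \<tau> z) = f z" if z: "z \<in> Z" for z
  proof -
    let ?p = "inv_into ?C F (\<tau> z, emb_cl (f z))"
    have p: "?p \<in> ?C" "F ?p = (\<tau> z, emb_cl (f z))" using im[OF z] by (simp_all add: inv_into_into f_inv_into_f)
    show yS: "Y z \<in> S" using p(1) unfolding Y_def by (auto simp: mem_Times_iff)
    have "?p = (Y z, \<tau> z)" using p(2) by (simp add: F_def Y_def prod_eq_iff)
    then have "emb_cl (cover (Y z, \<tau> z)) = emb_cl (f z)" using p(2) by (simp add: F_def)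
    then show "cover (Y z, \<tau> z) = f z" using injM cover_in[OF yS] fM[OF z] by (simp add: inj_on_eq_iff)
  qed
  have \<tau>0: "\<tau> z0 = s0" by (simp add: \<tau>_def)
  have "Y z0 = y0" using cover_same_height[of "Y z0" s0 y0] YC[OF z0] YS[OF z0] y0 \<tau>0 by simp
  then show ?thesis using that contY cont\<tau> YS YC \<tau>0 by blast
qed

end

lemma continuous_integer_valued_constant:
  fixes f :: "'a::topological_space \<Rightarrow> real"
  assumes S: "connected S" and f: "continuous_on S f" and int: "\<And>z. z \<in> S \<Longrightarrow> f z \<in> \<int>"
    and ab: "a \<in> S" "b \<in> S"
  shows "f a = f b"
proof -
  have "f constant_on S"
  proof (rule continuous_discrete_range_constant[OF S f])
    fix x assume x: "x \<in> S"
    have "1 \<le> norm (f y - f x)" if "y \<in> S" "f y \<noteq> f x" for y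
    proof -
      have "f y - f x \<in> \<int>" "f y - f x \<noteq> 0" using int that x by auto
      then show ?thesis by (simp add: Ints_nonzero_abs_ge1)
    qed
    then show "\<exists>e>0. \<forall>y. y \<in> S \<and> f y \<noteq> f x \<longrightarrow> e \<le> norm (f y - f x)" by (intro exI[of _ 1]) auto
  qed
  then show ?thesis using ab by (auto simp: constant_on_def)
qed

section \<open>Lifts of loops, the degree and the stable letter\<close>

locale pointed_mapping_torus = compact_mapping_torus +
  fixes x :: 'a
  assumes x [simp]: "x \<in> S" and hx: "h x = x"
begin

abbreviation "base \<equiv> cl (x, 0)"
abbreviation "\<Gamma> \<equiv> fundamental_group M base"
abbreviation "P \<equiv> fundamental_group (top_of_set S) x"
abbreviation "incl \<equiv> fundamental_group_map M base (\<lambda>y. cl (y, 0))"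

lemma base_in: "base \<in> topspace M"
  using cover_in[OF x, of 0] by (simp add: cover_0)

lemma group_\<Gamma>: "group \<Gamma>"
  by (rule group_fundamental_group[OF base_in])

lemma cover_x: "cover (x, of_int n) = base"
  using cover_shift[OF x, of 0 n] by (simp add: cover_0 h_pow_fixed hx)

lemma cover_eq_base:
  assumes "cover (y, s) = base" "y \<in> S"
  shows "s \<in> \<int>" "y = x"
proof -
  have "cover (x, 0) = cover (y, s)" using assms by (simp add: cover_0)
  then obtain n :: int where n: "s = 0 + n" "x = h_pow n y" by (rule cover_eqD) (use assms in auto)
  show "s \<in> \<int>" using n by simp
  have "y = h_pow (- n) x" using n(2) assms(2) by (simp add: h_pow_inverse)
  then show "y = x" by (simp add: h_pow_fixed hx)
qed

definition lifts :: "(real \<Rightarrow> ('a \<times> real) set) \<Rightarrow> (real \<Rightarrow> 'a) \<Rightarrow> (real \<Rightarrow> real) \<Rightarrow> bool" where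
  "lifts p Y \<tau> \<longleftrightarrow> continuous_on {0..1} Y \<and> continuous_on {0..1} \<tau> \<and> Y ` {0..1} \<subseteq> S \<and>
     (\<forall>t\<in>{0..1}. cover (Y t, \<tau> t) = p t) \<and> Y 0 = x \<and> \<tau> 0 = 0"

lemma ex_lift:
  assumes "p \<in> loops M base"
  obtains Y \<tau> where "lifts p Y \<tau>"
proof -
  have "continuous_map (top_of_set {0..1}) M p" "p 0 = cover (x, 0)"
    using assms by (auto simp: loops_def pathin_def cover_0)
  then obtain Y \<tau> where "continuous_on {0..1} Y" "continuous_on {0..1} \<tau>" "Y ` {0..1} \<subseteq> S"
      "\<And>t. t \<in> {0..1} \<Longrightarrow> cover (Y t, \<tau> t) = p t" "Y 0 = x" "\<tau> 0 = 0"
    using cover_lift[of "{0..1::real}" 0 p x 0] by auto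
  then show ?thesis using that unfolding lifts_def by blast
qed

text \<open>The heights of two lifts differ by a continuous integer-valued function that vanishes at
  0, and at equal heights the fibre coordinate is determined.\<close>

lemma lifts_unique:
  assumes "lifts p Y \<tau>" "lifts p Y' \<tau>'" "t \<in> {0..1}"
  shows "\<tau> t = \<tau>' t" "Y t = Y' t"
proof -
  have c: "cover (Y s, \<tau> s) = cover (Y' s, \<tau>' s)" "Y s \<in> S" "Y' s \<in> S" if "s \<in> {0..1}" for s
    using assms(1,2) that by (auto simp: lifts_def)
  have "\<tau> 0 - \<tau>' 0 = \<tau> t - \<tau>' t"
  proof (rule continuous_integer_valued_constant[of "{0..1::real}" "\<lambda>t. \<tau> t - \<tau>' t"])
    show "continuous_on {0..1} (\<lambda>t. \<tau> t - \<tau>' t)"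
      using assms(1,2) by (auto simp: lifts_def intro!: continuous_intros)
    show "\<tau> s - \<tau>' s \<in> \<int>" if s: "s \<in> {0..1}" for s
    proof -
      obtain n :: int where "\<tau>' s = \<tau> s + n" using cover_eqD[OF c[OF s]] by blast
      then show ?thesis by simp
    qed
  qed (use assms(3) in auto)
  then show t: "\<tau> t = \<tau>' t" using assms(1,2) by (simp add: lifts_def)
  show "Y t = Y' t" using c[OF assms(3)] t by (intro cover_same_height[of _ "\<tau> t"]) auto
qed

lemma lifts_end:
  assumes "p \<in> loops M base" "lifts p Y \<tau>"
  shows "\<tau> 1 \<in> \<int>" "Y 1 = x"
proof -
  have "cover (Y 1, \<tau> 1) = base" "Y 1 \<in> S" using assms by (auto simp: lifts_def loops_def)
  then show "\<tau> 1 \<in> \<int>" "Y 1 = x" by (rule cover_eq_base)+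
qed

text \<open>The homotopy is lifted on the whole square from the corner \<open>(0, 0)\<close>. On the
  two sides that stay at the base point the height is an integer, hence constant, and the fibre
  coordinate is \<open>x\<close>. The other two sides are the given lifts by uniqueness.\<close>

lemma lifts_homotopic:
  assumes p: "p \<in> loops M base" and pq: "path_homotopic M p q"
    and lp: "lifts p Y \<tau>" and lq: "lifts q Y' \<tau>'"
  obtains Z :: "real \<times> real \<Rightarrow> 'a" where "continuous_on ({0..1} \<times> {0..1}) Z" "Z ` ({0..1} \<times> {0..1}) \<subseteq> S"
    "\<And>t. t \<in> {0..1} \<Longrightarrow> Z (0, t) = Y t" "\<And>t. t \<in> {0..1} \<Longrightarrow> Z (1, t) = Y' t"
    "\<And>s. s \<in> {0..1} \<Longrightarrow> Z (s, 0) = x" "\<And>s. s \<in> {0..1} \<Longrightarrow> Z (s, 1) = x" "\<tau> 1 = \<tau>' 1"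
proof -
  let ?I = "top_of_set {0..1::real}"
  let ?Q = "{0..1::real} \<times> {0..1::real}"
  obtain H where H: "continuous_map (prod_topology ?I ?I) M H" "\<And>t. H (0, t) = p t" "\<And>t. H (1, t) = q t"
    "\<And>s. s \<in> {0..1} \<Longrightarrow> H (s, 0) = p 0 \<and> H (s, 1) = p 1"
    using pq unfolding path_homotopic_def homotopic_with_def by blast
  have pb: "p 0 = base" "p 1 = base" using p by (auto simp: loops_def)
  have Q: "compact ?Q" "convex ?Q" "(0, 0) \<in> ?Q" by (auto intro: compact_Times convex_Times)
  have contH: "continuous_map (top_of_set ?Q) M H" using H(1) by (simp only: prod_top_of_set)
  have H00: "H (0, 0) = cover (x, 0)" using H(2) pb by (simp add: cover_0)
  obtain Z \<sigma> where Z: "continuous_on ?Q Z" "continuous_on ?Q \<sigma>" "Z ` ?Q \<subseteq> S"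
    "\<And>z. z \<in> ?Q \<Longrightarrow> cover (Z z, \<sigma> z) = H z" "Z (0, 0) = x" "\<sigma> (0, 0) = 0"
    using cover_lift[OF Q contH x H00] by blast
  have ZS: "Z (s, t) \<in> S" if "s \<in> {0..1}" "t \<in> {0..1}" for s t using Z(3) that by auto
  have cont_const: "continuous_on {0..1} (\<lambda>t. Z (s, t))" "continuous_on {0..1} (\<lambda>t. \<sigma> (s, t))"
    "continuous_on {0..1} (\<lambda>t. \<sigma> (t, s))" if "s \<in> {0..1}" for s
    using that by (auto intro!: continuous_on_compose2[OF Z(1)] continuous_on_compose2[OF Z(2)] continuous_intros)
  have side: "Z (s, e) = x" "\<sigma> (s, e) = \<sigma> (0, e)" if e: "e = 0 \<or> e = 1" and s: "s \<in> {0..1}" for s e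
  proof -
    have b: "cover (Z (r, e), \<sigma> (r, e)) = base" if "r \<in> {0..1}" for r
      using Z(4)[of "(r, e)"] H(4)[OF that] e pb that by auto
    show "Z (s, e) = x" using cover_eq_base(2)[OF b[OF s]] ZS[OF s] e by auto
    show "\<sigma> (s, e) = \<sigma> (0, e)"
    proof (rule continuous_integer_valued_constant[of "{0..1::real}" "\<lambda>r. \<sigma> (r, e)"])
      show "continuous_on {0..1} (\<lambda>r. \<sigma> (r, e))" using cont_const(3) e by auto
      show "\<sigma> (r, e) \<in> \<int>" if "r \<in> {0..1}" for r using cover_eq_base(1)[OF b[OF that]] ZS[OF that] e by auto
    qed (use s in auto)
  qed
  have l0: "lifts p (\<lambda>t. Z (0, t)) (\<lambda>t. \<sigma> (0, t))"
    unfolding lifts_def using cont_const[of 0] ZS Z(4)[of "(0, _)"] H(2) Z(5,6) by auto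
  have l1: "lifts q (\<lambda>t. Z (1, t)) (\<lambda>t. \<sigma> (1, t))"
    unfolding lifts_def using cont_const[of 1] ZS Z(4)[of "(1, _)"] H(3) Z(5,6) side[of 0 1] by auto
  show ?thesis
  proof (rule that[OF Z(1,3)])
    show "Z (0, t) = Y t" if "t \<in> {0..1}" for t using lifts_unique(2)[OF l0 lp that] .
    show "Z (1, t) = Y' t" if "t \<in> {0..1}" for t using lifts_unique(2)[OF l1 lq that] .
    show "Z (s, 0) = x" "Z (s, 1) = x" if "s \<in> {0..1}" for s using side(1) that by auto
    show "\<tau> 1 = \<tau>' 1"
      using lifts_unique(1)[OF l0 lp, of 1] lifts_unique(1)[OF l1 lq, of 1] side(2)[of 1 1] by simp
  qed
qed

text \<open>The final height of a lift, that is, the number of turns in the circle direction of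
  \<open>M\<close>; \<open>deg_eqI\<close> shows independence of the representative.\<close>

definition deg :: "(real \<Rightarrow> ('a \<times> real) set) set \<Rightarrow> int" where
  "deg a = (THE n. \<exists>p Y \<tau>. p \<in> loops M base \<and> a = loop_class M base p \<and> lifts p Y \<tau> \<and> \<tau> 1 = of_int n)"

lemma deg_eqI:
  assumes p: "p \<in> loops M base" and l: "lifts p Y \<tau>" and n: "\<tau> 1 = of_int n"
  shows "deg (loop_class M base p) = n"
  unfolding deg_def
proof (rule the_equality)
  show "\<exists>p' Y \<tau>. p' \<in> loops M base \<and> loop_class M base p = loop_class M base p' \<and> lifts p' Y \<tau> \<and> \<tau> 1 = of_int n"
    using assms by blast
  fix m assume "\<exists>p' Y \<tau>. p' \<in> loops M base \<and> loop_class M base p = loop_class M base p' \<and> lifts p' Y \<tau> \<and> \<tau> 1 = of_int m"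
  then obtain p' Y' \<tau>' where p': "p' \<in> loops M base" "loop_class M base p = loop_class M base p'" "lifts p' Y' \<tau>'" "\<tau>' 1 = of_int m"
    by blast
  then have "path_homotopic M p p'" using loop_class_eq_iff[OF p p'(1)] by simp
  then have "\<tau> 1 = \<tau>' 1" by (rule lifts_homotopic[OF p _ l p'(3)])
  then show "m = n" using n p'(4) by simp
qed

text \<open>The lift of \<open>q\<close> has to continue from \<open>(x, n)\<close>. It is moved
  there by a deck transformation, which also applies \<open>h_pow (- n)\<close> to the fibre
  coordinate.\<close>

lemma lifts_concat:
  assumes p: "p \<in> loops M base" "lifts p Y \<tau>" "\<tau> 1 = of_int n"
    and q: "q \<in> loops M base" "lifts q Y' \<tau>'"
  shows "lifts (loop_concat p q) (loop_concat Y (\<lambda>t. h_pow (- n) (Y' t))) (loop_concat \<tau> (\<lambda>t. \<tau>' t + of_int n))"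
  unfolding lifts_def
proof (intro conjI ballI)
  have Y1: "Y 1 = x" using lifts_end[OF p(1,2)] by simp
  have Y': "Y' ` {0..1} \<subseteq> S" "Y' 0 = x" "\<tau>' 0 = 0" using q(2) by (auto simp: lifts_def)
  have "continuous_on {0..1} (\<lambda>t. h_pow (- n) (Y' t))"
    using q(2) by (intro continuous_on_compose2[OF continuous_h_pow]) (auto simp: lifts_def)
  then show "continuous_on {0..1} (loop_concat Y (\<lambda>t. h_pow (- n) (Y' t)))"
    using p(2) Y1 Y' by (intro continuous_on_loop_concat) (auto simp: lifts_def h_pow_fixed hx)
  show "continuous_on {0..1} (loop_concat \<tau> (\<lambda>t. \<tau>' t + of_int n))"
    using p q by (intro continuous_on_loop_concat continuous_intros) (auto simp: lifts_def)
  show "loop_concat Y (\<lambda>t. h_pow (- n) (Y' t)) ` {0..1} \<subseteq> S"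
    using p(2) Y' by (auto simp: lifts_def loop_concat_def image_subset_iff)
  show "cover (loop_concat Y (\<lambda>t. h_pow (- n) (Y' t)) t, loop_concat \<tau> (\<lambda>t. \<tau>' t + of_int n) t) = loop_concat p q t"
    if t: "t \<in> {0..1}" for t
  proof (cases "t \<le> 1/2")
    case True
    then show ?thesis using p(2) t by (simp add: lifts_def loop_concat_def)
  next
    case False
    then have t': "2 * t - 1 \<in> {0..1}" using t by simp
    then have "Y' (2 * t - 1) \<in> S" using Y' by blast
    then show ?thesis using False q(2) t' by (simp add: lifts_def loop_concat_def cover_shift h_pow_inverse)
  qed
qed (use p(2) in \<open>simp_all add: lifts_def\<close>)

lemma ex_deg:
  assumes p: "p \<in> loops M base"
  obtains Y \<tau> where "lifts p Y \<tau>" "\<tau> 1 = of_int (deg (loop_class M base p))"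
proof -
  obtain Y \<tau> where l: "lifts p Y \<tau>" by (rule ex_lift[OF p])
  then obtain n where n: "\<tau> 1 = of_int n" using lifts_end(1)[OF p l] by (auto elim: Ints_cases)
  then show ?thesis using that[OF l] deg_eqI[OF p l n] by simp
qed

lemma deg_mult:
  assumes "a \<in> carrier \<Gamma>" "b \<in> carrier \<Gamma>"
  shows "deg (a \<otimes>\<^bsub>\<Gamma>\<^esub> b) = deg a + deg b"
proof -
  obtain p q where p: "p \<in> loops M base" "a = loop_class M base p" and q: "q \<in> loops M base" "b = loop_class M base q"
    using assms by (auto simp: carrier_fundamental_group)
  obtain Y \<tau> where lp: "lifts p Y \<tau>" "\<tau> 1 = of_int (deg a)" using ex_deg[OF p(1)] p(2) by blast
  obtain Y' \<tau>' where lq: "lifts q Y' \<tau>'" "\<tau>' 1 = of_int (deg b)" using ex_deg[OF q(1)] q(2) by blast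
  have "deg (loop_class M base (loop_concat p q)) = deg a + deg b"
    by (rule deg_eqI[OF loops_concat[OF p(1) q(1)] lifts_concat[OF p(1) lp q(1) lq(1)]]) (simp add: lq(2))
  then show ?thesis by (simp add: p q mult_fundamental_group)
qed

text \<open>The path is closed because \<open>h\<close> fixes \<open>x\<close>; in the cover it is
  the segment over \<open>x\<close> from height 0 to height 1.\<close>

definition stable :: "(real \<Rightarrow> ('a \<times> real) set) set" where
  "stable = loop_class M base (\<lambda>s. cover (x, s))"

lemma pathin_cover:
  assumes "continuous_on {0..1} Y" "continuous_on {0..1} \<tau>" "Y ` {0..1} \<subseteq> S"
  shows "pathin M (\<lambda>t. cover (Y t, \<tau> t))"
proof -
  have "pathin (top_of_set (S \<times> UNIV)) (\<lambda>t. (Y t, \<tau> t))"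
    unfolding pathin_def using assms by (auto intro!: continuous_intros)
  from pathin_comp[OF this continuous_cover] show ?thesis by (simp add: comp_def)
qed

lemma stable_loop: "(\<lambda>s. cover (x, s)) \<in> loops M base"
proof -
  have "pathin M (\<lambda>s. cover (x, s))" by (rule pathin_cover) auto
  then show ?thesis using cover_x[of 0] cover_x[of 1] by (simp add: loops_def)
qed

lemma stable: "stable \<in> carrier \<Gamma>" "deg stable = 1"
proof -
  show "stable \<in> carrier \<Gamma>" unfolding stable_def by (rule loop_class_in_carrier[OF stable_loop])
  have "lifts (\<lambda>s. cover (x, s)) (\<lambda>_. x) (\<lambda>s. s)" by (auto simp: lifts_def)
  from deg_eqI[OF stable_loop this, of 1] show "deg stable = 1" by (simp add: stable_def)
qed

lemma continuous_fibre: "continuous_map (top_of_set S) M (\<lambda>y. cl (y, 0))"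
proof -
  have "continuous_map (top_of_set S) (top_of_set (S \<times> UNIV)) (\<lambda>y. (y, 0::real))"
    by (auto intro!: continuous_intros)
  from continuous_map_compose[OF this continuous_cover] show ?thesis by (simp add: comp_def cover_0)
qed

lemma fibre_comp: "(\<lambda>y. cl (y, 0)) \<circ> g = (\<lambda>t. cover (g t, 0))"
  by (auto simp: cover_0)

lemma fibre_lifts: "g \<in> loops (top_of_set S) x \<Longrightarrow> lifts ((\<lambda>y. cl (y, 0)) \<circ> g) g (\<lambda>_. 0)"
  by (auto simp: lifts_def loops_def pathin_def cover_0)

text \<open>Each point slides vertically in \<open>S \<times> UNIV\<close>, and \<open>cover\<close>
  projects this homotopy to \<open>M\<close>.\<close>

lemma path_homotopic_level:
  assumes "continuous_on {0..1} Y" "continuous_on {0..1} \<tau>" "Y ` {0..1} \<subseteq> S" "\<tau> 0 = 0" "\<tau> 1 = 0"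
  shows "path_homotopic M (\<lambda>t. cover (Y t, \<tau> t)) (\<lambda>t. cover (Y t, 0))"
proof -
  have "homotopic_paths (S \<times> UNIV) (\<lambda>t. (Y t, \<tau> t)) (\<lambda>t. (Y t, 0))"
  proof (rule homotopic_paths_linear)
    show "closed_segment (Y t, \<tau> t) (Y t, 0) \<subseteq> S \<times> UNIV" if "t \<in> {0..1}" for t
      using assms(3) that by (auto simp: closed_segment_def simp flip: scaleR_add_left)
  qed (use assms in \<open>auto simp: path_def pathstart_def pathfinish_def intro!: continuous_intros\<close>)
  then have "path_homotopic (top_of_set (S \<times> UNIV)) (\<lambda>t. (Y t, \<tau> t)) (\<lambda>t. (Y t, 0))"
    by (simp add: path_homotopic_top_of_set)
  from path_homotopic_comp[OF this continuous_cover] show ?thesis by (simp add: comp_def)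
qed

lemma incl_class: "g \<in> loops (top_of_set S) x \<Longrightarrow> incl (loop_class (top_of_set S) x g) = loop_class M base (\<lambda>t. cover (g t, 0))"
  by (subst fundamental_group_map_class[OF _ continuous_fibre]) (simp_all add: fibre_comp)

lemma incl_hom: "incl \<in> hom P \<Gamma>"
  by (rule fundamental_group_map_hom[OF continuous_fibre]) simp

text \<open>A loop in the fibre is its own lift at height 0. Conversely a lift of a loop of degree 0
  begins and ends at height 0, and flattening it gives a loop in the fibre.\<close>

lemma image_incl: "incl ` carrier P = {a \<in> carrier \<Gamma>. deg a = 0}"
proof
  show "incl ` carrier P \<subseteq> {a \<in> carrier \<Gamma>. deg a = 0}"
  proof
    fix a assume "a \<in> incl ` carrier P"
    then obtain g where g: "g \<in> loops (top_of_set S) x" "a = loop_class M base (\<lambda>t. cover (g t, 0))"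
      by (auto simp: carrier_fundamental_group incl_class)
    have l: "(\<lambda>t. cover (g t, 0)) \<in> loops M base"
      using loops_comp[OF g(1) continuous_fibre] by (simp add: fibre_comp)
    have "deg a = 0"
      unfolding g(2) by (rule deg_eqI[OF l fibre_lifts[OF g(1), unfolded fibre_comp]]) simp
    then show "a \<in> {a \<in> carrier \<Gamma>. deg a = 0}" using loop_class_in_carrier[OF l] g(2) by simp
  qed
  show "{a \<in> carrier \<Gamma>. deg a = 0} \<subseteq> incl ` carrier P"
  proof
    fix a assume "a \<in> {a \<in> carrier \<Gamma>. deg a = 0}"
    then obtain p where p: "p \<in> loops M base" "a = loop_class M base p" "deg a = 0" by (auto simp: carrier_fundamental_group)
    obtain Y \<tau> where l: "lifts p Y \<tau>" "\<tau> 1 = 0" using ex_deg[OF p(1)] p(2,3) by auto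
    have Y1: "Y 1 = x" by (rule lifts_end(2)[OF p(1) l(1)])
    have Y: "Y \<in> loops (top_of_set S) x" using l(1) Y1 by (auto simp: lifts_def loops_def pathin_def)
    have "path_homotopic M p (\<lambda>t. cover (Y t, \<tau> t))"
      using p(1) l(1) by (intro path_homotopic_eq) (auto simp: loops_def lifts_def)
    also have "path_homotopic M \<dots> (\<lambda>t. cover (Y t, 0))"
      using l by (intro path_homotopic_level) (auto simp: lifts_def)
    finally have h: "path_homotopic M p (\<lambda>t. cover (Y t, 0))" .
    have "a = incl (loop_class (top_of_set S) x Y)"
      unfolding p(2) incl_class[OF Y] using loop_class_eq_iff[OF p(1) loops_homotopic[OF p(1) h]] h by simp
    then show "a \<in> incl ` carrier P" using loop_class_in_carrier[OF Y] by blast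
  qed
qed

text \<open>The fibre coordinate of a lifted homotopy is a homotopy in \<open>S\<close>.\<close>

lemma incl_inj: "inj_on incl (carrier P)"
proof (rule inj_onI)
  fix a b assume "a \<in> carrier P" "b \<in> carrier P" and eq: "incl a = incl b"
  then obtain f g where f: "f \<in> loops (top_of_set S) x" "a = loop_class (top_of_set S) x f"
    and g: "g \<in> loops (top_of_set S) x" "b = loop_class (top_of_set S) x g"
    by (auto simp: carrier_fundamental_group)
  note lf = loops_comp[OF f(1) continuous_fibre] and lg = loops_comp[OF g(1) continuous_fibre]
  have "path_homotopic M ((\<lambda>y. cl (y, 0)) \<circ> f) ((\<lambda>y. cl (y, 0)) \<circ> g)"
    using eq loop_class_eq_iff[OF lf lg] f g by (simp add: incl_class fibre_comp)
  then obtain Z :: "real \<times> real \<Rightarrow> 'a" where Z: "continuous_on ({0..1} \<times> {0..1}) Z" "Z ` ({0..1} \<times> {0..1}) \<subseteq> S"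
    "\<And>t. t \<in> {0..1} \<Longrightarrow> Z (0, t) = f t" "\<And>t. t \<in> {0..1} \<Longrightarrow> Z (1, t) = g t"
    "\<And>s. s \<in> {0..1} \<Longrightarrow> Z (s, 0) = x" "\<And>s. s \<in> {0..1} \<Longrightarrow> Z (s, 1) = x"
    by (rule lifts_homotopic[OF lf _ fibre_lifts[OF f(1)] fibre_lifts[OF g(1)]]) blast
  have "path_homotopic (top_of_set S) (\<lambda>t. Z (0, t)) (\<lambda>t. Z (1, t))"
    unfolding path_homotopic_def homotopic_with_def
    by (intro exI[of _ Z]) (use Z in \<open>auto simp: prod_top_of_set\<close>)
  moreover have "path_homotopic (top_of_set S) f (\<lambda>t. Z (0, t))"
    using f(1) Z(3) by (intro path_homotopic_eq) (auto simp: loops_def)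
  moreover have "path_homotopic (top_of_set S) g (\<lambda>t. Z (1, t))"
    using g(1) Z(4) by (intro path_homotopic_eq) (auto simp: loops_def)
  ultimately have "path_homotopic (top_of_set S) f g"
    by (meson path_homotopic_trans path_homotopic_sym)
  then show "a = b" using f g loop_class_eq_iff by metis
qed

text \<open>The lift of the product climbs over \<open>x\<close> to height 1, moves along the fibre
  there and descends. The covering map sends \<open>(y, 1)\<close> to the point under
  \<open>(h y, 0)\<close>, so at height 1 the lift of the loop \<open>h \<circ> g\<close> is
  \<open>g\<close>. Flattening all heights leaves \<open>g\<close>.\<close>

lemma conj_stable:
  assumes "a \<in> carrier P"
  shows "stable \<otimes>\<^bsub>\<Gamma>\<^esub> (incl (fundamental_group_map (top_of_set S) x h a) \<otimes>\<^bsub>\<Gamma>\<^esub> inv\<^bsub>\<Gamma>\<^esub> stable) = incl a"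
proof -
  obtain g where g: "g \<in> loops (top_of_set S) x" "a = loop_class (top_of_set S) x g"
    using assms by (auto simp: carrier_fundamental_group)
  have gS: "g ` {0..1} \<subseteq> S" "continuous_on {0..1} g" "g 0 = x" "g 1 = x"
    using g(1) by (auto simp: loops_def pathin_def)
  have conth: "continuous_map (top_of_set S) (top_of_set S) h" by (rule homeomorphic_imp_continuous_map[OF homeo])
  have hg: "h \<circ> g \<in> loops (top_of_set S) x" using loops_comp[OF g(1) conth] by (simp add: hx)
  let ?t = "\<lambda>s. cover (x, s)"
  let ?u = "\<lambda>t. cover ((h \<circ> g) t, 0)"
  have u: "?u \<in> loops M base" using loops_comp[OF hg continuous_fibre] by (simp add: fibre_comp)
  have v: "(\<lambda>t. cover (g t, 0)) \<in> loops M base" using loops_comp[OF g(1) continuous_fibre] by (simp add: fibre_comp)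
  let ?W = "loop_concat ?t (loop_concat ?u (path_inverse ?t))"
  have W: "?W \<in> loops M base" using stable_loop u by (simp add: loops_concat loops_inverse)
  let ?Y = "loop_concat (\<lambda>_. x) (loop_concat g (\<lambda>_. x))"
  let ?\<tau> = "loop_concat (\<lambda>s. s) (loop_concat (\<lambda>_. 1) (\<lambda>s. 1 - s)) :: real \<Rightarrow> real"
  have "path_homotopic M ?W (\<lambda>t. cover (?Y t, ?\<tau> t))"
  proof (rule path_homotopic_eq)
    show "pathin M ?W" using W by (simp add: loops_def)
    fix t :: real assume t: "t \<in> {0..1}"
    have "cover (g r, 1) = cover (h (g r), 0)" if "r \<in> {0..1}" for r
      using cover_shift[of "g r" 0 1] gS(1) that h_pow_Suc[of "g r" 0] by (auto simp: image_subset_iff)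
    then show "?W t = cover (?Y t, ?\<tau> t)"
      using t by (auto simp: loop_concat_def path_inverse_def)
  qed
  also have "path_homotopic M \<dots> (\<lambda>t. cover (?Y t, 0))"
  proof (rule path_homotopic_level)
    show "continuous_on {0..1} ?Y" using gS by (intro continuous_on_loop_concat) auto
    show "continuous_on {0..1} ?\<tau>" by (intro continuous_on_loop_concat continuous_intros) auto
    show "?Y ` {0..1} \<subseteq> S" using gS by (auto simp: loop_concat_def image_subset_iff)
  qed auto
  also have "path_homotopic M \<dots> (\<lambda>t. cover (g t, 0))"
  proof -
    have pg: "pathin (top_of_set S) g" using g(1) by (simp add: loops_def)
    have r: "path_homotopic (top_of_set S) (loop_concat g (\<lambda>_. x)) g" using path_homotopic_rid[OF pg] gS by simp
    have "path_homotopic (top_of_set S) ?Y (loop_concat (\<lambda>_. x) g)"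
      using r gS by (intro path_homotopic_concat) auto
    also have "path_homotopic (top_of_set S) \<dots> g" using path_homotopic_lid[OF pg] gS by simp
    finally have "path_homotopic (top_of_set S) ?Y g" .
    from path_homotopic_comp[OF this continuous_fibre] show ?thesis by (simp add: fibre_comp)
  qed
  finally have "loop_class M base ?W = loop_class M base (\<lambda>t. cover (g t, 0))"
    using loop_class_eq_iff[OF W v] by simp
  moreover have "loop_class M base ?W = stable \<otimes>\<^bsub>\<Gamma>\<^esub> (loop_class M base ?u \<otimes>\<^bsub>\<Gamma>\<^esub> inv\<^bsub>\<Gamma>\<^esub> stable)"
    unfolding stable_def inv_fundamental_group[OF stable_loop]
    by (simp only: mult_fundamental_group[OF u loops_inverse[OF stable_loop]]
        mult_fundamental_group[OF stable_loop loops_concat[OF u loops_inverse[OF stable_loop]]])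
  moreover have "incl (fundamental_group_map (top_of_set S) x h a) = loop_class M base ?u"
    using incl_class[OF hg] fundamental_group_map_class[OF g(1) conth hx] g(2) by simp
  ultimately show ?thesis using incl_class[OF g(1)] g(2) by simp
qed

end

section \<open>The theorem\<close>

theorem theorem1p3:
  fixes h :: "complex \<times> complex \<Rightarrow> complex \<times> complex"
    and x :: "complex \<times> complex"
    and less :: "(real \<Rightarrow> ((complex \<times> complex) \<times> real) set) set rel"
  assumes "x \<in> punctured_torus_boundary"
    and "is_monodromy h"
    and "hyperbolic h"
    and "untwisted h"
    and "bi_ordering (bundle_group h x) less"
  shows "maximal_convex_subgroup (bundle_group h x) less (fibre_subgroup h x) \<and>
    maximal_convex_subgroup
      ((bundle_group h x)\<lparr>carrier := fibre_subgroup h x\<rparr>)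
      (less \<inter> (fibre_subgroup h x \<times> fibre_subgroup h x))
      (derived (bundle_group h x) (fibre_subgroup h x))"
proof -
  have xT: "x \<in> punctured_torus_set"
    using assms(1) by (auto simp: punctured_torus_boundary_def punctured_torus_set_def)
  have homeo: "homeomorphic_map punctured_torus punctured_torus h" and hx: "h x = x"
    using assms(1,2) by (auto simp: is_monodromy_def)
  have "compact punctured_torus_set"
    unfolding punctured_torus_set_def by (intro compact_diff compact_Times) auto
  then interpret pointed_mapping_torus punctured_torus_set h x
    using homeo xT hx by unfold_locales
  interpret \<Gamma>: group \<Gamma> by (rule group_\<Gamma>)
  interpret P: group P by (rule group_fundamental_group) (simp add: xT)
  interpret incl: group_hom P \<Gamma> incl
    using incl_hom by (simp add: group_hom_def group_hom_axioms_def \<Gamma>.is_group P.is_group)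
  define \<alpha> where "\<alpha> = fundamental_group_map punctured_torus x h"
  have conth: "continuous_map punctured_torus punctured_torus h" by (rule homeomorphic_imp_continuous_map[OF homeo])
  have \<alpha>: "\<alpha> g \<in> carrier P" if "g \<in> carrier P" for g
    using fundamental_group_map_hom[OF conth hx] that by (auto simp: \<alpha>_def hom_def)
  obtain a b where ab: "a \<in> carrier P" "b \<in> carrier P" and gen: "generate P {a, b} = carrier P"
    by (rule punctured_torus_two_generators[OF xT])
  obtain A :: "int ^ 2 ^ 2" where A: "homology_matrix h A" "\<bar>trace A\<bar> > 2" using assms(3) by (auto simp: hyperbolic_def)
  then obtain \<phi> where \<phi>: "\<phi> \<in> iso (homology_group 1 punctured_torus) Z2_group"
    "\<forall>c\<in>carrier (homology_group 1 punctured_torus).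
      \<phi> (hom_induced 1 punctured_torus {} punctured_torus {} h c) = A *v \<phi> c"
    by (auto simp: homology_matrix_def)
  have "path_connectedin euclidean punctured_torus_set"
    using path_connected_punctured_torus by (simp only: path_connectedin_euclidean)
  then have pc: "path_connected_space punctured_torus" by (simp only: path_connectedin_def)
  have xt: "x \<in> topspace punctured_torus" using xT by simp
  note char = fundamental_group_characteristic_polynomial[OF pc xt gen ab homeo hx \<phi>, folded \<alpha>_def]
  define F where "F = incl ` carrier P"
  have gen_F: "F = generate \<Gamma> {incl a, incl b}"
    unfolding F_def gen[symmetric] using incl.generate_img[of "{a, b}"] ab by simp
  \<comment> \<open>\<open>conj_stable\<close> is solved for the image of \<open>\<alpha> g\<close>,
    in the form that the lemma on extensions expects.\<close>
  have conj: "inv\<^bsub>\<Gamma>\<^esub> stable \<otimes>\<^bsub>\<Gamma>\<^esub> incl g \<otimes>\<^bsub>\<Gamma>\<^esub> stable = incl (\<alpha> g)" if g: "g \<in> carrier P" for g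
  proof -
    have c: "incl (\<alpha> g) \<in> carrier \<Gamma>" "stable \<in> carrier \<Gamma>" using \<alpha>[OF g] stable(1) by auto
    have "inv\<^bsub>\<Gamma>\<^esub> stable \<otimes>\<^bsub>\<Gamma>\<^esub> incl g \<otimes>\<^bsub>\<Gamma>\<^esub> stable
        = inv\<^bsub>\<Gamma>\<^esub> stable \<otimes>\<^bsub>\<Gamma>\<^esub> (stable \<otimes>\<^bsub>\<Gamma>\<^esub> (incl (\<alpha> g) \<otimes>\<^bsub>\<Gamma>\<^esub> inv\<^bsub>\<Gamma>\<^esub> stable)) \<otimes>\<^bsub>\<Gamma>\<^esub> stable"
      using conj_stable[OF g] by (simp add: \<alpha>_def)
    also have "\<dots> = (inv\<^bsub>\<Gamma>\<^esub> stable \<otimes>\<^bsub>\<Gamma>\<^esub> stable) \<otimes>\<^bsub>\<Gamma>\<^esub> incl (\<alpha> g) \<otimes>\<^bsub>\<Gamma>\<^esub> (inv\<^bsub>\<Gamma>\<^esub> stable \<otimes>\<^bsub>\<Gamma>\<^esub> stable)"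
      using c by (simp only: \<Gamma>.m_assoc \<Gamma>.m_closed \<Gamma>.inv_closed)
    also have "\<dots> = incl (\<alpha> g)" using c by simp
    finally show ?thesis .
  qed
  \<comment> \<open>By injectivity of \<open>incl\<close> a trivial \<open>F\<close> would make
    \<open>P\<close> trivial, although \<open>P\<close> maps onto \<open>Z2_group\<close>.\<close>
  have nontriv: "F \<noteq> {\<one>\<^bsub>\<Gamma>\<^esub>}"
  proof
    assume F1: "F = {\<one>\<^bsub>\<Gamma>\<^esub>}"
    have "g = \<one>\<^bsub>P\<^esub>" if g: "g \<in> carrier P" for g
    proof (rule inj_onD[OF incl_inj _ g P.one_closed])
      have "incl g \<in> F" unfolding F_def using g by (rule imageI)
      then show "incl g = incl \<one>\<^bsub>P\<^esub>" using F1 by simp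
    qed
    then have "carrier P = {\<one>\<^bsub>P\<^esub>}" using P.one_closed by auto
    then show False using char(2) by simp
  qed
  have CH: "inv\<^bsub>\<Gamma>\<^esub> stable \<otimes>\<^bsub>\<Gamma>\<^esub> (inv\<^bsub>\<Gamma>\<^esub> stable \<otimes>\<^bsub>\<Gamma>\<^esub> f \<otimes>\<^bsub>\<Gamma>\<^esub> stable) \<otimes>\<^bsub>\<Gamma>\<^esub> stable
      \<otimes>\<^bsub>\<Gamma>\<^esub> inv\<^bsub>\<Gamma>\<^esub> ((inv\<^bsub>\<Gamma>\<^esub> stable \<otimes>\<^bsub>\<Gamma>\<^esub> f \<otimes>\<^bsub>\<Gamma>\<^esub> stable) [^]\<^bsub>\<Gamma>\<^esub> trace A) \<otimes>\<^bsub>\<Gamma>\<^esub> f [^]\<^bsub>\<Gamma>\<^esub> det A \<in> derived \<Gamma> F"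
    if f: "f \<in> F" for f
  proof -
    obtain g where "f = incl g" "g \<in> carrier P" using f unfolding F_def by (rule imageE)
    then have g: "g \<in> carrier P" "f = incl g" by simp_all
    have "incl (\<alpha> (\<alpha> g) \<otimes>\<^bsub>P\<^esub> inv\<^bsub>P\<^esub> (\<alpha> g [^]\<^bsub>P\<^esub> trace A) \<otimes>\<^bsub>P\<^esub> g [^]\<^bsub>P\<^esub> det A) \<in> incl ` derived P (carrier P)"
      by (rule imageI[OF char(3)[OF g(1)]])
    \<comment> \<open>A homomorphism carries the derived subgroup onto that of its image, so the
      relation found in \<open>P\<close> holds in \<open>\<Gamma>\<close> modulo
      \<open>derived \<Gamma> F\<close>.\<close>
    also have "incl ` derived P (carrier P) = derived \<Gamma> F" unfolding F_def by (rule incl.derived_img[symmetric]) simp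
    finally show ?thesis using g \<alpha> by (simp add: conj incl.hom_int_pow)
  qed
  have order: "bi_ordering \<Gamma> less" using assms(5) by (simp add: bundle_group_def)
  have "incl a \<in> carrier \<Gamma>" "incl b \<in> carrier \<Gamma>" using ab by auto
  from maximal_convex_subgroups_of_extension[OF \<Gamma>.is_group order deg_mult image_incl[folded F_def] stable gen_F this nontriv CH A(2) char(1)]
  show ?thesis
    unfolding bundle_group_def fibre_subgroup_def F_def by simp
qed

end
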